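(* Let $n,m\ge 0$ be integers and let $a\ge 4$ be an even integer. Let $(W,S)$ be the Coxeter system of rank $n+m+2$ with $S=\{s_1,\dots,s_{n+1},t_1,\dots,t_{m+1}\}$ whose Coxeter matrix has entry $3$ for each of the pairs $\{s_i,s_{i+1}\}$ ($1\le i\le n$) and $\{t_j,t_{j+1}\}$ ($1\le j\le m$), entry $a$ for the pair $\{s_{n+1},t_{m+1}\}$, entry $1$ on the diagonal, and entry $2$ for all other pairs of distinct generators. Thus its Coxeter graph is the path $$s_1 \overset{3}{-} s_2 \overset{3}{-}\cdots \overset{3}{-} s_{n+1}\overset{a}{-} t_{m+1}\overset{3}{-} t_m\overset{3}{-}\cdots\overset{3}{-} t_1 .$$ Let $\widehat{\widetilde R}_{W,S}$ be the associated $\mathbb{Q}$-algebra, and let $R_{\mathfrak F_{Y_1}}$ be the $\mathbb{Q}$-algebra associated to the graph $\Gamma=(S',Y')$ and the set of polynomials $\mathfrak F_{Y_1}$, all as defined in the context. Then there are unital ring isomorphisms $$\widehat{\widetilde R}_{W,S}\;\cong\; R_{\mathfrak F_{Y_1}}\;\cong\; M_{m+n+2}(L_a)\oplus M_{n+1}(\mathbb{Q})\oplus M_{m+1}(\mathbb{Q}).$$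
   Context: **Graphs and path algebras.** A graph $\Gamma=(S,Y)$ (in the sense of Serre) consists of a vertex set $S$, an edge set $Y$, a map $Y\to S\times S$, $y\mapsto(o(y),t(y))$ (origin and terminus), and a map $Y\to Y$, $y\mapsto\bar y$, with $\bar{\bar y}=y$, $\bar y\ne y$ and $o(y)=t(\bar y)$. A path of length $k\ge1$ is a sequence of edges $y_1\cdots y_k$ with $t(y_i)=o(y_{i+1})$ for $1 \le i \le k-1$; paths of length $0$ are the vertices, written $[s]$, $s\in S$, with $o([s])=t([s])=s$. For a commutative ring $A$ with identity, the path algebra $A\Gamma$ is the associative $A$-algebra with $A$-basis the set of all paths, with multiplication given by concatenation: $pq$ is the concatenated path if the terminus of $p$ equals the origin of $q$, and $pq=0$ otherwise. The $[s]$ are orthogonal idempotents, and for finite $S$ the identity is $\sum_{s\in S}[s]$. For $f\in A[t]$ and an edge $y$, $f(y\bar y)$ denotes the evaluation of $f$ at $y\bar y$ in the ring $[o(y)]A\Gamma[o(y)]$, whose identity is $[o(y)]$ (so the constant term of $f$ is multiplied by $[o(y)]$). **Polynomials.** For $n\ge3$, $C_n(t)\in\mathbb{Z}[t]$ is the minimal polynomial of $4\cos^2(\pi/n)$ over $\mathbb{Q}$, and $c_n(t)=\prod_{N\ge3,\;N\mid n}C_N(t)$. Put $L_n=\mathbb{Q}[t]/\langle c_n(t)\rangle$; equivalently $L_n\cong\prod_{N\ge3,\;N\mid n}\mathbb{Q}_N$, where $\mathbb{Q}_N=\mathbb{Q}[t]/\langle C_N(t)\rangle=\mathbb{Q}(4\cos^2(\pi/N))$.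 **The algebra $\widehat{\widetilde R}_{W,S}$.** For a Coxeter system $(W,S)$ of finite rank with $S$ indexed as $\{s_i\}_{1\le i\le N}$ and Coxeter matrix $(m_{ij})$, the graph $\Gamma_{W,S}$ has vertex set $S$ and edges $y_{ij}$ for all $i\ne j$ with $m_{ij}\ge3$, where $o(y_{ij})=s_i$, $t(y_{ij})=s_j$, $\overline{y_{ij}}=y_{ji}$. Let $P_{W,S}=\mathbb{Z}\Gamma_{W,S}$. Let $\widetilde I_{W,S}$ be the two-sided ideal of $P_{W,S}$ generated by the elements $c_{m_{ij}}(y_{ji}y_{ij})$ for all $(i,j)$ with $2<m_{ij}<\infty$, $m_{ij}$ odd, together with the elements $y_{ij}\,c_{m_{ij}}(y_{ji}y_{ij})$ for all $(i,j)$ with $2<m_{ij}<\infty$, $m_{ij}$ even. Set $\widetilde R_{W,S}=P_{W,S}/\widetilde I_{W,S}$ and $\widehat{\widetilde R}_{W,S}=\widetilde R_{W,S}\otimes_{\mathbb{Z}}\mathbb{Q}$. **The algebra $R_{\mathfrak F_{Y_1}}$.** Let $\Gamma=(S',Y')$ be the graph with vertices $S'=\{s'_i,s''_i,t'_j,t''_j \mid 1\le i\le n+1,\ 1\le j\le m+1\}$ and edges $Y'=Y'_+\sqcup\overline{Y'_+}$, where $Y'_+=\{y'_i,y''_i,x'_j,x''_j\mid 1\le i\le n,\ 1\le j\le m\}\cup\{z'\}$ with $o(y'_i)=s'_i$, $t(y'_i)=s'_{i+1}$, $o(y''_i)=s''_i$, $t(y''_i)=s''_{i+1}$, $o(x'_j)=t'_j$,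 $t(x'_j)=t'_{j+1}$, $o(x''_j)=t''_j$, $t(x''_j)=t''_{j+1}$, $o(z')=s'_{n+1}$, $t(z')=t'_{m+1}$. Let $Y_1=Y'$ and let $\mathfrak F_{Y_1}=\{f_y(t)\mid y\in Y_1\}\subset\mathbb{Q}[t]$ be given by $f_y=f_{\bar y}$, $f_{y'_i}=f_{y''_i}=f_{x'_j}=f_{x''_j}=C_3(t)=t-1$ for $1\le i\le n$, $1\le j\le m$, and $f_{z'}=c_a(t)$. Let $I_{\mathfrak F_{Y_1}}$ be the two-sided ideal of $\mathbb{Q}\Gamma$ generated by $\{f_y(y\bar y)\mid y\in Y_1\}$, and set $R_{\mathfrak F_{Y_1}}=\mathbb{Q}\Gamma/I_{\mathfrak F_{Y_1}}$. *)

theory Defs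
  imports
    Complex_Main
    "HOL-Library.Poly_Mapping"
    "HOL-Library.Extended_Nat"
    "HOL-Computational_Algebra.Polynomial"
    "HOL-Algebra.QuotRing"
    "HOL-Algebra.Multiplicative_Group"
    "HOL-Algebra.Generated_Groups"
    "HOL-Algebra.Chinese_Remainder"
    "HOL-Algebra.Algebraic_Closure_Type"
    "Graph_Theory.Arc_Walk"
    "Graph_Theory.Bidirected_Digraph"
    "Jordan_Normal_Form.Matrix"
begin

section \<open>Path algebras\<close>

text \<open>
  A graph in the sense of Serre is a \<^locale>\<open>bidirected_digraph\<close>: a digraph \<open>G\<close> together with the
  edge inversion \<open>arev\<close>, which by the convention of that locale is the identity outside \<open>arcs G\<close>.

  A path is a triple of its origin, its edge sequence and its terminus, so that \<open>[s]\<close> is \<open>(s, [], s)\<close>.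
  Elements of the path algebra are finitely supported functions on paths.
\<close>

type_synonym ('v, 'e) path = "'v \<times> 'e list \<times> 'v"

definition paths :: "('v, 'e) pre_digraph \<Rightarrow> ('v, 'e) path set" where
  "paths G = {(u, p, v). pre_digraph.awalk G u p v}"

definition scale :: "'a::comm_ring_1 \<Rightarrow> ('b \<Rightarrow>\<^sub>0 'a) \<Rightarrow> ('b \<Rightarrow>\<^sub>0 'a)" where
  "scale c f = Poly_Mapping.map ((*) c) f"

definition bilinear_extension ::
  "('b \<Rightarrow> 'b \<Rightarrow> ('b \<Rightarrow>\<^sub>0 'a::comm_ring_1)) \<Rightarrow> ('b \<Rightarrow>\<^sub>0 'a) \<Rightarrow> ('b \<Rightarrow>\<^sub>0 'a) \<Rightarrow> ('b \<Rightarrow>\<^sub>0 'a)" where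
  "bilinear_extension \<mu> f g =
     (\<Sum>p\<in>Poly_Mapping.keys f. \<Sum>q\<in>Poly_Mapping.keys g.
        scale (Poly_Mapping.lookup f p * Poly_Mapping.lookup g q) (\<mu> p q))"

fun path_mult :: "('v, 'e) path \<Rightarrow> ('v, 'e) path \<Rightarrow> (('v, 'e) path \<Rightarrow>\<^sub>0 'a::comm_ring_1)" where
  "path_mult (u, p, v) (u', q, w) = (if v = u' then Poly_Mapping.single (u, p @ q, w) 1 else 0)"

definition path_algebra :: "('v, 'e) pre_digraph \<Rightarrow> (('v, 'e) path \<Rightarrow>\<^sub>0 'a::comm_ring_1) ring" where
  "path_algebra G =
     \<lparr>carrier = {f. Poly_Mapping.keys f \<subseteq> paths G},
      monoid.mult = bilinear_extension path_mult,
      one = (\<Sum>s\<in>verts G. Poly_Mapping.single (s, [], s) 1),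
      zero = 0,
      add = (+)\<rparr>"

definition vertex_elt :: "'v \<Rightarrow> (('v, 'e) path \<Rightarrow>\<^sub>0 'a::comm_ring_1)" where
  "vertex_elt s = Poly_Mapping.single (s, [], s) 1"

definition edge_elt :: "('v, 'e) pre_digraph \<Rightarrow> 'e \<Rightarrow> (('v, 'e) path \<Rightarrow>\<^sub>0 'a::comm_ring_1)" where
  "edge_elt G y = Poly_Mapping.single (tail G y, [y], head G y) 1"

definition corner_ring :: "'r ring \<Rightarrow> 'r \<Rightarrow> 'r ring" where
  "corner_ring R e =
     R\<lparr>carrier := {e \<otimes>\<^bsub>R\<^esub> x \<otimes>\<^bsub>R\<^esub> e | x. x \<in> carrier R}, one := e\<rparr>"

text \<open>The value of \<open>f\<close> at \<open>y\<close> followed by its inverse edge; the power with exponent \<open>0\<close> is \<open>[o(y)]\<close>, the identity of the corner ring.\<close>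

definition eval_return ::
  "('v, 'e) pre_digraph \<Rightarrow> ('e \<Rightarrow> 'e) \<Rightarrow> 'a::comm_ring_1 poly \<Rightarrow> 'e \<Rightarrow> (('v, 'e) path \<Rightarrow>\<^sub>0 'a)" where
  "eval_return G arev f y =
     (\<Sum>k\<le>Polynomial.degree f. scale (Polynomial.coeff f k)
        ((edge_elt G y \<otimes>\<^bsub>path_algebra G\<^esub> edge_elt G (arev y))
           [^]\<^bsub>corner_ring (path_algebra G) (vertex_elt (tail G y))\<^esub> k))"


section \<open>The polynomials\<close>

definition min_poly_rat :: "real \<Rightarrow> rat poly" where
  "min_poly_rat x = (THE p. Polynomial.lead_coeff p = 1 \<and> poly (map_poly of_rat p) x = 0 \<and>
     (\<forall>q. q \<noteq> 0 \<and> poly (map_poly of_rat q) x = 0 \<longrightarrow> Polynomial.degree p \<le> Polynomial.degree q))"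

text \<open>
  The minimal polynomial of \<open>4 cos\<^sup>2(\<pi>/n)\<close> has integer coefficients because this number is an
  algebraic integer; the definition picks the corresponding integer polynomial.
\<close>

definition C_poly :: "nat \<Rightarrow> int poly" where
  "C_poly n = (THE p. map_poly rat_of_int p = min_poly_rat (4 * (cos (pi / real n))\<^sup>2))"

definition c_poly :: "nat \<Rightarrow> int poly" where
  "c_poly n = (\<Prod>N\<in>{N. 3 \<le> N \<and> N dvd n}. C_poly N)"

abbreviation rat_ring :: "rat ring" where
  "rat_ring \<equiv> ring_of_type_algebra"

abbreviation rat_poly_ring :: "rat poly ring" where
  "rat_poly_ring \<equiv> ring_of_type_algebra"

definition L_ring :: "nat \<Rightarrow> rat poly set ring" where
  "L_ring n = rat_poly_ring Quot (Idl\<^bsub>rat_poly_ring\<^esub> {map_poly rat_of_int (c_poly n)})"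


section \<open>Matrix rings and tensor products\<close>

definition matrix_ring :: "nat \<Rightarrow> ('r, 'x) ring_scheme \<Rightarrow> 'r mat ring" where
  "matrix_ring k R =
     \<lparr>carrier = {A \<in> carrier_mat k k. \<forall>i<k. \<forall>j<k. A $$ (i, j) \<in> carrier R},
      monoid.mult = (\<lambda>A B. mat k k (\<lambda>(i, j). \<Oplus>\<^bsub>R\<^esub>l\<in>{..<k}. A $$ (i, l) \<otimes>\<^bsub>R\<^esub> B $$ (l, j))),
      one = mat k k (\<lambda>(i, j). if i = j then \<one>\<^bsub>R\<^esub> else \<zero>\<^bsub>R\<^esub>),
      zero = mat k k (\<lambda>_. \<zero>\<^bsub>R\<^esub>),
      add = (\<lambda>A B. mat k k (\<lambda>(i, j). A $$ (i, j) \<oplus>\<^bsub>R\<^esub> B $$ (i, j)))\<rparr>"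

text \<open>
  The tensor product over the integers: the free abelian group on \<open>carrier R \<times> carrier S\<close> modulo
  biadditivity. The free group carries the ring structure with \<open>(a, b) (c, d) = (a c, b d)\<close>. The
  subgroup spanned by the biadditivity relators is already a two-sided ideal, so it agrees with the
  ideal generated by them.
\<close>

definition free_tensor_ring ::
  "('r, 'x) ring_scheme \<Rightarrow> ('s, 'y) ring_scheme \<Rightarrow> ('r \<times> 's \<Rightarrow>\<^sub>0 int) ring" where
  "free_tensor_ring R S =
     \<lparr>carrier = {f. Poly_Mapping.keys f \<subseteq> carrier R \<times> carrier S},
      monoid.mult = bilinear_extension
        (\<lambda>(a, b) (c, d). Poly_Mapping.single (a \<otimes>\<^bsub>R\<^esub> c, b \<otimes>\<^bsub>S\<^esub> d) 1),
      one = Poly_Mapping.single (\<one>\<^bsub>R\<^esub>, \<one>\<^bsub>S\<^esub>) 1,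
      zero = 0,
      add = (+)\<rparr>"

definition tensor_relators ::
  "('r, 'x) ring_scheme \<Rightarrow> ('s, 'y) ring_scheme \<Rightarrow> ('r \<times> 's \<Rightarrow>\<^sub>0 int) set" where
  "tensor_relators R S =
     {Poly_Mapping.single (a \<oplus>\<^bsub>R\<^esub> a', b) 1 - Poly_Mapping.single (a, b) 1 - Poly_Mapping.single (a', b) 1
        | a a' b. a \<in> carrier R \<and> a' \<in> carrier R \<and> b \<in> carrier S}
   \<union> {Poly_Mapping.single (a, b \<oplus>\<^bsub>S\<^esub> b') 1 - Poly_Mapping.single (a, b) 1 - Poly_Mapping.single (a, b') 1
        | a b b'. a \<in> carrier R \<and> b \<in> carrier S \<and> b' \<in> carrier S}"

definition tensor_ring ::
  "('r, 'x) ring_scheme \<Rightarrow> ('s, 'y) ring_scheme \<Rightarrow> ('r \<times> 's \<Rightarrow>\<^sub>0 int) set ring" where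
  "tensor_ring R S = free_tensor_ring R S Quot (Idl\<^bsub>free_tensor_ring R S\<^esub> (tensor_relators R S))"


section \<open>Coxeter systems\<close>

text \<open>The library's \<^const>\<open>group.ord\<close> is \<open>0\<close> for elements of infinite order.\<close>

definition coxeter_matrix :: "('w, 'x) monoid_scheme \<Rightarrow> 'w \<Rightarrow> 'w \<Rightarrow> enat" where
  "coxeter_matrix W s t =
     (let k = group.ord W (s \<otimes>\<^bsub>W\<^esub> t) in if k = 0 then \<infinity> else enat k)"

inductive coxeter_step :: "('w, 'x) monoid_scheme \<Rightarrow> 'w set \<Rightarrow> 'w list \<Rightarrow> 'w list \<Rightarrow> bool"
  for W S where
  "s \<in> S \<Longrightarrow> t \<in> S \<Longrightarrow> coxeter_matrix W s t = enat k \<Longrightarrow> u \<in> lists S \<Longrightarrow> v \<in> lists S \<Longrightarrow>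
     coxeter_step W S (u @ concat (replicate k [s, t]) @ v) (u @ v)"

text \<open>
  \<open>W\<close> has the presentation with generators \<open>S\<close> and relators \<open>(s t)\<^bsup>m(s,t)\<^esup>\<close> for finite \<open>m(s,t)\<close>.
  As \<open>m(s,s) = 1\<close> makes every generator its own inverse, words in \<open>S\<close> without formal inverses suffice:
  two words with the same value in \<open>W\<close> are related by inserting and deleting relators.
\<close>

definition coxeter_system :: "('w, 'x) monoid_scheme \<Rightarrow> 'w set \<Rightarrow> bool" where
  "coxeter_system W S \<longleftrightarrow>
     group W \<and> finite S \<and> S \<subseteq> carrier W \<and> generate W S = carrier W \<and>
     (\<forall>s\<in>S. group.ord W s = 2) \<and>
     (\<forall>u\<in>lists S. \<forall>v\<in>lists S.
        foldr (\<otimes>\<^bsub>W\<^esub>) u \<one>\<^bsub>W\<^esub> = foldr (\<otimes>\<^bsub>W\<^esub>) v \<one>\<^bsub>W\<^esub> \<longrightarrow> equivclp (coxeter_step W S) u v)"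


section \<open>The algebra of a Coxeter system\<close>

text \<open>The edge from \<open>s\<close> to \<open>t\<close> is the pair \<open>(s, t)\<close>.\<close>

definition coxeter_graph :: "('w, 'x) monoid_scheme \<Rightarrow> 'w set \<Rightarrow> ('w, 'w \<times> 'w) pre_digraph" where
  "coxeter_graph W S =
     \<lparr>verts = S, arcs = {(s, t). s \<in> S \<and> t \<in> S \<and> s \<noteq> t \<and> 3 \<le> coxeter_matrix W s t},
      tail = fst, head = snd\<rparr>"

definition coxeter_rev :: "('w, 'x) monoid_scheme \<Rightarrow> 'w set \<Rightarrow> 'w \<times> 'w \<Rightarrow> 'w \<times> 'w" where
  "coxeter_rev W S y = (if y \<in> arcs (coxeter_graph W S) then prod.swap y else y)"

lemma bidirected_digraph_coxeter_graph:
  assumes "coxeter_system W S"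
  shows "bidirected_digraph (coxeter_graph W S) (coxeter_rev W S)"
proof -
  interpret group W
    using assms by (simp add: coxeter_system_def)
  have inv: "inv\<^bsub>W\<^esub> s = s" if "s \<in> S" for s
  proof -
    have s: "s \<in> carrier W" "ord s = 2"
      using assms that by (auto simp: coxeter_system_def)
    then have "s [^]\<^bsub>W\<^esub> (2::nat) = \<one>\<^bsub>W\<^esub>"
      using pow_ord_eq_1 by metis
    then show ?thesis
      using s by (simp add: numeral_2_eq_2 inv_equality)
  qed
  have sym: "coxeter_matrix W s t = coxeter_matrix W t s" if "s \<in> S" "t \<in> S" for s t
  proof -
    have "s \<in> carrier W" "t \<in> carrier W"
      using assms that by (auto simp: coxeter_system_def)
    then have "ord (s \<otimes>\<^bsub>W\<^esub> t) = ord (t \<otimes>\<^bsub>W\<^esub> s)"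
      using inv that ord_inv[of "s \<otimes>\<^bsub>W\<^esub> t"] by (simp add: inv_mult_group)
    then show ?thesis
      by (simp add: coxeter_matrix_def)
  qed
  show ?thesis
    by unfold_locales (auto simp: coxeter_graph_def coxeter_rev_def sym)
qed

definition coxeter_relators ::
  "('w, 'x) monoid_scheme \<Rightarrow> 'w set \<Rightarrow> (('w, 'w \<times> 'w) path \<Rightarrow>\<^sub>0 int) set" where
  "coxeter_relators W S =
     (let \<Gamma> = coxeter_graph W S; c_ji = (\<lambda>m s t. eval_return \<Gamma> (coxeter_rev W S) (c_poly m) (t, s)) in
      {c_ji m s t | m s t. s \<in> S \<and> t \<in> S \<and> coxeter_matrix W s t = enat m \<and> 2 < m \<and> odd m}
    \<union> {edge_elt \<Gamma> (s, t) \<otimes>\<^bsub>path_algebra \<Gamma>\<^esub> c_ji m s t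
        | m s t. s \<in> S \<and> t \<in> S \<and> coxeter_matrix W s t = enat m \<and> 2 < m \<and> even m})"

definition R_tilde ::
  "('w, 'x) monoid_scheme \<Rightarrow> 'w set \<Rightarrow> (('w, 'w \<times> 'w) path \<Rightarrow>\<^sub>0 int) set ring" where
  "R_tilde W S =
     path_algebra (coxeter_graph W S)
       Quot (Idl\<^bsub>path_algebra (coxeter_graph W S)\<^esub> (coxeter_relators W S))"

definition R_tilde_hat ::
  "('w, 'x) monoid_scheme \<Rightarrow> 'w set \<Rightarrow> ((('w, 'w \<times> 'w) path \<Rightarrow>\<^sub>0 int) set \<times> rat \<Rightarrow>\<^sub>0 int) set ring" where
  "R_tilde_hat W S = tensor_ring (R_tilde W S) rat_ring"


section \<open>The algebra of a graph with polynomials on its edges\<close>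

definition R_frak ::
  "('v, 'e) pre_digraph \<Rightarrow> ('e \<Rightarrow> 'e) \<Rightarrow> 'e set \<Rightarrow> ('e \<Rightarrow> rat poly) \<Rightarrow> (('v, 'e) path \<Rightarrow>\<^sub>0 rat) set ring" where
  "R_frak G arev Y\<^sub>1 f =
     path_algebra G Quot (Idl\<^bsub>path_algebra G\<^esub> {eval_return G arev (f y) y | y. y \<in> Y\<^sub>1})"

text \<open>One prime is written \<open>1\<close>, two primes are written \<open>2\<close>: \<open>S1 i\<close> is \<open>s'\<^sub>i\<close> and \<open>X2 j\<close> is \<open>x''\<^sub>j\<close>.\<close>

datatype vertex = S1 nat | S2 nat | T1 nat | T2 nat

datatype pos_edge = Y1 nat | Y2 nat | X1 nat | X2 nat | Z1

fun pos_tail :: "nat \<Rightarrow> nat \<Rightarrow> pos_edge \<Rightarrow> vertex" where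
  "pos_tail n m (Y1 i) = S1 i"
| "pos_tail n m (Y2 i) = S2 i"
| "pos_tail n m (X1 j) = T1 j"
| "pos_tail n m (X2 j) = T2 j"
| "pos_tail n m Z1 = S1 (n + 1)"

fun pos_head :: "nat \<Rightarrow> nat \<Rightarrow> pos_edge \<Rightarrow> vertex" where
  "pos_head n m (Y1 i) = S1 (i + 1)"
| "pos_head n m (Y2 i) = S2 (i + 1)"
| "pos_head n m (X1 j) = T1 (j + 1)"
| "pos_head n m (X2 j) = T2 (j + 1)"
| "pos_head n m Z1 = T1 (m + 1)"

definition pos_edges :: "nat \<Rightarrow> nat \<Rightarrow> pos_edge set" where
  "pos_edges n m = Y1 ` {1..n} \<union> Y2 ` {1..n} \<union> X1 ` {1..m} \<union> X2 ` {1..m} \<union> {Z1}"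

text \<open>The edge \<open>(y, True)\<close> is \<open>y\<close> itself, and \<open>(y, False)\<close> is its inverse.\<close>

definition doubled_graph :: "nat \<Rightarrow> nat \<Rightarrow> (vertex, pos_edge \<times> bool) pre_digraph" where
  "doubled_graph n m =
     \<lparr>verts = S1 ` {1..n+1} \<union> S2 ` {1..n+1} \<union> T1 ` {1..m+1} \<union> T2 ` {1..m+1},
      arcs = pos_edges n m \<times> UNIV,
      tail = (\<lambda>(y, b). if b then pos_tail n m y else pos_head n m y),
      head = (\<lambda>(y, b). if b then pos_head n m y else pos_tail n m y)\<rparr>"

definition doubled_rev :: "nat \<Rightarrow> nat \<Rightarrow> pos_edge \<times> bool \<Rightarrow> pos_edge \<times> bool" where
  "doubled_rev n m = (\<lambda>(y, b). if y \<in> pos_edges n m then (y, \<not> b) else (y, b))"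

lemma bidirected_digraph_doubled_graph:
  "bidirected_digraph (doubled_graph n m) (doubled_rev n m)"
  by unfold_locales (auto simp: doubled_graph_def doubled_rev_def pos_edges_def split: if_splits)

fun edge_poly :: "nat \<Rightarrow> pos_edge \<times> bool \<Rightarrow> rat poly" where
  "edge_poly a (Z1, b) = map_poly rat_of_int (c_poly a)"
| "edge_poly a (y, b) = map_poly rat_of_int (C_poly 3)"

end

theory Submission
  imports Defs "Jordan_Normal_Form.Char_Poly"
begin

text \<open>
  Both graphs are disjoint unions of lines, in which all edges but one are invertible modulo the
  relations. Give a path the weight \<open>k\<close> if it traverses the inverse of the exceptional edge \<open>k\<close> times.
  Modulo the relations a path depends only on its end points and its weight, so an element \<open>f\<close> of the
  quotient is determined by the matrix of the polynomials \<open>\<Sum>\<^sub>p f(p) t\<^bsup>weight p\<^esup>\<close>, the sum running over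
  the paths with given end points. The remaining relators say that these polynomials count modulo
  \<open>c\<^sub>a\<close> in the doubled graph, and modulo \<open>t c\<^sub>a\<close> at the diagonal blocks of the Coxeter graph. As
  \<open>c\<^sub>a(0) \<noteq> 0\<close>, reduction modulo \<open>c\<^sub>a\<close> makes \<open>t\<close> invertible and so yields the full matrix ring over
  \<open>L\<^sub>a\<close>, while evaluation at \<open>t = 0\<close> yields the two rational matrix rings; in the doubled graph the
  latter come from the two extra components.
\<close>

section \<open>Algebras with structure constants\<close>

text \<open>Sending one crossing of the exceptional edge to 1 and the other to t keeps all entries
  polynomial, but the path algebra does not fill the matrix ring: an entry from the second branch to
  the first is divisible by t, because such a walk crosses backwards at least once. So at t = 0 the
  matrices are block triangular, which is why their diagonal blocks are ring homomorphisms on the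
  Coxeter side. Since a is even, the relators of the exceptional edge begin with that edge there and
  join different branches; returning to the diagonal takes the opposite crossing, and one crossing
  each way costs a factor t. Surjectivity is the Chinese remainder theorem for c_a and t.

  Two obstacles do not come from the graphs. The Coxeter algebra is tensored with the rationals
  after its relations are imposed over the integers; denominators are controlled by writing every
  tensor as x tensor 1/d. And C_n is defined by descriptions, which have a value only because 4
  cos^2(pi/n) is an algebraic integer: a shifted Chebyshev polynomial takes the value 2 there, and
  Gauss's lemma makes the minimal polynomial integral.\<close>

lemma lookup_scale [simp]: "Poly_Mapping.lookup (scale c f) p = c * Poly_Mapping.lookup f p"
  unfolding scale_def by (simp add: Poly_Mapping.map.rep_eq when_def)

lemma scale_single [simp]: "scale c (Poly_Mapping.single p a) = Poly_Mapping.single p (c * a)"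
  by (rule poly_mapping_eqI) (simp add: lookup_single when_def)

lemma scale_0_left [simp]: "scale 0 f = 0"
  by (rule poly_mapping_eqI) simp

lemma scale_0_right [simp]: "scale c 0 = 0"
  by (rule poly_mapping_eqI) simp

lemma scale_1_left [simp]: "scale 1 f = f"
  by (rule poly_mapping_eqI) simp

lemma scale_scale [simp]: "scale a (scale b f) = scale (a * b) f"
  by (rule poly_mapping_eqI) (simp add: mult.assoc)

lemma scale_add_left: "scale (a + b) f = scale a f + scale b f"
  by (rule poly_mapping_eqI) (simp add: lookup_add algebra_simps)

lemma scale_add_right: "scale a (f + g) = scale a f + scale a g"
  by (rule poly_mapping_eqI) (simp add: lookup_add algebra_simps)

lemma scale_diff_right: "scale a (f - g) = scale a f - scale a g"
  by (rule poly_mapping_eqI) (simp add: lookup_minus algebra_simps)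

lemma scale_sum_right: "scale a (sum f A) = (\<Sum>x\<in>A. scale a (f x))"
  by (rule poly_mapping_eqI) (simp add: lookup_sum sum_distrib_left)

lemma scale_minus_1: "scale (- 1) f = - f"
  by (rule poly_mapping_eqI) simp

lemma keys_scale: "Poly_Mapping.keys (scale c f) \<subseteq> Poly_Mapping.keys f"
  by (auto simp: in_keys_iff)

lemma poly_mapping_sum_singles:
  fixes f :: "'b \<Rightarrow>\<^sub>0 'a::comm_monoid_add"
  shows "f = (\<Sum>p\<in>Poly_Mapping.keys f. Poly_Mapping.single p (Poly_Mapping.lookup f p))"
  by (rule poly_mapping_eqI)
    (auto simp: lookup_sum lookup_single when_def sum.delta not_in_keys_iff_lookup_eq_zero)

text \<open>Additive statements about algebra elements reduce to multiples of single basis elements.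
  The support bound is carried along so that closure properties of \<open>B\<close> are available
  for every summand.\<close>

lemma keys_subset_induct [consumes 1, case_names zero single add]:
  fixes f :: "'b \<Rightarrow>\<^sub>0 'a::comm_monoid_add"
  assumes "Poly_Mapping.keys f \<subseteq> B"
    and "P 0"
    and single: "\<And>p c. p \<in> B \<Longrightarrow> P (Poly_Mapping.single p c)"
    and add: "\<And>f g. Poly_Mapping.keys f \<subseteq> B \<Longrightarrow> Poly_Mapping.keys g \<subseteq> B \<Longrightarrow> P f \<Longrightarrow> P g \<Longrightarrow> P (f + g)"
  shows "P f"
proof -
  let ?s = "\<lambda>A. \<Sum>p\<in>A. Poly_Mapping.single p (Poly_Mapping.lookup f p)"
  have "A \<subseteq> B \<Longrightarrow> Poly_Mapping.keys (?s A) \<subseteq> B \<and> P (?s A)" if "finite A" for A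
    using that
  proof (induction A rule: finite_induct)
    case empty
    then show ?case using assms(2) by simp
  next
    case (insert p A)
    have 1: "Poly_Mapping.keys (Poly_Mapping.single p (Poly_Mapping.lookup f p)) \<subseteq> B"
      using insert.prems by auto
    have 2: "Poly_Mapping.keys (?s A) \<subseteq> B" "P (?s A)"
      using insert by auto
    have "P (Poly_Mapping.single p (Poly_Mapping.lookup f p) + ?s A)"
      by (rule add) (use 1 2 single insert.prems in auto)
    moreover have "Poly_Mapping.keys (Poly_Mapping.single p (Poly_Mapping.lookup f p) + ?s A) \<subseteq> B"
      using keys_add 1 2(1) by (metis (no_types, lifting) Un_least subset_trans)
    ultimately show ?case using insert.hyps by simp
  qed
  from this[OF finite_keys assms(1)] show ?thesis
    using poly_mapping_sum_singles[of f] by simp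
qed

text \<open>The coefficient is an argument of \<open>h\<close> instead of a scalar factor because
  the target may live over another ring: \<open>entry\<close> turns it into a monomial,
  \<open>descent\<close> turns integers into rational scalars.\<close>

definition linear_extension :: "('b \<Rightarrow> 'a \<Rightarrow> 'c) \<Rightarrow> ('b \<Rightarrow>\<^sub>0 'a::zero) \<Rightarrow> 'c::comm_monoid_add" where
  "linear_extension h f = (\<Sum>p\<in>Poly_Mapping.keys f. h p (Poly_Mapping.lookup f p))"

locale additive_coefficients =
  fixes h :: "'b \<Rightarrow> 'a::comm_monoid_add \<Rightarrow> 'c::comm_monoid_add"
  assumes zero [simp]: "h p 0 = 0"
    and add: "h p (x + y) = h p x + h p y"
begin

lemma superset:
  assumes "finite A" "Poly_Mapping.keys f \<subseteq> A"
  shows "linear_extension h f = (\<Sum>p\<in>A. h p (Poly_Mapping.lookup f p))"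
  unfolding linear_extension_def
  by (rule sum.mono_neutral_left) (use assms in \<open>auto simp: in_keys_iff\<close>)

lemma extension_zero [simp]: "linear_extension h 0 = 0"
  by (simp add: linear_extension_def)

lemma extension_single [simp]: "linear_extension h (Poly_Mapping.single p c) = h p c"
  by (simp add: linear_extension_def)

lemma extension_add: "linear_extension h (f + g) = linear_extension h f + linear_extension h g"
proof -
  let ?A = "Poly_Mapping.keys f \<union> Poly_Mapping.keys g"
  have "linear_extension h (f + g) = (\<Sum>p\<in>?A. h p (Poly_Mapping.lookup (f + g) p))"
    by (rule superset) (simp_all add: keys_add)
  also have "\<dots> = linear_extension h f + linear_extension h g"
    by (simp add: superset[of ?A f] superset[of ?A g] lookup_add add sum.distrib)
  finally show ?thesis .
qed

lemma extension_sum: "linear_extension h (sum F A) = (\<Sum>x\<in>A. linear_extension h (F x))"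
  by (induction A rule: infinite_finite_induct) (simp_all add: extension_add)

end

text \<open>Summands may be added where a coefficient vanishes, so that elements with different
  supports can be compared over a common index set.\<close>

lemma bilinear_extension_superset:
  assumes "finite A" "Poly_Mapping.keys f \<subseteq> A" "finite B" "Poly_Mapping.keys g \<subseteq> B"
  shows "bilinear_extension \<mu> f g =
    (\<Sum>p\<in>A. \<Sum>q\<in>B. scale (Poly_Mapping.lookup f p * Poly_Mapping.lookup g q) (\<mu> p q))"
proof -
  have "bilinear_extension \<mu> f g = (\<Sum>p\<in>Poly_Mapping.keys f. \<Sum>q\<in>B.
      scale (Poly_Mapping.lookup f p * Poly_Mapping.lookup g q) (\<mu> p q))"
    unfolding bilinear_extension_def
    by (intro sum.cong refl sum.mono_neutral_left) (use assms in \<open>auto simp: in_keys_iff\<close>)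
  also have "\<dots> = (\<Sum>p\<in>A. \<Sum>q\<in>B.
      scale (Poly_Mapping.lookup f p * Poly_Mapping.lookup g q) (\<mu> p q))"
    by (rule sum.mono_neutral_left) (use assms in \<open>auto simp: in_keys_iff\<close>)
  finally show ?thesis .
qed

lemma bilinear_extension_zero [simp]:
  "bilinear_extension \<mu> 0 g = 0" "bilinear_extension \<mu> f 0 = 0"
  by (simp_all add: bilinear_extension_def)

lemma bilinear_extension_single [simp]:
  "bilinear_extension \<mu> (Poly_Mapping.single p a) (Poly_Mapping.single q b) = scale (a * b) (\<mu> p q)"
  by (simp add: bilinear_extension_def)

lemma bilinear_extension_add_left:
  "bilinear_extension \<mu> (f + f') g = bilinear_extension \<mu> f g + bilinear_extension \<mu> f' g"
proof -
  let ?A = "Poly_Mapping.keys f \<union> Poly_Mapping.keys f'" and ?B = "Poly_Mapping.keys g"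
  show ?thesis
    using keys_add[of f f']
    by (simp add: bilinear_extension_superset[of ?A _ ?B] lookup_add distrib_right
        scale_add_left sum.distrib)
qed

lemma bilinear_extension_add_right:
  "bilinear_extension \<mu> f (g + g') = bilinear_extension \<mu> f g + bilinear_extension \<mu> f g'"
proof -
  let ?A = "Poly_Mapping.keys f" and ?B = "Poly_Mapping.keys g \<union> Poly_Mapping.keys g'"
  show ?thesis
    using keys_add[of g g']
    by (simp add: bilinear_extension_superset[of ?A _ ?B] lookup_add distrib_left
        scale_add_left sum.distrib)
qed

lemma bilinear_extension_scale_left:
  "bilinear_extension \<mu> (scale c f) g = scale c (bilinear_extension \<mu> f g)"
  by (subst bilinear_extension_superset[OF finite_keys keys_scale finite_keys order_refl])
    (simp add: scale_sum_right mult.assoc bilinear_extension_def)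

lemma bilinear_extension_scale_right:
  "bilinear_extension \<mu> f (scale c g) = scale c (bilinear_extension \<mu> f g)"
  by (subst bilinear_extension_superset[OF finite_keys order_refl finite_keys keys_scale])
    (simp add: scale_sum_right mult.left_commute bilinear_extension_def)

lemma bilinear_extension_diff_left:
  "bilinear_extension \<mu> (f - f') g = bilinear_extension \<mu> f g - bilinear_extension \<mu> f' g"
  using bilinear_extension_add_left[of \<mu> "f - f'" f' g] by (simp add: algebra_simps)

lemma bilinear_extension_diff_right:
  "bilinear_extension \<mu> f (g - g') = bilinear_extension \<mu> f g - bilinear_extension \<mu> f g'"
  using bilinear_extension_add_right[of \<mu> f "g - g'" g'] by (simp add: algebra_simps)

lemma bilinear_extension_sum_left:
  "bilinear_extension \<mu> (sum F A) g = (\<Sum>x\<in>A. bilinear_extension \<mu> (F x) g)"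
  by (induction A rule: infinite_finite_induct) (simp_all add: bilinear_extension_add_left)

lemma bilinear_extension_sum_right:
  "bilinear_extension \<mu> f (sum G A) = (\<Sum>x\<in>A. bilinear_extension \<mu> f (G x))"
  by (induction A rule: infinite_finite_induct) (simp_all add: bilinear_extension_add_right)

lemma keys_sum_subset:
  assumes "\<And>x. x \<in> A \<Longrightarrow> Poly_Mapping.keys (F x) \<subseteq> B"
  shows "Poly_Mapping.keys (sum F A) \<subseteq> B"
  using assms
proof (induction A rule: infinite_finite_induct)
  case (insert x A)
  have "Poly_Mapping.keys (F x + sum F A) \<subseteq> Poly_Mapping.keys (F x) \<union> Poly_Mapping.keys (sum F A)"
    by (rule keys_add)
  then show ?case using insert by auto
qed auto

definition free_algebra ::
  "'b set \<Rightarrow> ('b \<Rightarrow> 'b \<Rightarrow> ('b \<Rightarrow>\<^sub>0 'a)) \<Rightarrow> ('b \<Rightarrow>\<^sub>0 'a) \<Rightarrow> ('b \<Rightarrow>\<^sub>0 'a::comm_ring_1) ring" where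
  "free_algebra B \<mu> e = \<lparr>carrier = {f. Poly_Mapping.keys f \<subseteq> B},
      monoid.mult = bilinear_extension \<mu>, one = e, zero = 0, add = (+)\<rparr>"

lemma free_algebra_simps [simp]:
  "carrier (free_algebra B \<mu> e) = {f. Poly_Mapping.keys f \<subseteq> B}"
  "monoid.mult (free_algebra B \<mu> e) = bilinear_extension \<mu>"
  "one (free_algebra B \<mu> e) = e"
  "ring.zero (free_algebra B \<mu> e) = 0"
  "ring.add (free_algebra B \<mu> e) = (+)"
  by (simp_all add: free_algebra_def)

text \<open>Associativity and the unit laws are demanded on basis elements only and extend
  multilinearly. The instances are paths under concatenation and the pairs spanning the free group
  behind the tensor product.\<close>

locale structure_constants =
  fixes B :: "'b set" and \<mu> :: "'b \<Rightarrow> 'b \<Rightarrow> ('b \<Rightarrow>\<^sub>0 'a::comm_ring_1)" and e :: "'b \<Rightarrow>\<^sub>0 'a"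
  assumes keys_unit: "Poly_Mapping.keys e \<subseteq> B"
    and keys_mult: "p \<in> B \<Longrightarrow> q \<in> B \<Longrightarrow> Poly_Mapping.keys (\<mu> p q) \<subseteq> B"
    and assoc: "p \<in> B \<Longrightarrow> q \<in> B \<Longrightarrow> r \<in> B \<Longrightarrow>
      bilinear_extension \<mu> (\<mu> p q) (Poly_Mapping.single r 1) =
      bilinear_extension \<mu> (Poly_Mapping.single p 1) (\<mu> q r)"
    and unit_left: "p \<in> B \<Longrightarrow> bilinear_extension \<mu> e (Poly_Mapping.single p 1) = Poly_Mapping.single p 1"
    and unit_right: "p \<in> B \<Longrightarrow> bilinear_extension \<mu> (Poly_Mapping.single p 1) e = Poly_Mapping.single p 1"
begin

lemma keys_bilinear_extension:
  assumes "Poly_Mapping.keys f \<subseteq> B" "Poly_Mapping.keys g \<subseteq> B"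
  shows "Poly_Mapping.keys (bilinear_extension \<mu> f g) \<subseteq> B"
  unfolding bilinear_extension_def
proof (intro keys_sum_subset)
  fix p q assume "p \<in> Poly_Mapping.keys f" "q \<in> Poly_Mapping.keys g"
  then have "Poly_Mapping.keys (\<mu> p q) \<subseteq> B" using assms by (intro keys_mult) auto
  then show "Poly_Mapping.keys (scale (Poly_Mapping.lookup f p * Poly_Mapping.lookup g q) (\<mu> p q)) \<subseteq> B"
    by (rule order_trans[OF keys_scale])
qed

lemma assoc_singles:
  assumes "p \<in> B" "q \<in> B" "r \<in> B"
  shows "bilinear_extension \<mu> (bilinear_extension \<mu> (Poly_Mapping.single p a) (Poly_Mapping.single q b)) (Poly_Mapping.single r c) =
    bilinear_extension \<mu> (Poly_Mapping.single p a) (bilinear_extension \<mu> (Poly_Mapping.single q b) (Poly_Mapping.single r c))"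
proof -
  let ?X = "bilinear_extension \<mu> (Poly_Mapping.single p 1) (\<mu> q r)"
  have 1: "Poly_Mapping.single x k = scale k (Poly_Mapping.single x 1)" for x k
    by simp
  have "bilinear_extension \<mu> (scale (a * b) (\<mu> p q)) (Poly_Mapping.single r c) = scale c (scale (a * b) ?X)"
    by (subst 1, subst bilinear_extension_scale_right, subst bilinear_extension_scale_left, subst assoc[OF assms], rule refl)
  moreover have "bilinear_extension \<mu> (Poly_Mapping.single p a) (scale (b * c) (\<mu> q r)) = scale a (scale (b * c) ?X)"
    by (subst 1, subst bilinear_extension_scale_left, subst bilinear_extension_scale_right, rule refl)
  moreover have "scale c (scale (a * b) ?X) = scale a (scale (b * c) ?X)"
    unfolding scale_scale by (simp only: mult.assoc mult.commute[of c])
  ultimately show ?thesis unfolding bilinear_extension_single by metis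
qed

lemma bilinear_extension_assoc:
  assumes f: "Poly_Mapping.keys f \<subseteq> B" and g: "Poly_Mapping.keys g \<subseteq> B" and h: "Poly_Mapping.keys h \<subseteq> B"
  shows "bilinear_extension \<mu> (bilinear_extension \<mu> f g) h =
    bilinear_extension \<mu> f (bilinear_extension \<mu> g h)"
  using f
proof (induction f rule: keys_subset_induct)
  case (single p a)
  from g show ?case
  proof (induction g rule: keys_subset_induct)
    case (single q b)
    from h show ?case
    proof (induction h rule: keys_subset_induct)
      case (single r c)
      then show ?case using assoc_singles \<open>p \<in> B\<close> \<open>q \<in> B\<close> by blast
    qed (simp_all only: bilinear_extension_add_right bilinear_extension_zero)
  qed (simp_all only: bilinear_extension_add_left bilinear_extension_add_right bilinear_extension_zero)
qed (simp_all only: bilinear_extension_add_left bilinear_extension_zero)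

lemma bilinear_extension_unit_left:
  assumes "Poly_Mapping.keys f \<subseteq> B"
  shows "bilinear_extension \<mu> e f = f"
  using assms
proof (induction f rule: keys_subset_induct)
  case (single p c)
  then have "bilinear_extension \<mu> e (scale c (Poly_Mapping.single p 1)) = scale c (Poly_Mapping.single p 1)"
    by (simp only: bilinear_extension_scale_right unit_left)
  then show ?case by simp
qed (simp_all add: bilinear_extension_add_right)

lemma bilinear_extension_unit_right:
  assumes "Poly_Mapping.keys f \<subseteq> B"
  shows "bilinear_extension \<mu> f e = f"
  using assms
proof (induction f rule: keys_subset_induct)
  case (single p c)
  then have "bilinear_extension \<mu> (scale c (Poly_Mapping.single p 1)) e = scale c (Poly_Mapping.single p 1)"
    by (simp only: bilinear_extension_scale_left unit_right)
  then show ?case by simp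
qed (simp_all add: bilinear_extension_add_left)

lemma ring_free_algebra: "ring (free_algebra B \<mu> e)"
proof (rule ringI)
  show "abelian_group (free_algebra B \<mu> e)"
  proof (rule abelian_groupI)
    fix x y assume "x \<in> carrier (free_algebra B \<mu> e)" "y \<in> carrier (free_algebra B \<mu> e)"
    then show "x \<oplus>\<^bsub>free_algebra B \<mu> e\<^esub> y \<in> carrier (free_algebra B \<mu> e)"
      using keys_add[of x y] by auto
  next
    fix x assume x: "x \<in> carrier (free_algebra B \<mu> e)"
    have "Poly_Mapping.keys (scale (- 1) x) \<subseteq> B" using x keys_scale[of "- 1" x] by auto
    then show "\<exists>y\<in>carrier (free_algebra B \<mu> e). y \<oplus>\<^bsub>free_algebra B \<mu> e\<^esub> x = \<zero>\<^bsub>free_algebra B \<mu> e\<^esub>"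
      by (intro bexI[of _ "scale (- 1) x"]) (simp_all add: scale_minus_1)
  qed (simp_all only: free_algebra_simps mem_Collect_eq keys_zero empty_subsetI add_0 add_0_right ac_simps)
  show "monoid (free_algebra B \<mu> e)"
  proof (rule monoidI)
    fix x y z
    assume "x \<in> carrier (free_algebra B \<mu> e)" "y \<in> carrier (free_algebra B \<mu> e)" "z \<in> carrier (free_algebra B \<mu> e)"
    then show "x \<otimes>\<^bsub>free_algebra B \<mu> e\<^esub> y \<otimes>\<^bsub>free_algebra B \<mu> e\<^esub> z =
        x \<otimes>\<^bsub>free_algebra B \<mu> e\<^esub> (y \<otimes>\<^bsub>free_algebra B \<mu> e\<^esub> z)"
      using bilinear_extension_assoc by simp
  qed (simp_all only: free_algebra_simps mem_Collect_eq keys_unit keys_bilinear_extension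
      bilinear_extension_unit_left bilinear_extension_unit_right)
qed (simp_all only: free_algebra_simps bilinear_extension_add_left bilinear_extension_add_right)

end

section \<open>Ideals, congruences and cosets in these algebras\<close>

locale algebra_ideal = structure_constants B \<mu> e + ideal I "free_algebra B \<mu> e"
  for B :: "'b set" and \<mu> :: "'b \<Rightarrow> 'b \<Rightarrow> ('b \<Rightarrow>\<^sub>0 'a::comm_ring_1)" and e I
begin

lemma keys_mem: "x \<in> I \<Longrightarrow> Poly_Mapping.keys x \<subseteq> B"
  using Icarr by auto

lemma zero_mem [simp]: "0 \<in> I"
  using additive_subgroup.zero_closed[OF is_additive_subgroup] by simp

lemma add_mem: "x \<in> I \<Longrightarrow> y \<in> I \<Longrightarrow> x + y \<in> I"
  using additive_subgroup.a_closed[OF is_additive_subgroup] by simp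

lemma mult_mem_left: "x \<in> I \<Longrightarrow> Poly_Mapping.keys f \<subseteq> B \<Longrightarrow> bilinear_extension \<mu> f x \<in> I"
  using I_l_closed[of x f] by simp

lemma mult_mem_right: "x \<in> I \<Longrightarrow> Poly_Mapping.keys f \<subseteq> B \<Longrightarrow> bilinear_extension \<mu> x f \<in> I"
  using I_r_closed[of x f] by simp

text \<open>The scalar \<open>c\<close> acts as left multiplication by \<open>c\<close> times the
  unit, so a ring ideal is also a submodule.\<close>

lemma scale_mem: assumes "x \<in> I" shows "scale c x \<in> I"
proof -
  have "bilinear_extension \<mu> (scale c e) x \<in> I"
    by (rule mult_mem_left) (use assms keys_scale[of c e] keys_unit in auto)
  then show ?thesis
    by (simp add: bilinear_extension_scale_left bilinear_extension_unit_left keys_mem assms)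
qed

lemma uminus_mem: "x \<in> I \<Longrightarrow> - x \<in> I"
  using scale_mem[of x "- 1"] by (simp add: scale_minus_1)

lemma diff_mem: "x \<in> I \<Longrightarrow> y \<in> I \<Longrightarrow> x - y \<in> I"
  using add_mem[of x "- y"] uminus_mem[of y] by simp

lemma sum_mem: "(\<And>x. x \<in> A \<Longrightarrow> F x \<in> I) \<Longrightarrow> sum F A \<in> I"
  by (induction A rule: infinite_finite_induct) (auto intro: add_mem)

lemma cong_trans: "x - y \<in> I \<Longrightarrow> y - z \<in> I \<Longrightarrow> x - z \<in> I"
  using add_mem[of "x - y" "y - z"] by simp

lemma cong_sym: "x - y \<in> I \<Longrightarrow> y - x \<in> I"
  using uminus_mem[of "x - y"] by simp

lemma cong_add: "x - x' \<in> I \<Longrightarrow> y - y' \<in> I \<Longrightarrow> (x + y) - (x' + y') \<in> I"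
  using add_mem[of "x - x'" "y - y'"] by (simp add: algebra_simps)

lemma cong_mem: "x - y \<in> I \<Longrightarrow> x \<in> I \<longleftrightarrow> y \<in> I"
  using add_mem[of "x - y" y] diff_mem[of x "x - y"] by auto

lemma coset_eq: "I +>\<^bsub>free_algebra B \<mu> e\<^esub> x = {y. y - x \<in> I}"
proof -
  have "y - x \<in> I \<Longrightarrow> y \<in> I +>\<^bsub>free_algebra B \<mu> e\<^esub> x" for y
    unfolding a_r_coset_def' by (rule UN_I[of "y - x"]) simp_all
  then show ?thesis by (auto simp: a_r_coset_def')
qed

lemma coset_eq_iff: "I +>\<^bsub>free_algebra B \<mu> e\<^esub> x = I +>\<^bsub>free_algebra B \<mu> e\<^esub> y \<longleftrightarrow> x - y \<in> I"
proof
  assume "I +>\<^bsub>free_algebra B \<mu> e\<^esub> x = I +>\<^bsub>free_algebra B \<mu> e\<^esub> y"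
  moreover have "x \<in> I +>\<^bsub>free_algebra B \<mu> e\<^esub> x" by (simp add: coset_eq)
  ultimately show "x - y \<in> I" by (simp add: coset_eq)
next
  assume "x - y \<in> I"
  then show "I +>\<^bsub>free_algebra B \<mu> e\<^esub> x = I +>\<^bsub>free_algebra B \<mu> e\<^esub> y"
    unfolding coset_eq using cong_trans cong_sym by blast
qed

end

lemma (in structure_constants) algebra_ideal_genideal:
  assumes "\<And>x. x \<in> J \<Longrightarrow> Poly_Mapping.keys x \<subseteq> B"
  shows "algebra_ideal B \<mu> e (Idl\<^bsub>free_algebra B \<mu> e\<^esub> J)"
proof -
  have "ideal (Idl\<^bsub>free_algebra B \<mu> e\<^esub> J) (free_algebra B \<mu> e)"
    by (rule ring.genideal_ideal[OF ring_free_algebra]) (use assms in auto)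
  then show ?thesis using structure_constants_axioms by (simp add: algebra_ideal_def)
qed

text \<open>Closure under negation comes from multiplying by \<open>scale (- 1) e\<close>.\<close>

lemma (in structure_constants) ideal_free_algebraI:
  assumes "I \<subseteq> {f. Poly_Mapping.keys f \<subseteq> B}" "0 \<in> I" "\<And>x y. x \<in> I \<Longrightarrow> y \<in> I \<Longrightarrow> x + y \<in> I"
    and "\<And>x f. x \<in> I \<Longrightarrow> Poly_Mapping.keys f \<subseteq> B \<Longrightarrow> bilinear_extension \<mu> f x \<in> I"
    and "\<And>x f. x \<in> I \<Longrightarrow> Poly_Mapping.keys f \<subseteq> B \<Longrightarrow> bilinear_extension \<mu> x f \<in> I"
  shows "ideal I (free_algebra B \<mu> e)"
proof (rule idealI)
  let ?R = "free_algebra B \<mu> e"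
  interpret ring ?R by (rule ring_free_algebra)
  show "ring ?R" ..
  show "subgroup I (add_monoid ?R)"
  proof (rule add.subgroupI)
    fix x assume x: "x \<in> I"
    have "bilinear_extension \<mu> (scale (- 1) e) x \<in> I"
      by (rule assms(4)[OF x]) (use keys_scale[of "- 1" e] keys_unit in auto)
    moreover have "bilinear_extension \<mu> (scale (- 1) e) x = - x"
      using x assms(1)
      by (subst bilinear_extension_scale_left) (auto simp: bilinear_extension_unit_left scale_minus_1)
    moreover have "\<ominus>\<^bsub>?R\<^esub> x = - x"
      by (rule minus_equality) (use x assms(1) in auto)
    ultimately show "\<ominus>\<^bsub>?R\<^esub> x \<in> I" by simp
  qed (use assms in auto)
qed (use assms in auto)


section \<open>Path algebras and their integral forms\<close>

lemma path_algebra_eq_free_algebra: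
  "path_algebra G = free_algebra (paths G) path_mult (\<Sum>s\<in>verts G. Poly_Mapping.single (s, [], s) 1)"
  by (simp add: path_algebra_def free_algebra_def)

locale finite_vertex_digraph = wf_digraph G for G :: "('v, 'e) pre_digraph" +
  assumes finite_verts: "finite (verts G)"
begin

lemma mem_paths [simp]: "(u, p, v) \<in> paths G \<longleftrightarrow> awalk u p v"
  by (simp add: paths_def)

sublocale path: structure_constants "paths G"
  "path_mult :: ('v, 'e) path \<Rightarrow> ('v, 'e) path \<Rightarrow> (('v, 'e) path \<Rightarrow>\<^sub>0 'a::comm_ring_1)"
  "\<Sum>s\<in>verts G. Poly_Mapping.single (s, [], s) 1"
proof
  show "Poly_Mapping.keys (\<Sum>s\<in>verts G. Poly_Mapping.single (s, [] :: 'e list, s) (1::'a)) \<subseteq> paths G"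
    by (rule keys_sum_subset) (auto simp: awalk_Nil_iff)
next
  fix p q :: "('v, 'e) path"
  assume "p \<in> paths G" "q \<in> paths G"
  then show "Poly_Mapping.keys (path_mult p q :: ('v, 'e) path \<Rightarrow>\<^sub>0 'a) \<subseteq> paths G"
    by (cases p; cases q) (auto simp del: awalk_append_iff intro: awalk_appendI)
next
  fix p q r :: "('v, 'e) path"
  show "bilinear_extension path_mult (path_mult p q) (Poly_Mapping.single r (1::'a)) =
      bilinear_extension path_mult (Poly_Mapping.single p 1) (path_mult q r)"
    by (cases p; cases q; cases r) auto
next
  fix p :: "('v, 'e) path"
  assume "p \<in> paths G"
  moreover obtain u es v where p: "p = (u, es, v)" by (cases p)
  ultimately have uv: "u \<in> verts G" "v \<in> verts G" by auto
  show "bilinear_extension path_mult (\<Sum>s\<in>verts G. Poly_Mapping.single (s, [], s) 1)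
      (Poly_Mapping.single p (1::'a)) = Poly_Mapping.single p 1"
    by (simp add: p bilinear_extension_sum_left if_distrib[of "scale _"] sum.delta[OF finite_verts] uv cong: if_cong)
  show "bilinear_extension path_mult (Poly_Mapping.single p (1::'a))
      (\<Sum>s\<in>verts G. Poly_Mapping.single (s, [], s) 1) = Poly_Mapping.single p 1"
    by (simp add: p bilinear_extension_sum_right if_distrib[of "scale _"] sum.delta'[OF finite_verts] uv cong: if_cong)
qed

end

section \<open>Extension of coefficients from the integers to the rationals\<close>

definition of_int_coeffs :: "('b \<Rightarrow>\<^sub>0 int) \<Rightarrow> ('b \<Rightarrow>\<^sub>0 rat)" where
  "of_int_coeffs f = Poly_Mapping.map rat_of_int f"

lemma lookup_of_int_coeffs [simp]:
  "Poly_Mapping.lookup (of_int_coeffs f) p = rat_of_int (Poly_Mapping.lookup f p)"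
  by (simp add: of_int_coeffs_def Poly_Mapping.map.rep_eq when_def)

lemma keys_of_int_coeffs [simp]: "Poly_Mapping.keys (of_int_coeffs f) = Poly_Mapping.keys f"
  by (auto simp: in_keys_iff)

lemma of_int_coeffs_single [simp]:
  "of_int_coeffs (Poly_Mapping.single p a) = Poly_Mapping.single p (of_int a)"
  by (rule poly_mapping_eqI) (simp add: lookup_single when_def)

lemma of_int_coeffs_zero [simp]: "of_int_coeffs 0 = 0"
  by (rule poly_mapping_eqI) simp

lemma of_int_coeffs_add: "of_int_coeffs (f + g) = of_int_coeffs f + of_int_coeffs g"
  by (rule poly_mapping_eqI) (simp add: lookup_add)

lemma of_int_coeffs_diff: "of_int_coeffs (f - g) = of_int_coeffs f - of_int_coeffs g"
  by (rule poly_mapping_eqI) (simp add: lookup_minus)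

lemma of_int_coeffs_scale: "of_int_coeffs (scale c f) = scale (of_int c) (of_int_coeffs f)"
  by (rule poly_mapping_eqI) simp

lemma of_int_coeffs_sum: "of_int_coeffs (sum F A) = (\<Sum>x\<in>A. of_int_coeffs (F x))"
  by (induction A rule: infinite_finite_induct) (simp_all add: of_int_coeffs_add)

lemma of_int_coeffs_inject [simp]: "of_int_coeffs f = of_int_coeffs g \<longleftrightarrow> f = g"
  by (auto simp: poly_mapping_eq_iff fun_eq_iff)

lemma of_int_coeffs_bilinear_extension:
  assumes "\<And>p q. of_int_coeffs (\<mu> p q) = \<mu>' p q"
  shows "of_int_coeffs (bilinear_extension \<mu> f g) =
    bilinear_extension \<mu>' (of_int_coeffs f) (of_int_coeffs g)"
  by (simp add: bilinear_extension_def of_int_coeffs_sum of_int_coeffs_scale assms)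

lemma clear_denominators:
  fixes f :: "'b \<Rightarrow>\<^sub>0 rat"
  obtains d :: int and g where "d > 0" "scale (of_int d) f = of_int_coeffs g"
    "Poly_Mapping.keys g \<subseteq> Poly_Mapping.keys f"
proof -
  have "\<exists>d g. d > 0 \<and> scale (of_int d) f = of_int_coeffs g \<and> Poly_Mapping.keys g \<subseteq> B"
    if "Poly_Mapping.keys f \<subseteq> B" for B
    using that
  proof (induction f rule: keys_subset_induct)
    case zero
    show ?case by (intro exI[of _ 1] exI[of _ 0]) simp
  next
    case (single p c)
    obtain a b where ab: "quotient_of c = (a, b)" by force
    then have "b > 0" "c = of_int a / of_int b"
      using quotient_of_denom_pos quotient_of_div by auto
    then have "scale (of_int b) (Poly_Mapping.single p c) = of_int_coeffs (Poly_Mapping.single p a)"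
      by simp
    moreover have "Poly_Mapping.keys (Poly_Mapping.single p a) \<subseteq> B"
      using single by auto
    ultimately show ?case using \<open>b > 0\<close> by blast
  next
    case (add f' f'')
    then obtain d g d' g' where g: "d > 0" "scale (of_int d) f' = of_int_coeffs g" "Poly_Mapping.keys g \<subseteq> B"
      "d' > 0" "scale (of_int d') f'' = of_int_coeffs g'" "Poly_Mapping.keys g' \<subseteq> B" by blast
    have "scale (of_int (d * d')) (f' + f'') =
        scale (of_int d') (scale (of_int d) f') + scale (of_int d) (scale (of_int d') f'')"
      by (simp add: scale_add_right mult.commute)
    also have "\<dots> = of_int_coeffs (scale d' g + scale d g')"
      by (simp only: g of_int_coeffs_add of_int_coeffs_scale)
    finally have "scale (of_int (d * d')) (f' + f'') = of_int_coeffs (scale d' g + scale d g')" .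
    moreover have "Poly_Mapping.keys (scale d' g + scale d g') \<subseteq> B"
      using keys_add[of "scale d' g" "scale d g'"] keys_scale[of d' g] keys_scale[of d g'] g by blast
    ultimately show ?case using g by (metis zero_less_mult_iff)
  qed
  from this[OF order_refl] show ?thesis using that by blast
qed

lemma (in structure_constants) mem_genideal:
  assumes "\<And>x. x \<in> J \<Longrightarrow> Poly_Mapping.keys x \<subseteq> B" "x \<in> J"
  shows "x \<in> Idl\<^bsub>free_algebra B \<mu> e\<^esub> J"
proof -
  have "J \<subseteq> carrier (free_algebra B \<mu> e)" using assms(1) by auto
  from ring.genideal_self[OF ring_free_algebra this] assms(2) show ?thesis by blast
qed

lemma ring_of_type_algebra_simps [simp]:
  "carrier (ring_of_type_algebra :: 'a::comm_ring_1 ring) = UNIV"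
  "\<zero>\<^bsub>(ring_of_type_algebra :: 'a ring)\<^esub> = 0" "\<one>\<^bsub>(ring_of_type_algebra :: 'a ring)\<^esub> = 1"
  "a \<otimes>\<^bsub>(ring_of_type_algebra :: 'a ring)\<^esub> b = a * b" "a \<oplus>\<^bsub>(ring_of_type_algebra :: 'a ring)\<^esub> b = a + b"
  by (simp_all add: ring_of_type_algebra_def)

text \<open>One basis whose integral and rational structure constants agree, with integral relations
  \<open>J\<close>. The aim is that imposing \<open>J\<close> over the integers and then tensoring
  gives the same algebra as imposing \<open>J\<close> over the rationals.\<close>

locale integral_form = ZA: structure_constants B \<mu>\<^sub>Z e\<^sub>Z + QA: structure_constants B \<mu>\<^sub>Q e\<^sub>Q
  for B :: "'b set" and \<mu>\<^sub>Z :: "'b \<Rightarrow> 'b \<Rightarrow> ('b \<Rightarrow>\<^sub>0 int)" and e\<^sub>Z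
    and \<mu>\<^sub>Q :: "'b \<Rightarrow> 'b \<Rightarrow> ('b \<Rightarrow>\<^sub>0 rat)" and e\<^sub>Q +
  fixes J :: "('b \<Rightarrow>\<^sub>0 int) set"
  assumes of_int_mult: "of_int_coeffs (\<mu>\<^sub>Z p q) = \<mu>\<^sub>Q p q"
    and of_int_unit: "of_int_coeffs e\<^sub>Z = e\<^sub>Q"
    and keys_J: "x \<in> J \<Longrightarrow> Poly_Mapping.keys x \<subseteq> B"
begin

abbreviation "Z \<equiv> free_algebra B \<mu>\<^sub>Z e\<^sub>Z"
abbreviation "Q \<equiv> free_algebra B \<mu>\<^sub>Q e\<^sub>Q"
abbreviation "I\<^sub>Z \<equiv> Idl\<^bsub>Z\<^esub> J"
abbreviation "I\<^sub>Q \<equiv> Idl\<^bsub>Q\<^esub> (of_int_coeffs ` J)"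

sublocale IZ: algebra_ideal B \<mu>\<^sub>Z e\<^sub>Z I\<^sub>Z
  by (rule ZA.algebra_ideal_genideal) (rule keys_J)

sublocale IQ: algebra_ideal B \<mu>\<^sub>Q e\<^sub>Q I\<^sub>Q
  by (rule QA.algebra_ideal_genideal) (metis imageE keys_J keys_of_int_coeffs)

lemma of_int_coeffs_mult:
  "of_int_coeffs (bilinear_extension \<mu>\<^sub>Z f g) = bilinear_extension \<mu>\<^sub>Q (of_int_coeffs f) (of_int_coeffs g)"
  by (rule of_int_coeffs_bilinear_extension) (rule of_int_mult)

text \<open>The preimage of \<open>I\<^sub>Q\<close> under extension of coefficients is an ideal
  containing \<open>J\<close>, hence contains the ideal that \<open>J\<close> generates.\<close>

lemma of_int_coeffs_mem: assumes "r \<in> I\<^sub>Z" shows "of_int_coeffs r \<in> I\<^sub>Q"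
proof -
  let ?K = "{r. Poly_Mapping.keys r \<subseteq> B \<and> of_int_coeffs r \<in> I\<^sub>Q}"
  have "I\<^sub>Z \<subseteq> ?K"
  proof (rule ring.genideal_minimal[OF ZA.ring_free_algebra])
    show "ideal ?K Z"
    proof (rule ZA.ideal_free_algebraI)
      fix x y assume "x \<in> ?K" "y \<in> ?K"
      then show "x + y \<in> ?K"
        using keys_add[of x y] by (auto simp: of_int_coeffs_add intro: IQ.add_mem)
    next
      fix x f :: "'b \<Rightarrow>\<^sub>0 int" assume "x \<in> ?K" "Poly_Mapping.keys f \<subseteq> B"
      then show "bilinear_extension \<mu>\<^sub>Z f x \<in> ?K" "bilinear_extension \<mu>\<^sub>Z x f \<in> ?K"
        using IQ.mult_mem_left[of "of_int_coeffs x" "of_int_coeffs f"]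
          IQ.mult_mem_right[of "of_int_coeffs x" "of_int_coeffs f"]
          ZA.keys_bilinear_extension[of f x] ZA.keys_bilinear_extension[of x f]
        by (simp_all add: of_int_coeffs_mult)
    qed auto
    show "J \<subseteq> ?K"
    proof
      fix r assume "r \<in> J"
      then have "of_int_coeffs r \<in> I\<^sub>Q"
        by (intro QA.mem_genideal) (metis imageE keys_J keys_of_int_coeffs, rule imageI)
      then show "r \<in> ?K" using keys_J \<open>r \<in> J\<close> by simp
    qed
  qed
  then show ?thesis using assms by blast
qed

text \<open>Converse to \<open>of_int_coeffs_mem\<close> up to an integer factor: the elements with
  a positive multiple coming from \<open>I\<^sub>Z\<close> form an ideal of \<open>Q\<close> that
  contains the relations. In a product, the denominators of the rational factor are cleared as
  well.\<close>

lemma saturation: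
  assumes "x \<in> I\<^sub>Q"
  obtains N :: int and r where "N > 0" "r \<in> I\<^sub>Z" "scale (of_int N) x = of_int_coeffs r"
proof -
  let ?K = "{x. Poly_Mapping.keys x \<subseteq> B \<and>
    (\<exists>N :: int. \<exists>r\<in>I\<^sub>Z. N > 0 \<and> scale (of_int N) x = of_int_coeffs r)}"
  have "I\<^sub>Q \<subseteq> ?K"
  proof (rule ring.genideal_minimal[OF QA.ring_free_algebra])
    show "ideal ?K Q"
    proof (rule QA.ideal_free_algebraI)
      show "0 \<in> ?K"
        using IZ.zero_mem by (auto intro!: exI[of _ "1::int"] bexI[of _ 0])
    next
      fix x y assume "x \<in> ?K" "y \<in> ?K"
      then obtain N N' :: int and r r' where *: "r \<in> I\<^sub>Z" "N > 0" "scale (of_int N) x = of_int_coeffs r"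
        "r' \<in> I\<^sub>Z" "N' > 0" "scale (of_int N') y = of_int_coeffs r'" "Poly_Mapping.keys x \<subseteq> B" "Poly_Mapping.keys y \<subseteq> B"
        by blast
      have "scale (of_int (N * N')) (x + y) =
          scale (of_int N') (scale (of_int N) x) + scale (of_int N) (scale (of_int N') y)"
        by (simp add: scale_add_right mult.commute)
      also have "\<dots> = of_int_coeffs (scale N' r + scale N r')"
        by (simp only: * of_int_coeffs_add of_int_coeffs_scale)
      finally have "scale (of_int (N * N')) (x + y) = of_int_coeffs (scale N' r + scale N r')" .
      moreover have "scale N' r + scale N r' \<in> I\<^sub>Z"
        using * by (intro IZ.add_mem IZ.scale_mem)
      moreover have "N * N' > 0" using * by simp
      moreover have "Poly_Mapping.keys (x + y) \<subseteq> B" using keys_add[of x y] * by blast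
      ultimately show "x + y \<in> ?K" by blast
    next
      fix x f :: "'b \<Rightarrow>\<^sub>0 rat" assume "x \<in> ?K" and f: "Poly_Mapping.keys f \<subseteq> B"
      then obtain N :: int and r where *: "r \<in> I\<^sub>Z" "N > 0" "scale (of_int N) x = of_int_coeffs r"
        "Poly_Mapping.keys x \<subseteq> B"
        by blast
      obtain d g where d: "d > 0" "scale (of_int d) f = of_int_coeffs g" "Poly_Mapping.keys g \<subseteq> Poly_Mapping.keys f"
        by (rule clear_denominators)
      have g: "Poly_Mapping.keys g \<subseteq> B" using d f by blast
      have pos: "d * N > 0" using d * by simp
      have "scale (of_int (d * N)) (bilinear_extension \<mu>\<^sub>Q f x) =
          bilinear_extension \<mu>\<^sub>Q (scale (of_int d) f) (scale (of_int N) x)"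
        unfolding bilinear_extension_scale_left bilinear_extension_scale_right scale_scale by (simp add: mult.commute)
      also have "\<dots> = of_int_coeffs (bilinear_extension \<mu>\<^sub>Z g r)"
        by (simp only: d * of_int_coeffs_mult)
      finally show "bilinear_extension \<mu>\<^sub>Q f x \<in> ?K"
        using pos IZ.mult_mem_left[OF *(1) g] QA.keys_bilinear_extension[OF f *(4)] by blast
      have "scale (of_int (d * N)) (bilinear_extension \<mu>\<^sub>Q x f) =
          bilinear_extension \<mu>\<^sub>Q (scale (of_int N) x) (scale (of_int d) f)"
        unfolding bilinear_extension_scale_left bilinear_extension_scale_right scale_scale by (simp add: mult.commute)
      also have "\<dots> = of_int_coeffs (bilinear_extension \<mu>\<^sub>Z r g)"
        by (simp only: d * of_int_coeffs_mult)
      finally show "bilinear_extension \<mu>\<^sub>Q x f \<in> ?K"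
        using pos IZ.mult_mem_right[OF *(1) g] QA.keys_bilinear_extension[OF *(4) f] by blast
    qed blast
    show "of_int_coeffs ` J \<subseteq> ?K"
    proof
      fix x assume "x \<in> of_int_coeffs ` J"
      then obtain r where r: "r \<in> J" "x = of_int_coeffs r" by blast
      have "r \<in> I\<^sub>Z"
        by (rule ZA.mem_genideal[OF keys_J r(1)])
      moreover have "scale (of_int 1) x = of_int_coeffs r" using r by simp
      moreover have "Poly_Mapping.keys x \<subseteq> B" using r keys_J by simp
      ultimately show "x \<in> ?K"
        by (intro CollectI conjI exI[of _ 1] bexI[of _ r]) simp_all
    qed
  qed
  then show ?thesis using assms that by blast
qed

section \<open>The tensor product of the integral quotient with the rationals\<close>

abbreviation "R \<equiv> Z Quot I\<^sub>Z"

abbreviation coset where "coset x \<equiv> a_r_coset Z I\<^sub>Z x"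

abbreviation rep :: "('b \<Rightarrow>\<^sub>0 int) set \<Rightarrow> ('b \<Rightarrow>\<^sub>0 int)" where "rep U \<equiv> (SOME x. x \<in> U)"

lemma carrier_R: "carrier R = coset ` {x. Poly_Mapping.keys x \<subseteq> B}"
  by (auto simp: FactRing_def A_RCOSETS_def' )

lemma rep:
  assumes "U \<in> carrier R"
  shows "Poly_Mapping.keys (rep U) \<subseteq> B" "coset (rep U) = U"
proof -
  obtain x where x: "Poly_Mapping.keys x \<subseteq> B" "U = coset x"
    using assms by (auto simp: carrier_R)
  have "x \<in> U" by (simp add: x(2) IZ.coset_eq)
  then have *: "rep U - x \<in> I\<^sub>Z" using someI[of "\<lambda>x. x \<in> U" x] by (simp add: x(2) IZ.coset_eq)
  then show "coset (rep U) = U" unfolding x(2) IZ.coset_eq_iff .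
  show "Poly_Mapping.keys (rep U) \<subseteq> B"
    using keys_add[of "rep U - x" x] IZ.keys_mem[OF *] x(1) by auto
qed

lemma coset_mem: "Poly_Mapping.keys x \<subseteq> B \<Longrightarrow> coset x \<in> carrier R"
  by (auto simp: carrier_R)

lemma rep_coset: "Poly_Mapping.keys x \<subseteq> B \<Longrightarrow> rep (coset x) - x \<in> I\<^sub>Z"
  using rep(2)[of "coset x"] coset_mem IZ.coset_eq_iff by blast

lemma R_simps:
  "Poly_Mapping.keys x \<subseteq> B \<Longrightarrow> Poly_Mapping.keys y \<subseteq> B \<Longrightarrow>
    coset x \<otimes>\<^bsub>R\<^esub> coset y = coset (bilinear_extension \<mu>\<^sub>Z x y)"
  "Poly_Mapping.keys x \<subseteq> B \<Longrightarrow> Poly_Mapping.keys y \<subseteq> B \<Longrightarrow>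
    coset x \<oplus>\<^bsub>R\<^esub> coset y = coset (x + y)"
  "\<one>\<^bsub>R\<^esub> = coset e\<^sub>Z"
  using ring_hom_mult[OF IZ.rcos_ring_hom, of x y] ring_hom_add[OF IZ.rcos_ring_hom, of x y]
    ring_hom_one[OF IZ.rcos_ring_hom] by simp_all

lemma ring_R: "ring R"
  by (rule IZ.quotient_is_ring)

abbreviation \<nu> :: "('b \<Rightarrow>\<^sub>0 int) set \<times> rat \<Rightarrow> ('b \<Rightarrow>\<^sub>0 int) set \<times> rat \<Rightarrow>
    (('b \<Rightarrow>\<^sub>0 int) set \<times> rat \<Rightarrow>\<^sub>0 int)" where
  "\<nu> \<equiv> \<lambda>(a, b) (c, d). Poly_Mapping.single (a \<otimes>\<^bsub>R\<^esub> c, b \<otimes>\<^bsub>rat_ring\<^esub> d) 1"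

sublocale FA: structure_constants "carrier R \<times> UNIV" \<nu> "Poly_Mapping.single (\<one>\<^bsub>R\<^esub>, 1) 1"
proof -
  interpret ring R by (rule ring_R)
  show "structure_constants (carrier R \<times> UNIV) \<nu> (Poly_Mapping.single (\<one>\<^bsub>R\<^esub>, 1) 1)"
    by unfold_locales (auto simp: m_assoc mult.assoc)
qed

lemma free_tensor_eq: "free_tensor_ring R rat_ring =
    free_algebra (carrier R \<times> UNIV) \<nu> (Poly_Mapping.single (\<one>\<^bsub>R\<^esub>, 1) 1)"
  by (simp add: free_tensor_ring_def free_algebra_def)

abbreviation "F \<equiv> free_tensor_ring R rat_ring"
abbreviation "T \<equiv> Idl\<^bsub>F\<^esub> (tensor_relators R rat_ring)"

lemma keys_relators:
  assumes "x \<in> tensor_relators R rat_ring"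
  shows "Poly_Mapping.keys x \<subseteq> carrier R \<times> UNIV"
proof -
  interpret ring R by (rule ring_R)
  have d: "Poly_Mapping.keys (Poly_Mapping.single p 1 - Poly_Mapping.single q 1 - Poly_Mapping.single r (1::int))
      \<subseteq> carrier R \<times> UNIV" if "p \<in> carrier R \<times> UNIV" "q \<in> carrier R \<times> UNIV" "r \<in> carrier R \<times> UNIV" for p q r
    using that keys_diff[of "Poly_Mapping.single p 1 - Poly_Mapping.single q 1" "Poly_Mapping.single r (1::int)"]
      keys_diff[of "Poly_Mapping.single p 1" "Poly_Mapping.single q (1::int)"]
    by (auto split: if_splits)
  show ?thesis
    using assms unfolding tensor_relators_def
    by (elim UnE CollectE exE conjE; hypsubst; intro d) simp_all
qed

sublocale IT: algebra_ideal "carrier R \<times> UNIV" \<nu> "Poly_Mapping.single (\<one>\<^bsub>R\<^esub>, 1) 1" T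
  unfolding free_tensor_eq by (rule FA.algebra_ideal_genideal) (rule keys_relators)

lemma relator_mem: "x \<in> tensor_relators R rat_ring \<Longrightarrow> x \<in> T"
  unfolding free_tensor_eq by (rule FA.mem_genideal[OF keys_relators])

abbreviation pure where "pure x q \<equiv> Poly_Mapping.single (coset x, q :: rat) (1::int)"

lemma pure_add_left:
  assumes "Poly_Mapping.keys x \<subseteq> B" "Poly_Mapping.keys y \<subseteq> B"
  shows "pure (x + y) q - pure x q - pure y q \<in> T"
proof -
  have "pure (x + y) q - pure x q - pure y q \<in> tensor_relators R rat_ring"
    unfolding tensor_relators_def R_simps(2)[OF assms, symmetric]
    using assms coset_mem by (intro UnI1 CollectI exI[of _ "coset x"] exI[of _ "coset y"] exI[of _ q]) simp
  then show ?thesis by (rule relator_mem)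
qed

lemma pure_add_right:
  assumes "Poly_Mapping.keys x \<subseteq> B"
  shows "pure x (p + q) - pure x p - pure x q \<in> T"
proof -
  have "pure x (p + q) - pure x p - pure x q \<in> tensor_relators R rat_ring"
    unfolding tensor_relators_def
    using assms coset_mem by (intro UnI2 CollectI exI[of _ "coset x"] exI[of _ p] exI[of _ q]) simp
  then show ?thesis by (rule relator_mem)
qed

text \<open>Induction from 0 in both directions. It turns additivity of \<open>pure\<close> in
  either argument into compatibility with integer multiples.\<close>

lemma int_multiple_mem:
  fixes f :: "int \<Rightarrow> (('b \<Rightarrow>\<^sub>0 int) set \<times> rat \<Rightarrow>\<^sub>0 int)"
  assumes add: "\<And>a b. f (a + b) - f a - f b \<in> T"
  shows "f k - scale k (f 1) \<in> T"
proof (induction k rule: int_induct[where k = 0])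
  case base
  show ?case using IT.uminus_mem[OF add[of 0 0]] by simp
next
  case (step1 i)
  show ?case using IT.add_mem[OF add[of i 1] step1(2)] by (simp add: scale_add_left algebra_simps)
next
  case (step2 i)
  have "scale (i - 1) (f 1) = scale i (f 1) - f 1"
    using scale_add_left[of "i - 1" 1 "f 1"] by simp
  then have "f (i - 1) - scale (i - 1) (f 1) = (f i - scale i (f 1)) - (f (i - 1 + 1) - f (i - 1) - f 1)"
    by simp
  then show ?case using IT.diff_mem[OF step2(2) add[of "i - 1" 1]] by (simp only:)
qed

lemma keys_scale_B: "Poly_Mapping.keys x \<subseteq> B \<Longrightarrow> Poly_Mapping.keys (scale c x) \<subseteq> B"
  by (rule order_trans[OF keys_scale])

lemma pure_multiple_right:
  assumes "Poly_Mapping.keys x \<subseteq> B"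
  shows "pure x (of_int k * q) - scale k (pure x q) \<in> T"
  using int_multiple_mem[of "\<lambda>k. pure x (of_int k * q)" k] pure_add_right[OF assms]
  by (simp add: algebra_simps)

lemma pure_multiple_left:
  assumes "Poly_Mapping.keys x \<subseteq> B"
  shows "pure (scale k x) q - scale k (pure x q) \<in> T"
  using int_multiple_mem[of "\<lambda>k. pure (scale k x) q" k] pure_add_left[OF keys_scale_B keys_scale_B, OF assms assms]
  by (simp add: scale_add_left)

text \<open>Both tensors are congruent to k times \<open>pure x q\<close>, so integers may cross the
  tensor sign.\<close>

lemma pure_move:
  assumes "Poly_Mapping.keys x \<subseteq> B"
  shows "pure (scale k x) q - pure x (of_int k * q) \<in> T"
  by (rule IT.cong_trans[OF pure_multiple_left[OF assms] IT.cong_sym[OF pure_multiple_right[OF assms]]])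

lemma pure_zero: "pure 0 q \<in> T"
  using IT.uminus_mem[OF pure_add_left[of 0 0 q]] by simp

text \<open>Over a common denominator a sum of tensors collapses to a single one: x/d + y/d' = (d' x
  + d y)/(d d'). This reduces the kernel of \<open>descent\<close> to single tensors.\<close>

lemma pure_form:
  assumes "Poly_Mapping.keys f \<subseteq> carrier R \<times> UNIV"
  shows "\<exists>x d. Poly_Mapping.keys x \<subseteq> B \<and> d > 0 \<and> f - pure x (1 / of_int d) \<in> T"
  using assms
proof (induction f rule: keys_subset_induct)
  case zero
  show ?case
    using IT.uminus_mem[OF pure_zero[of 1]] by (intro exI[of _ 0] exI[of _ 1]) simp
next
  case (single Uq k)
  then obtain x q where x: "Poly_Mapping.keys x \<subseteq> B" "Uq = (coset x, q)"
    by (auto simp: carrier_R)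
  obtain a b where ab: "quotient_of (of_int k * q) = (a, b)" by force
  then have b: "b > 0" "of_int k * q = of_int a * (1 / of_int b)"
    using quotient_of_denom_pos quotient_of_div by auto
  \<comment> \<open>The coefficient k is absorbed into the rational factor, whose numerator a then
    moves over to x.\<close>
  have "Poly_Mapping.single Uq k - pure (scale a x) (1 / of_int b) \<in> T"
  proof (rule IT.cong_trans)
    show "Poly_Mapping.single Uq k - pure x (of_int k * q) \<in> T"
      using IT.cong_sym[OF pure_multiple_right[OF x(1), of k q]] x(2) by simp
    show "pure x (of_int k * q) - pure (scale a x) (1 / of_int b) \<in> T"
      unfolding b(2) by (rule IT.cong_sym[OF pure_move[OF x(1)]])
  qed
  then show ?case using b(1) keys_scale_B[OF x(1)] by blast
next
  case (add f g)
  then obtain x d y d' where *: "Poly_Mapping.keys x \<subseteq> B" "d > 0" "f - pure x (1 / of_int d) \<in> T"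
    "Poly_Mapping.keys y \<subseteq> B" "d' > 0" "g - pure y (1 / of_int d') \<in> T" by blast
  \<comment> \<open>Both tensors are rewritten over the common denominator d d'.\<close>
  let ?q = "1 / of_int (d * d') :: rat"
  have q: "of_int d' * ?q = 1 / of_int d" "of_int d * ?q = 1 / of_int d'"
    using * by simp_all
  have 1: "f - pure (scale d' x) ?q \<in> T"
    using *(3) IT.cong_sym[OF pure_move[OF *(1), of d' ?q]] unfolding q by (rule IT.cong_trans)
  have 2: "g - pure (scale d y) ?q \<in> T"
    using *(6) IT.cong_sym[OF pure_move[OF *(4), of d ?q]] unfolding q by (rule IT.cong_trans)
  have "(f + g) - pure (scale d' x + scale d y) ?q \<in> T"
    using IT.diff_mem[OF IT.cong_add[OF 1 2] pure_add_left[OF keys_scale_B[OF *(1), of d'] keys_scale_B[OF *(4), of d], of ?q]]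
    by (simp add: algebra_simps)
  moreover have "Poly_Mapping.keys (scale d' x + scale d y) \<subseteq> B"
    using keys_add[of "scale d' x" "scale d y"] keys_scale_B[OF *(1), of d'] keys_scale_B[OF *(4), of d] by blast
  moreover have "d * d' > 0" using * by simp
  ultimately show ?case by blast
qed

text \<open>Since \<open>rep\<close> picks representatives arbitrarily, the resulting map on the
  free group is exactly additive, but it respects products and the unit only modulo
  \<open>I\<^sub>Q\<close>.\<close>

definition descent_coeff where
  "descent_coeff = (\<lambda>(U, q) (k::int). scale (of_int k * q :: rat) (of_int_coeffs (rep U)))"

lemma descent_coeff_pair [simp]: "descent_coeff (U, q) k = scale (of_int k * q) (of_int_coeffs (rep U))"
  by (simp add: descent_coeff_def)

sublocale descent: additive_coefficients descent_coeff
  by unfold_locales (auto simp: descent_coeff_def distrib_right scale_add_left)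

abbreviation descent where "descent \<equiv> linear_extension descent_coeff"

lemma descent_diff: "descent (f - g) = descent f - descent g"
  using descent.extension_add[of "f - g" g] by (simp add: algebra_simps)

lemma keys_rep: "U \<in> carrier R \<Longrightarrow> Poly_Mapping.keys (of_int_coeffs (rep U)) \<subseteq> B"
  using rep(1) by simp

lemma descent_pure:
  assumes "Poly_Mapping.keys x \<subseteq> B"
  shows "descent (pure x q) - scale q (of_int_coeffs x) \<in> I\<^sub>Q"
  using IQ.scale_mem[OF of_int_coeffs_mem[OF rep_coset[OF assms]], of q]
  by (simp add: of_int_coeffs_diff scale_diff_right)

lemma keys_descent:
  assumes "Poly_Mapping.keys f \<subseteq> carrier R \<times> UNIV"
  shows "Poly_Mapping.keys (descent f) \<subseteq> B"
  using assms
proof (induction f rule: keys_subset_induct)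
  case (single Uq k)
  obtain U q where Uq: "Uq = (U, q)" by (cases Uq)
  have "U \<in> carrier R" using single Uq by simp
  then have "Poly_Mapping.keys (of_int_coeffs (rep U)) \<subseteq> B" by (rule keys_rep)
  then show ?case unfolding Uq using keys_scale[of "of_int k * q" "of_int_coeffs (rep U)"]
    by auto
next
  case (add f g)
  then show ?case using keys_add[of "descent f" "descent g"] by (auto simp: descent.extension_add)
qed simp

lemma descent_mult:
  assumes "Poly_Mapping.keys f \<subseteq> carrier R \<times> UNIV" "Poly_Mapping.keys g \<subseteq> carrier R \<times> UNIV"
  shows "descent (bilinear_extension \<nu> f g) - bilinear_extension \<mu>\<^sub>Q (descent f) (descent g) \<in> I\<^sub>Q"
  using assms(1)
proof (induction f rule: keys_subset_induct)
  case (single Uq k)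
  obtain U q where Uq: "Uq = (U, q)" by (cases Uq)
  have U: "U \<in> carrier R" using single Uq by simp
  from assms(2) show ?case
  proof (induction g rule: keys_subset_induct)
    case (single Yr l)
    obtain Y r where Yr: "Yr = (Y, r)" by (cases Yr)
    have Y: "Y \<in> carrier R" using single Yr by simp
    have UY: "U \<otimes>\<^bsub>R\<^esub> Y = coset (bilinear_extension \<mu>\<^sub>Z (rep U) (rep Y))"
      using R_simps(1)[OF rep(1) rep(1), OF U Y] rep(2) U Y by simp
    have "rep (U \<otimes>\<^bsub>R\<^esub> Y) - bilinear_extension \<mu>\<^sub>Z (rep U) (rep Y) \<in> I\<^sub>Z"
      unfolding UY by (rule rep_coset, rule ZA.keys_bilinear_extension) (use rep(1) U Y in auto)
    from IQ.scale_mem[OF of_int_coeffs_mem[OF this], of "of_int (k * l) * (q * r)"]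
    show ?case
      unfolding Uq Yr
      by (simp add: of_int_coeffs_diff of_int_coeffs_mult scale_diff_right
          bilinear_extension_scale_left bilinear_extension_scale_right ac_simps)
  next
    case (add g g')
    show ?case using IQ.add_mem[OF add(3,4)]
      by (simp add: bilinear_extension_add_right descent.extension_add algebra_simps)
  qed simp
next
  case (add f f')
  show ?case using IQ.add_mem[OF add(3,4)]
    by (simp add: bilinear_extension_add_left descent.extension_add algebra_simps)
qed simp

lemma descent_relator:
  assumes "x \<in> tensor_relators R rat_ring"
  shows "descent x \<in> I\<^sub>Q"
proof -
  from assms consider
    (left) U Y q where "U \<in> carrier R" "Y \<in> carrier R"
      "x = Poly_Mapping.single (U \<oplus>\<^bsub>R\<^esub> Y, q) 1 - Poly_Mapping.single (U, q) 1 - Poly_Mapping.single (Y, q) 1"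
  | (right) U q r where "U \<in> carrier R"
      "x = Poly_Mapping.single (U, q + r) 1 - Poly_Mapping.single (U, q) 1 - Poly_Mapping.single (U, r) 1"
    unfolding tensor_relators_def by auto
  then show ?thesis
  proof cases
    case left
    have UY: "U \<oplus>\<^bsub>R\<^esub> Y = coset (rep U + rep Y)"
      using R_simps(2)[OF rep(1) rep(1), OF left(1,2)] rep(2) left by simp
    have "rep (U \<oplus>\<^bsub>R\<^esub> Y) - (rep U + rep Y) \<in> I\<^sub>Z"
      unfolding UY by (rule rep_coset) (use keys_add[of "rep U" "rep Y"] rep(1) left in blast)
    from IQ.scale_mem[OF of_int_coeffs_mem[OF this], of q] show ?thesis
      by (simp add: left(3) descent_diff descent.extension_add of_int_coeffs_diff of_int_coeffs_add
          scale_diff_right scale_add_right algebra_simps)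
  next
    case right
    then show ?thesis by (simp add: descent_diff scale_add_left)
  qed
qed

text \<open>The map is induced by sending the tensor of x and q to q x. Surjectivity clears
  denominators; for the kernel, \<open>pure_form\<close> leaves one tensor, to which
  \<open>saturation\<close> applies.\<close>

theorem tensor_rat_iso: "tensor_ring R rat_ring \<simeq> Q Quot I\<^sub>Q"
proof -
  let ?h = "\<lambda>f. I\<^sub>Q +>\<^bsub>Q\<^esub> descent f"
  have ringF: "ring F" unfolding free_tensor_eq by (rule FA.ring_free_algebra)
  have ringQ: "ring (Q Quot I\<^sub>Q)" by (rule IQ.quotient_is_ring)
  have carrier_F: "carrier F = {f. Poly_Mapping.keys f \<subseteq> carrier R \<times> UNIV}"
    unfolding free_tensor_eq by simp
  have carrier_Q: "carrier (Q Quot I\<^sub>Q) = (\<lambda>f. I\<^sub>Q +>\<^bsub>Q\<^esub> f) ` {f. Poly_Mapping.keys f \<subseteq> B}"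
    by (auto simp: FactRing_def A_RCOSETS_def')
  have hom: "?h \<in> Ring.ring_hom F (Q Quot I\<^sub>Q)"
  proof (rule ring_hom_memI)
    fix f assume "f \<in> carrier F"
    then show "?h f \<in> carrier (Q Quot I\<^sub>Q)"
      using keys_descent[of f] unfolding carrier_F carrier_Q by blast
  next
    fix f g assume fg: "f \<in> carrier F" "g \<in> carrier F"
    then have k: "Poly_Mapping.keys f \<subseteq> carrier R \<times> UNIV" "Poly_Mapping.keys g \<subseteq> carrier R \<times> UNIV"
      by (auto simp: carrier_F)
    note kd = keys_descent[OF k(1)] keys_descent[OF k(2)]
    have "?h (bilinear_extension \<nu> f g) = I\<^sub>Q +>\<^bsub>Q\<^esub> bilinear_extension \<mu>\<^sub>Q (descent f) (descent g)"
      unfolding IQ.coset_eq_iff by (rule descent_mult[OF k])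
    then show "?h (f \<otimes>\<^bsub>F\<^esub> g) = ?h f \<otimes>\<^bsub>Q Quot I\<^sub>Q\<^esub> ?h g"
      using ring_hom_mult[OF IQ.rcos_ring_hom, of "descent f" "descent g"] kd
      unfolding free_tensor_eq by simp
    show "?h (f \<oplus>\<^bsub>F\<^esub> g) = ?h f \<oplus>\<^bsub>Q Quot I\<^sub>Q\<^esub> ?h g"
      using ring_hom_add[OF IQ.rcos_ring_hom, of "descent f" "descent g"] kd
      unfolding free_tensor_eq by (simp add: descent.extension_add)
  next
    have "?h (Poly_Mapping.single (\<one>\<^bsub>R\<^esub>, 1) 1) = I\<^sub>Q +>\<^bsub>Q\<^esub> e\<^sub>Q"
      unfolding IQ.coset_eq_iff R_simps(3)
      using descent_pure[OF ZA.keys_unit, of 1] by (simp add: of_int_unit)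
    then show "?h \<one>\<^bsub>F\<^esub> = \<one>\<^bsub>Q Quot I\<^sub>Q\<^esub>"
      using ring_hom_one[OF IQ.rcos_ring_hom] unfolding free_tensor_eq by simp
  qed
  interpret h: ring_hom_ring F "Q Quot I\<^sub>Q" ?h
    using ringF ringQ hom by (intro ring_hom_ringI2)
  have zero: "\<zero>\<^bsub>Q Quot I\<^sub>Q\<^esub> = I\<^sub>Q" by (simp add: FactRing_def)
  have I0: "I\<^sub>Q = I\<^sub>Q +>\<^bsub>Q\<^esub> 0" by (simp add: IQ.coset_eq)
  have ker: "a_kernel F (Q Quot I\<^sub>Q) ?h = {f \<in> carrier F. descent f \<in> I\<^sub>Q}"
    unfolding a_kernel_def' zero using IQ.coset_eq_iff[of _ 0] I0 by auto
  have "T \<subseteq> a_kernel F (Q Quot I\<^sub>Q) ?h"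
  proof (rule ring.genideal_minimal[OF ringF])
    show "ideal (a_kernel F (Q Quot I\<^sub>Q) ?h) F" by (rule h.kernel_is_ideal)
    show "tensor_relators R rat_ring \<subseteq> a_kernel F (Q Quot I\<^sub>Q) ?h"
      using keys_relators descent_relator unfolding ker carrier_F by auto
  qed
  then have T_descent: "f \<in> T \<Longrightarrow> descent f \<in> I\<^sub>Q" for f unfolding ker by auto
  have "f \<in> T" if f: "Poly_Mapping.keys f \<subseteq> carrier R \<times> UNIV" and df: "descent f \<in> I\<^sub>Q" for f
  proof -
    obtain x d where x: "Poly_Mapping.keys x \<subseteq> B" "d > 0" "f - pure x (1 / of_int d) \<in> T"
      using pure_form[OF f] by blast
    let ?q = "1 / of_int d :: rat"
    have "descent (pure x ?q) \<in> I\<^sub>Q"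
      using IQ.diff_mem[OF df T_descent[OF x(3)]] by (simp only: descent_diff) simp
    then have "scale ?q (of_int_coeffs x) \<in> I\<^sub>Q"
      using IQ.cong_mem[OF descent_pure[OF x(1)]] by blast
    from IQ.scale_mem[OF this, of "of_int d"] x(2) have "of_int_coeffs x \<in> I\<^sub>Q" by simp
    \<comment> \<open>The integral quotient may have torsion, so only a multiple N x is known to lie
      in \<open>I\<^sub>Z\<close>. Dividing the rational factor by N and moving N across the tensor
      sign brings this multiple into play.\<close>
    then obtain N r where N: "N > 0" "r \<in> I\<^sub>Z" "scale (of_int N) (of_int_coeffs x) = of_int_coeffs r"
      by (rule saturation)
    then have "scale N x \<in> I\<^sub>Z"
      using of_int_coeffs_scale[of N x] by (metis of_int_coeffs_inject)
    then have "coset (scale N x) = coset 0" using IZ.coset_eq_iff by simp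
    then have "pure (scale N x) (?q / of_int N) \<in> T" using pure_zero by metis
    then have "pure x ?q \<in> T"
      using IT.cong_mem[OF pure_move[OF x(1), of N "?q / of_int N"]] N(1) by simp
    then show ?thesis using IT.cong_mem[OF x(3)] by blast
  qed
  then have kerT: "a_kernel F (Q Quot I\<^sub>Q) ?h = T"
    using T_descent IT.keys_mem unfolding ker carrier_F by blast
  have "?h ` carrier F = carrier (Q Quot I\<^sub>Q)"
  proof
    show "?h ` carrier F \<subseteq> carrier (Q Quot I\<^sub>Q)" using h.hom_closed by blast
    show "carrier (Q Quot I\<^sub>Q) \<subseteq> ?h ` carrier F"
    proof
      fix U assume "U \<in> carrier (Q Quot I\<^sub>Q)"
      then obtain f where f: "Poly_Mapping.keys f \<subseteq> B" "U = I\<^sub>Q +>\<^bsub>Q\<^esub> f"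
        unfolding carrier_Q by auto
      obtain d g where d: "d > 0" "scale (of_int d) f = of_int_coeffs g" "Poly_Mapping.keys g \<subseteq> Poly_Mapping.keys f"
        by (rule clear_denominators)
      have g: "Poly_Mapping.keys g \<subseteq> B" using d f by blast
      have "f = scale (1 / of_int d) (of_int_coeffs g)"
        unfolding d(2)[symmetric] using d(1) by simp
      then have "U = ?h (pure g (1 / of_int d))"
        using IQ.cong_sym[OF descent_pure[OF g, of "1 / of_int d"]] unfolding f(2) IQ.coset_eq_iff by simp
      moreover have "pure g (1 / of_int d) \<in> carrier F"
        unfolding carrier_F using coset_mem[OF g] by simp
      ultimately show "U \<in> ?h ` carrier F" by blast
    qed
  qed
  from h.FactRing_iso[OF this] show ?thesis unfolding kerT tensor_ring_def .
qed

end

section \<open>Minimal polynomials of algebraic integers\<close>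

abbreviation real_poly :: "int poly \<Rightarrow> real poly" where
  "real_poly \<equiv> map_poly real_of_int"

abbreviation rat_poly :: "int poly \<Rightarrow> rat poly" where
  "rat_poly \<equiv> map_poly rat_of_int"

lemma of_rat_rat_poly: "map_poly of_rat (rat_poly p) = real_poly p"
  by (simp add: map_poly_map_poly o_def)

lemma clear_denominators_poly:
  fixes q :: "rat poly"
  obtains d :: int and r where "d > 0" "smult (of_int d) q = rat_poly r"
proof -
  have "\<exists>d r. (d::int) > 0 \<and> smult (of_int d) q = rat_poly r"
  proof (induction q)
    case 0
    show ?case by (intro exI[of _ 1] exI[of _ 0]) simp
  next
    case (pCons c q)
    then obtain d r where d: "d > 0" "smult (of_int d) q = rat_poly r" by blast
    obtain a b where "quotient_of c = (a, b)" by force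
    then have ab: "b > 0" "c = of_int a / of_int b"
      using quotient_of_denom_pos quotient_of_div by auto
    have "smult (of_int b) (smult (of_int d) q) = rat_poly (smult b r)"
      unfolding d(2) by (simp add: hom_distribs)
    then have "smult (of_int (b * d)) (pCons c q) = rat_poly (pCons (d * a) (smult b r))"
      using ab by (simp add: of_int_hom.map_poly_pCons_hom)
    then show ?case using d ab by (metis zero_less_mult_iff)
  qed
  then show ?thesis using that by blast
qed

lemma degree_smult_of_int: "d > 0 \<Longrightarrow> smult (of_int d :: rat) q = rat_poly r \<Longrightarrow> degree r = degree q"
  by (metis degree_smult_eq less_irrefl of_int_eq_0_iff of_int_hom.degree_map_poly_hom)

lemma root_smult_of_int:
  assumes "d > 0" "smult (of_int d :: rat) q = rat_poly r"
  shows "poly (real_poly r) x = real_of_int d * poly (map_poly of_rat q) x"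
proof -
  have "real_poly r = map_poly of_rat (smult (of_int d) q)"
    by (simp add: assms(2) of_rat_rat_poly)
  also have "\<dots> = smult (of_rat (of_int d)) (map_poly of_rat q)"
    by (rule map_poly_smult) (simp_all add: of_rat_mult)
  finally show ?thesis by simp
qed

definition is_int_min_poly :: "int poly \<Rightarrow> real \<Rightarrow> bool" where
  "is_int_min_poly p x \<longleftrightarrow> lead_coeff p = 1 \<and> poly (real_poly p) x = 0 \<and>
     (\<forall>q. q \<noteq> 0 \<and> poly (real_poly q) x = 0 \<longrightarrow> degree p \<le> degree q)"

text \<open>Clearing denominators extends minimality from integer to rational competitors, so the
  description defining \<open>min_poly_rat\<close> has exactly one solution.\<close>

lemma min_poly_rat_eqI:
  assumes "is_int_min_poly p x"
  shows "min_poly_rat x = rat_poly p"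
  unfolding min_poly_rat_def
proof (rule the_equality)
  have minimal: "degree p \<le> degree q" if "q \<noteq> 0" "poly (map_poly of_rat q) x = 0" for q :: "rat poly"
  proof -
    obtain d r where d: "d > 0" "smult (of_int d) q = rat_poly r" by (rule clear_denominators_poly)
    have "poly (real_poly r) x = 0" using root_smult_of_int[OF d, of x] that by simp
    moreover have "r \<noteq> 0" using d that by auto
    ultimately show ?thesis using assms degree_smult_of_int[OF d] by (auto simp: is_int_min_poly_def)
  qed
  then show *: "lead_coeff (rat_poly p) = 1 \<and> poly (map_poly of_rat (rat_poly p)) x = 0 \<and>
      (\<forall>q. q \<noteq> 0 \<and> poly (map_poly of_rat q) x = 0 \<longrightarrow> degree (rat_poly p) \<le> degree q)"
    using assms by (simp add: is_int_min_poly_def of_rat_rat_poly)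
  fix q :: "rat poly"
  assume q: "lead_coeff q = 1 \<and> poly (map_poly of_rat q) x = 0 \<and>
    (\<forall>r. r \<noteq> 0 \<and> poly (map_poly of_rat r) x = 0 \<longrightarrow> degree q \<le> degree r)"
  show "q = rat_poly p"
  proof (rule ccontr)
    let ?p = "rat_poly p"
    assume "q \<noteq> ?p"
    have nz: "q \<noteq> 0" "?p \<noteq> 0" using q * by auto
    have deg: "degree q = degree ?p"
      using q * nz by (metis le_antisym)
    have root: "poly (map_poly of_rat (q - ?p)) x = 0"
    proof -
      have "map_poly of_rat (q - ?p) = (map_poly of_rat q - map_poly of_rat ?p :: real poly)"
        by (rule poly_eqI) (simp add: coeff_map_poly of_rat_diff)
      then show ?thesis using q * by simp
    qed
    \<comment> \<open>Two monic polynomials of equal degree cancel their leading terms, and the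
      difference would be a root polynomial of smaller degree.\<close>
    have "degree ?p \<le> degree (q - ?p)"
      using minimal[of "q - ?p"] \<open>q \<noteq> ?p\<close> root by simp
    moreover have "degree (q - ?p) \<le> degree ?p" using deg by (simp add: degree_diff_le)
    ultimately have "degree (q - ?p) = degree ?p" by simp
    moreover have "coeff (q - ?p) (degree ?p) = 0" using q * deg by simp
    ultimately have "lead_coeff (q - ?p) = 0" by (simp only:)
    then show False using \<open>q \<noteq> ?p\<close> by (metis leading_coeff_0_iff right_minus_eq)
  qed
qed

text \<open>Gauss's lemma: a primitive r of least degree vanishing at x divides the monic
  \<open>P\<close> over the rationals, because a remainder would be a smaller competitor. Contents
  show that the cofactor is integral, so the leading coefficient of r divides 1.\<close>

lemma int_min_poly_exists:
  assumes P: "lead_coeff P = 1" "poly (real_poly P) x = 0"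
  shows "\<exists>p. is_int_min_poly p x"
proof -
  define A where "A = {q. q \<noteq> 0 \<and> poly (real_poly q) x = 0}"
  have "P \<in> A" using P by (auto simp: A_def)
  then obtain r0 where r0: "r0 \<in> A" "\<And>q. q \<in> A \<Longrightarrow> degree r0 \<le> degree q"
    using ex_has_least_nat[of "\<lambda>q. q \<in> A" P degree] by blast
  define r where "r = primitive_part r0"
  have r0_eq: "r0 = smult (content r0) r" by (simp add: r_def)
  have r0_nz: "r0 \<noteq> 0" using r0(1) by (simp add: A_def)
  have "real_poly r0 = smult (of_int (content r0)) (real_poly r)"
    by (subst r0_eq) (simp add: hom_distribs)
  moreover have "poly (real_poly r0) x = 0" using r0(1) unfolding A_def by blast
  ultimately have "of_int (content r0) * poly (real_poly r) x = 0"
    by (simp only: poly_smult)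
  then have root: "poly (real_poly r) x = 0" using r0_nz by auto
  have r_nz: "r \<noteq> 0" using r0_nz by (simp add: r_def)
  have deg: "degree r \<le> degree q" if "q \<noteq> 0" "poly (real_poly q) x = 0" for q
    using r0(2)[of q] that by (simp add: A_def r_def)
  have prim: "content r = 1" using r0_nz by (simp add: r_def)
  have "rat_poly r dvd rat_poly P"
  proof (rule ccontr)
    let ?m = "rat_poly P mod rat_poly r"
    assume "\<not> rat_poly r dvd rat_poly P"
    then have m: "?m \<noteq> 0" by (simp add: dvd_eq_mod_eq_0)
    then have deg_m: "degree ?m < degree r"
      using degree_mod_less[of "rat_poly r" "rat_poly P"] r_nz by auto
    obtain d s where d: "d > 0" "smult (of_int d) (rat_poly P div rat_poly r) = rat_poly s"
      by (rule clear_denominators_poly)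
    obtain d' m' where d': "d' > 0" "smult (of_int d') ?m = rat_poly m'"
      by (rule clear_denominators_poly)
    \<comment> \<open>Clearing the denominators of quotient and remainder gives d d' P = d' s r + d
      m' over the integers, where m' inherits the root x and has the degree of the
      remainder.\<close>
    have "smult (of_int (d * d')) (Q * R + M) = smult (of_int d') (smult (of_int d) Q * R) + smult (of_int d) (smult (of_int d') M)"
      for Q R M :: "rat poly"
      by (simp add: smult_add_right mult.commute)
    from this[of "rat_poly P div rat_poly r" "rat_poly r" ?m]
    have "smult (of_int (d * d')) (rat_poly P) =
        smult (of_int d') (smult (of_int d) (rat_poly P div rat_poly r) * rat_poly r) + smult (of_int d) (smult (of_int d') ?m)"
      by (simp only: div_mult_mod_eq)
    also have "\<dots> = rat_poly (smult d' (s * r) + smult d m')"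
      unfolding d(2) d'(2) by (simp add: hom_distribs)
    finally have "rat_poly (smult (d * d') P) = rat_poly (smult d' (s * r) + smult d m')"
      by (simp add: hom_distribs)
    then have "smult (d * d') P = smult d' (s * r) + smult d m'" by simp
    then have "poly (real_poly (smult (d * d') P)) x = poly (real_poly (smult d' (s * r) + smult d m')) x"
      by simp
    then have "poly (real_poly m') x = 0"
      using P(2) root d(1) by (simp add: hom_distribs)
    moreover have "m' \<noteq> 0" using d' m by auto
    moreover have "degree m' = degree ?m" using degree_smult_of_int[OF d'] .
    ultimately show False using deg[of m'] deg_m by simp
  qed
  then obtain s where s: "rat_poly P = rat_poly r * s" by (elim dvdE)
  obtain d s' where d: "d > 0" "smult (of_int d) s = rat_poly s'" by (rule clear_denominators_poly)
  have "rat_poly (smult d P) = rat_poly (r * s')"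
    using s d(2) by (simp add: hom_distribs flip: d(2))
  then have eq: "smult d P = r * s'" by simp
  \<comment> \<open>A monic polynomial is primitive. As contents are multiplicative and r is
    primitive, the content of s' is d, which can then be cancelled.\<close>
  have "content P dvd lead_coeff P" by simp
  then have "content P = 1"
    using P(1) by (metis content_dvd_coeff is_unit_normalize normalize_content)
  then have "content s' = d"
    using arg_cong[OF eq, of content] prim d(1) by (simp add: content_mult)
  then have "s' = smult d (primitive_part s')"
    using content_times_primitive_part[of s'] by simp
  then have "smult d P = smult d (r * primitive_part s')"
    using eq by (metis mult_smult_right)
  then have "P = r * primitive_part s'" using d(1) by (metis less_irrefl smult_cancel)
  then have "lead_coeff r * lead_coeff (primitive_part s') = 1"
    using P(1) by (metis lead_coeff_mult)
  then have unit: "lead_coeff r * lead_coeff r = 1"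
    by (metis mult.commute mult_cancel_right1 zmult_eq_1_iff)
  \<comment> \<open>The leading coefficient is 1 or -1; multiplying by it makes r monic.\<close>
  have "is_int_min_poly (smult (lead_coeff r) r) x"
    unfolding is_int_min_poly_def using unit root deg by (auto simp: hom_distribs)
  then show ?thesis by blast
qed

section \<open>The polynomials $C_n$ and $c_n$\<close>

text \<open>This is 2 T_k((x - 2)/2) for the Chebyshev polynomials T_k of the first kind. The shift
  is adapted to 4 cos^2(\<theta>/2) = 2 + 2 cos \<theta>.\<close>

fun shifted_chebyshev :: "nat \<Rightarrow> int poly" where
  "shifted_chebyshev 0 = [:2:]"
| "shifted_chebyshev (Suc 0) = [:-2, 1:]"
| "shifted_chebyshev (Suc (Suc k)) = [:-2, 1:] * shifted_chebyshev (Suc k) - shifted_chebyshev k"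

lemma poly_shifted_chebyshev:
  "poly (real_poly (shifted_chebyshev k)) (2 + 2 * cos \<theta>) = 2 * cos (real k * \<theta>)"
proof (induction k rule: shifted_chebyshev.induct)
  case (3 k)
  have "cos (real (Suc (Suc k)) * \<theta>) + cos (real k * \<theta>) = 2 * cos \<theta> * cos (real (Suc k) * \<theta>)"
    using cos_plus_cos[of "real (Suc (Suc k)) * \<theta>" "real k * \<theta>"]
    by (simp add: algebra_simps add_divide_distrib)
  moreover have "poly (real_poly (shifted_chebyshev (Suc (Suc k)))) (2 + 2 * cos \<theta>) =
      2 * cos \<theta> * (2 * cos (real (Suc k) * \<theta>)) - 2 * cos (real k * \<theta>)"
    using 3 by (simp add: hom_distribs of_int_hom.map_poly_pCons_hom algebra_simps)
  ultimately show ?case by simp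
qed (simp_all add: of_int_hom.map_poly_pCons_hom)

text \<open>Indices start at 1, since the polynomial of index 0 is the constant 2. In the recursion
  the product with x - 2 dominates the degree.\<close>

lemma shifted_chebyshev_monic:
  "lead_coeff (shifted_chebyshev (Suc k)) = 1 \<and> degree (shifted_chebyshev (Suc k)) = Suc k"
proof (induction k rule: less_induct)
  case (less k)
  show ?case
  proof (cases k)
    case (Suc j)
    let ?a = "[:-2, 1:] * shifted_chebyshev (Suc j)"
    have j: "lead_coeff (shifted_chebyshev (Suc j)) = 1" "degree (shifted_chebyshev (Suc j)) = Suc j"
      using less[of j] Suc by auto
    then have "shifted_chebyshev (Suc j) \<noteq> 0" by auto
    then have a: "degree ?a = Suc (Suc j)" "lead_coeff ?a = 1"
      using j degree_mult_eq[of "[:-2, 1:]" "shifted_chebyshev (Suc j)"]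
        lead_coeff_mult[of "[:-2, 1:]" "shifted_chebyshev (Suc j)"] by (simp_all del: mult_pCons_left)
    have lt: "degree (- shifted_chebyshev j) < degree ?a"
      using less[of "j - 1"] Suc a by (cases j) auto
    have "shifted_chebyshev (Suc k) = - shifted_chebyshev j + ?a"
      by (simp add: Suc del: mult_pCons_left)
    then show ?thesis
      using degree_add_eq_right[OF lt] lead_coeff_add_le[OF lt] a Suc by metis
  qed simp
qed

text \<open>An explicit monic integer polynomial has the root in question, which gives both
  descriptions behind \<open>C_poly\<close> a value.\<close>

lemma C_poly_min_poly:
  assumes "n \<ge> 3"
  shows "is_int_min_poly (C_poly n) (4 * (cos (pi / real n))\<^sup>2)"
proof -
  let ?x = "4 * (cos (pi / real n))\<^sup>2"
  have x: "?x = 2 + 2 * cos (2 * (pi / real n))"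
    by (simp only: cos_double_cos)  (simp add: algebra_simps)
  obtain k where k: "n = Suc k" using assms by (cases n) auto
  \<comment> \<open>At the angle \<theta> = 2 \<pi>/n the Chebyshev value is 2 cos(2 \<pi>) = 2,
    which the added constant removes.\<close>
  let ?P = "shifted_chebyshev n + [:-2:]"
  have lt: "degree [:-2::int:] < degree (shifted_chebyshev n)"
    using shifted_chebyshev_monic[of k] k by simp
  have "lead_coeff ?P = 1"
    using lead_coeff_add_le[OF lt] shifted_chebyshev_monic[of k] k by (metis add.commute)
  moreover have "poly (real_poly ?P) ?x = 0"
    using poly_shifted_chebyshev[of n "2 * (pi / real n)"] assms
    by (simp add: x hom_distribs of_int_hom.map_poly_pCons_hom)
  ultimately obtain p where p: "is_int_min_poly p ?x"
    using int_min_poly_exists by blast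
  then have "C_poly n = p"
    unfolding C_poly_def min_poly_rat_eqI[OF p] by (intro the_equality) simp_all
  with p show ?thesis by simp
qed

lemma is_int_min_poly_unique:
  assumes "is_int_min_poly p x" "is_int_min_poly q x"
  shows "p = q"
  using min_poly_rat_eqI[OF assms(1)] min_poly_rat_eqI[OF assms(2)] by simp

text \<open>The root is nonzero because 0 < \<pi>/n < \<pi>/2. A factor t could therefore be
  cancelled, contradicting minimality of the degree.\<close>

lemma coeff_0_C_poly:
  assumes "n \<ge> 3"
  shows "coeff (C_poly n) 0 \<noteq> 0"
proof
  let ?x = "4 * (cos (pi / real n))\<^sup>2"
  assume 0: "coeff (C_poly n) 0 = 0"
  obtain c q where q: "C_poly n = pCons c q" by (cases "C_poly n")
  have "pi / real n < pi / 2" using assms by (intro divide_strict_left_mono) auto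
  then have "cos (pi / real n) > 0" using assms by (intro cos_gt_zero) auto
  then have "?x \<noteq> 0" by simp
  moreover have "C_poly n = pCons 0 q" using q 0 by simp
  ultimately have "q \<noteq> 0" "poly (real_poly q) ?x = 0" "degree (C_poly n) = Suc (degree q)"
    using C_poly_min_poly[OF assms] by (auto simp: is_int_min_poly_def of_int_hom.map_poly_pCons_hom)
  then show False using C_poly_min_poly[OF assms] by (auto simp: is_int_min_poly_def)
qed

lemma C_poly_3: "C_poly 3 = [:-1, 1:]"
proof -
  have x: "4 * (cos (pi / real 3))\<^sup>2 = 1" by (simp add: cos_60 power2_eq_square)
  have "is_int_min_poly [:-1, 1:] 1"
    unfolding is_int_min_poly_def
  proof (intro conjI allI impI)
    fix q :: "int poly" assume q: "q \<noteq> 0 \<and> poly (real_poly q) 1 = 0"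
    have "degree q \<noteq> 0"
    proof
      assume "degree q = 0"
      then obtain c where "q = [:c:]" by (rule degree_eq_zeroE)
      then show False using q by (simp add: of_int_hom.map_poly_pCons_hom)
    qed
    then show "degree [:-1, 1 :: int:] \<le> degree q" by simp
  qed (simp_all add: of_int_hom.map_poly_pCons_hom)
  moreover have "is_int_min_poly (C_poly 3) 1"
    using C_poly_min_poly[of 3] x by simp
  ultimately show ?thesis using is_int_min_poly_unique by blast
qed

lemma c_poly_3: "c_poly 3 = [:-1, 1:]"
proof -
  have "{N::nat. 3 \<le> N \<and> N dvd 3} = {3}" by (auto dest: dvd_imp_le)
  then show ?thesis by (simp add: c_poly_def C_poly_3)
qed

lemma coeff_0_c_poly: "coeff (c_poly n) 0 \<noteq> 0"
proof (cases "n = 0")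
  case False
  then have "finite {N. 3 \<le> N \<and> N dvd n}"
    by (intro finite_subset[OF _ finite_divisors_nat[of n]]) auto
  moreover have "poly (C_poly N) 0 \<noteq> 0" if "N \<ge> 3" for N
    using coeff_0_C_poly[OF that] by (simp add: poly_0_coeff_0)
  ultimately have "poly (c_poly n) 0 \<noteq> 0"
    by (auto simp: c_poly_def poly_prod)
  then show ?thesis by (simp add: poly_0_coeff_0)
next
  \<comment> \<open>Every N divides 0, so the index set is infinite and the product takes its
    default value 1.\<close>
  case True
  have "\<not> finite {N::nat. 3 \<le> N}" using infinite_Ici[of "3::nat"] by (simp add: atLeast_def)
  then show ?thesis using True by (simp add: c_poly_def)
qed

section \<open>Polynomial families of walks\<close>

text \<open>The polynomial \<open>f\<close> with the walk \<open>w k\<close> substituted for the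
  k-th power of t. Relators of the exceptional edge and combinations of normal forms both have this
  shape.\<close>

definition walk_sum :: "'v \<Rightarrow> (nat \<Rightarrow> 'e list) \<Rightarrow> 'v \<Rightarrow> 'a::comm_ring_1 poly \<Rightarrow> (('v, 'e) path \<Rightarrow>\<^sub>0 'a)" where
  "walk_sum u w v f = (\<Sum>k\<le>degree f. Poly_Mapping.single (u, w k, v) (coeff f k))"

lemma walk_sum_bound:
  assumes "degree f \<le> n"
  shows "walk_sum u w v f = (\<Sum>k\<le>n. Poly_Mapping.single (u, w k, v) (coeff f k))"
  unfolding walk_sum_def
  by (rule sum.mono_neutral_left) (use assms in \<open>auto simp: coeff_eq_0\<close>)

lemma walk_sum_0 [simp]: "walk_sum u w v 0 = 0"
  by (simp add: walk_sum_def)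

lemma walk_sum_add: "walk_sum u w v (f + g) = walk_sum u w v f + walk_sum u w v g"
  using walk_sum_bound[of f "max (degree f) (degree g)" u w v]
    walk_sum_bound[of g "max (degree f) (degree g)" u w v]
    walk_sum_bound[of "f + g" "max (degree f) (degree g)" u w v]
  by (simp add: degree_add_le_max single_add sum.distrib)

lemma walk_sum_monom [simp]: "walk_sum u w v (monom c k) = Poly_Mapping.single (u, w k, v) c"
proof -
  have "walk_sum u w v (monom c k) = (\<Sum>j\<le>k. Poly_Mapping.single (u, w j, v) (coeff (monom c k) j))"
    by (rule walk_sum_bound) (rule degree_monom_le)
  also have "\<dots> = (\<Sum>j\<le>k. if j = k then Poly_Mapping.single (u, w j, v) c else 0)"
    by (intro sum.cong) auto
  finally show ?thesis by simp
qed

lemma walk_sum_smult: "walk_sum u w v (smult c f) = scale c (walk_sum u w v f)"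
  by (subst walk_sum_bound[OF degree_smult_le]) (simp add: walk_sum_def scale_sum_right)

lemma keys_walk_sum:
  assumes "\<And>k. coeff f k \<noteq> 0 \<Longrightarrow> (u, w k, v) \<in> B"
  shows "Poly_Mapping.keys (walk_sum u w v f) \<subseteq> B"
  unfolding walk_sum_def by (rule keys_sum_subset) (use assms in auto)

lemma of_int_coeffs_walk_sum:
  "of_int_coeffs (walk_sum u w v f) = walk_sum u w v (map_poly rat_of_int f)"
  by (simp add: walk_sum_def of_int_coeffs_sum)

lemma path_mult_walk_sum:
  "bilinear_extension path_mult (Poly_Mapping.single (x, p, u) 1) (walk_sum u w v f) =
    walk_sum x (\<lambda>k. p @ w k) v f"
  by (simp add: walk_sum_def bilinear_extension_sum_right)

lemma walk_sum_path_mult: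
  "bilinear_extension path_mult (walk_sum u w v f) (Poly_Mapping.single (v, p, y) 1) =
    walk_sum u (\<lambda>k. w k @ p) y f"
  by (simp add: walk_sum_def bilinear_extension_sum_left)

lemma poly_monom_induct [case_names monom add]:
  assumes "\<And>a k. P (monom a k)" "\<And>p q. P p \<Longrightarrow> P q \<Longrightarrow> P (p + q)"
  shows "P p"
proof -
  have "P (\<Sum>k\<in>A. monom (coeff p k) k)" if "finite A" for A
    using that
  proof (induction A rule: finite_induct)
    case empty
    show ?case using assms(1)[of 0 0] by simp
  qed (use assms in auto)
  from this[of "{..degree p}"] show ?thesis by (simp add: poly_as_sum_of_monoms)
qed

lemma walk_sum_shift: "walk_sum u w v (monom 1 t * f) = walk_sum u (\<lambda>k. w (k + t)) v f"
  by (induction f rule: poly_monom_induct)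
    (simp_all add: mult_monom walk_sum_add distrib_left add.commute)

lemma walk_sum_diff_mem:
  assumes "algebra_ideal (paths G) path_mult e I"
    and "\<And>k. Poly_Mapping.single (u, w k, v) 1 - Poly_Mapping.single (u, w' k, v) 1 \<in> I"
  shows "walk_sum u w v f - walk_sum u w' v f \<in> I"
proof -
  interpret algebra_ideal "paths G" path_mult e I by fact
  have "(\<Sum>k\<le>Polynomial.degree f. scale (Polynomial.coeff f k) (Poly_Mapping.single (u, w k, v) 1 - Poly_Mapping.single (u, w' k, v) 1)) \<in> I"
    by (intro sum_mem scale_mem assms(2))
  then show ?thesis by (simp add: walk_sum_def scale_diff_right sum_subtractf)
qed

lemma concat_replicate_Suc: "concat (replicate (Suc k) w) = concat (replicate k w) @ w"
  by (induction k) auto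

text \<open>The power with exponent 0 in the corner ring is the vertex, that is, the empty walk;
  from there each factor appends one round trip along \<open>y\<close>.\<close>

lemma eval_return_eq_walk_sum:
  assumes "tail G (arev y) = head G y" "head G (arev y) = tail G y"
  shows "eval_return G arev f y =
    walk_sum (tail G y) (\<lambda>k. concat (replicate k [y, arev y])) (tail G y) f"
proof -
  let ?R = "corner_ring (path_algebra G) (vertex_elt (tail G y))"
  have m: "monoid.mult (path_algebra G) = bilinear_extension path_mult"
    "monoid.mult ?R = bilinear_extension path_mult"
    by (simp_all add: path_algebra_def corner_ring_def)
  have "(edge_elt G y \<otimes>\<^bsub>path_algebra G\<^esub> edge_elt G (arev y)) [^]\<^bsub>?R\<^esub> k =
      Poly_Mapping.single (tail G y, concat (replicate k [y, arev y]), tail G y) (1 :: 'c)" for k :: nat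
  proof (induction k)
    case 0
    show ?case by (simp add: nat_pow_def corner_ring_def vertex_elt_def)
  next
    case (Suc k)
    have "x [^]\<^bsub>?R\<^esub> Suc k = x [^]\<^bsub>?R\<^esub> k \<otimes>\<^bsub>?R\<^esub> x" for x :: "('a, 'b) path \<Rightarrow>\<^sub>0 'c"
      by (simp add: nat_pow_def)
    with Suc show ?case
      unfolding concat_replicate_Suc by (simp add: edge_elt_def m assms)
  qed
  then show ?thesis by (simp add: eval_return_def walk_sum_def)
qed

section \<open>Line graphs with one distinguished edge\<close>

text \<open>
  The vertex set is a disjoint union of linear branches \<open>vx b 0, \<dots>, vx b (len b)\<close>; the edge \<open>ed b i True\<close>
  leads from \<open>vx b i\<close> to \<open>vx b (Suc i)\<close>, and \<open>z True\<close> joins the last vertices of the branches \<open>0\<close>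
  and \<open>1\<close>. Replacing \<open>True\<close> by \<open>False\<close> inverts an edge. Both graphs of the theorem have this shape,
  with two and four branches.
\<close>

locale branched_graph = finite_vertex_digraph G for G :: "('v, 'e) pre_digraph" +
  fixes Br :: "nat set" and len :: "nat \<Rightarrow> nat" and vx :: "nat \<Rightarrow> nat \<Rightarrow> 'v"
    and ed :: "nat \<Rightarrow> nat \<Rightarrow> bool \<Rightarrow> 'e" and z :: "bool \<Rightarrow> 'e"
  assumes Br01: "0 \<in> Br" "1 \<in> Br"
    and verts_eq: "verts G = {vx b i | b i. b \<in> Br \<and> i \<le> len b}"
    and vx_inj: "b \<in> Br \<Longrightarrow> b' \<in> Br \<Longrightarrow> i \<le> len b \<Longrightarrow> j \<le> len b' \<Longrightarrow> vx b i = vx b' j \<Longrightarrow> b = b' \<and> i = j"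
    and arcs_eq: "arcs G = {ed b i d | b i d. b \<in> Br \<and> i < len b} \<union> {z True, z False}"
    and tail_ed: "b \<in> Br \<Longrightarrow> i < len b \<Longrightarrow> tail G (ed b i d) = vx b (if d then i else Suc i)"
    and head_ed: "b \<in> Br \<Longrightarrow> i < len b \<Longrightarrow> head G (ed b i d) = vx b (if d then Suc i else i)"
    and tail_z: "tail G (z d) = (if d then vx 0 (len 0) else vx 1 (len 1))"
    and head_z: "head G (z d) = (if d then vx 1 (len 1) else vx 0 (len 0))"
begin

definition pos :: "'v \<Rightarrow> nat \<times> nat" where
  "pos v = (THE bi. fst bi \<in> Br \<and> snd bi \<le> len (fst bi) \<and> v = vx (fst bi) (snd bi))"

abbreviation "br v \<equiv> fst (pos v)"
abbreviation "ix v \<equiv> snd (pos v)"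

lemma pos_vx [simp]: "b \<in> Br \<Longrightarrow> i \<le> len b \<Longrightarrow> pos (vx b i) = (b, i)"
  unfolding pos_def by (rule the_equality) (use vx_inj in \<open>auto dest: vx_inj\<close>)

lemma vx_verts [simp]: "b \<in> Br \<Longrightarrow> i \<le> len b \<Longrightarrow> vx b i \<in> verts G"
  by (auto simp: verts_eq)

lemma vertsE:
  assumes "v \<in> verts G"
  obtains b i where "b \<in> Br" "i \<le> len b" "v = vx b i"
  using assms by (auto simp: verts_eq)

lemma vx_pos [simp]: "v \<in> verts G \<Longrightarrow> vx (br v) (ix v) = v"
  by (elim vertsE) simp

lemma br_Br [simp]: "v \<in> verts G \<Longrightarrow> br v \<in> Br"
  by (elim vertsE) simp

lemma ix_len: "v \<in> verts G \<Longrightarrow> ix v \<le> len (br v)"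
  by (elim vertsE) simp

text \<open>A branch edge stays inside its branch, whereas \<open>z\<close> changes the
  branch.\<close>

lemma ed_neq_z: "b \<in> Br \<Longrightarrow> i < len b \<Longrightarrow> ed b i d \<noteq> z d'"
proof
  assume *: "b \<in> Br" "i < len b" "ed b i d = z d'"
  have "br (tail G (ed b i d)) = br (head G (ed b i d))" using *(1,2) by (simp add: tail_ed head_ed)
  moreover have "br (tail G (z d')) \<noteq> br (head G (z d'))" using Br01 by (simp add: tail_z head_z)
  ultimately show False using * by simp
qed

lemma z_neq [simp]: "z True \<noteq> z False"
proof
  assume "z True = z False"
  then have "vx 0 (len 0) = vx 1 (len 1)" using tail_z[of True] tail_z[of False] by simp
  then show False using vx_inj[of 0 1 "len 0" "len 1"] Br01 by simp
qed

lemma z_arcs [simp]: "z d \<in> arcs G"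
  by (cases d) (simp_all add: arcs_eq)

lemma ed_arcs [simp]: "b \<in> Br \<Longrightarrow> i < len b \<Longrightarrow> ed b i d \<in> arcs G"
  by (auto simp: arcs_eq)

text \<open>The weight of a path becomes the exponent of \<open>t\<close>: \<open>z True\<close> is sent to \<open>1\<close> and \<open>z False\<close> to \<open>t\<close>.\<close>

abbreviation "weight p \<equiv> count_list p (z False)"

definition up :: "nat \<Rightarrow> nat \<Rightarrow> 'e list" where
  "up b i = map (\<lambda>j. ed b j True) [i..<len b]"

definition down :: "nat \<Rightarrow> nat \<Rightarrow> 'e list" where
  "down b i = map (\<lambda>j. ed b j False) (rev [i..<len b])"

lemma up_step: "i < len b \<Longrightarrow> up b i = ed b i True # up b (Suc i)"
  by (simp add: up_def upt_conv_Cons)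

lemma down_step: "i < len b \<Longrightarrow> down b i = down b (Suc i) @ [ed b i False]"
  by (simp add: down_def upt_conv_Cons)

lemma up_len [simp]: "up b (len b) = []" and down_len [simp]: "down b (len b) = []"
  by (simp_all add: up_def down_def)

lemma awalk_up:
  assumes "i \<le> len b" "b \<in> Br"
  shows "awalk (vx b i) (up b i) (vx b (len b)) \<and> weight (up b i) = 0"
  using assms(1)
proof (induction i rule: inc_induct)
  case base
  show ?case using assms by (simp add: awalk_Nil_iff)
next
  case (step i)
  then show ?case using assms(2) by (auto simp: up_step awalk_Cons_iff tail_ed head_ed ed_neq_z)
qed

lemma awalk_down:
  assumes "i \<le> len b" "b \<in> Br"
  shows "awalk (vx b (len b)) (down b i) (vx b i) \<and> weight (down b i) = 0"
  using assms(1)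
proof (induction i rule: inc_induct)
  case base
  show ?case using assms by (simp add: awalk_Nil_iff)
next
  case (step i)
  have "awalk (vx b (Suc i)) [ed b i False] (vx b i)"
    using step assms by (auto simp: awalk_Cons_iff awalk_Nil_iff tail_ed head_ed)
  with step show ?case using assms(2)
    by (auto simp: down_step ed_neq_z simp del: awalk_append_iff intro: awalk_appendI)
qed

text \<open>From the end of branch 0: k round trips across \<open>z\<close>, closed off by one more
  crossing when the target is branch 1.\<close>

primrec core0 :: "nat \<Rightarrow> nat \<Rightarrow> 'e list" where
  "core0 b' 0 = (if b' = 1 then [z True] else [])"
| "core0 b' (Suc k) = z True # z False # core0 b' k"

text \<open>From the end of branch 1, a positive weight is spent by first crossing to branch 0 with
  \<open>z False\<close>. The value for weight 0 from branch 1 to branch 0 is a dummy, excluded by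
  \<open>admissible\<close>.\<close>

definition core :: "nat \<Rightarrow> nat \<Rightarrow> nat \<Rightarrow> 'e list" where
  "core b b' k = (if b = 0 then core0 b' k
     else if b = 1 then (case k of 0 \<Rightarrow> [] | Suc j \<Rightarrow> z False # core0 b' j) else [])"

text \<open>The weights that walks between two branches can have: going from branch 1 to branch 0
  uses \<open>z False\<close> at least once, and the branches from 2 on are separate components
  without \<open>z\<close>.\<close>

definition admissible :: "nat \<Rightarrow> nat \<Rightarrow> nat \<Rightarrow> bool" where
  "admissible b b' k \<longleftrightarrow> (if b < 2 then b' < 2 \<and> (b = 1 \<and> b' = 0 \<longrightarrow> 1 \<le> k) else b' = b \<and> k = 0)"

lemma core_z_True: "admissible 1 b' k \<Longrightarrow> z True # core 1 b' k = core 0 b' k"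
  by (cases k) (auto simp: core_def admissible_def less_2_cases_iff)

lemma core_z_False: "z False # core 0 b' k = core 1 b' (Suc k)"
  by (simp add: core_def)

lemma awalk_core0:
  assumes "b' < 2"
  shows "awalk (vx 0 (len 0)) (core0 b' k) (vx b' (len b')) \<and> weight (core0 b' k) = k"
proof (induction k)
  case 0
  show ?case using assms Br01 by (auto simp: less_2_cases_iff awalk_Cons_iff awalk_Nil_iff tail_z head_z)
next
  case (Suc k)
  then show ?case by (simp add: awalk_Cons_iff tail_z head_z)
qed

lemma awalk_core:
  assumes "admissible b b' k" "b \<in> Br"
  shows "awalk (vx b (len b)) (core b b' k) (vx b' (len b')) \<and> weight (core b b' k) = k"
proof -
  consider "b = 0" | "b = 1" | "b \<ge> 2" by linarith
  then show ?thesis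
  proof cases
    case 1
    then show ?thesis using awalk_core0[of b' k] assms by (simp add: admissible_def core_def)
  next
    case 2
    then show ?thesis using awalk_core0[of b' "k - 1"] assms Br01
      by (cases k) (auto simp: admissible_def core_def less_2_cases_iff awalk_Cons_iff awalk_Nil_iff tail_z head_z)
  next
    case 3
    then show ?thesis using assms by (simp add: admissible_def core_def awalk_Nil_iff)
  qed
qed

definition nf :: "'v \<Rightarrow> 'v \<Rightarrow> nat \<Rightarrow> 'e list" where
  "nf u v k = up (br u) (ix u) @ core (br u) (br v) k @ down (br v) (ix v)"

lemma awalk_nf:
  assumes "u \<in> verts G" "v \<in> verts G" "admissible (br u) (br v) k"
  shows "awalk u (nf u v k) v" "weight (nf u v k) = k"
proof -
  have "awalk u (up (br u) (ix u)) (vx (br u) (len (br u)))"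
    using awalk_up[of "ix u" "br u"] assms ix_len[of u] by simp
  moreover have "awalk (vx (br v) (len (br v))) (down (br v) (ix v)) v"
    using awalk_down[of "ix v" "br v"] assms ix_len[of v] by simp
  ultimately show "awalk u (nf u v k) v"
    unfolding nf_def using awalk_core[OF assms(3)] assms(1) by (meson awalk_appendI br_Br)
  show "weight (nf u v k) = k"
    unfolding nf_def using awalk_core[OF assms(3)] awalk_up[of "ix u" "br u"] awalk_down[of "ix v" "br v"]
      assms ix_len[of u] ix_len[of v] by simp
qed

text \<open>By induction along the walk. Branch edges change neither the branch nor the weight, so
  only the two crossings of \<open>z\<close> matter.\<close>

lemma admissible_weight:
  assumes "awalk u p v"
  shows "admissible (br u) (br v) (weight p)"
  using assms
proof (induction p arbitrary: u)
  case Nil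
  then show ?case by (auto simp: awalk_Nil_iff admissible_def)
next
  case (Cons y p)
  then have y: "y \<in> arcs G" "u = tail G y" and IH: "admissible (br (head G y)) (br v) (weight p)"
    by (auto simp: awalk_Cons_iff)
  from y(1) consider b i d where "y = ed b i d" "b \<in> Br" "i < len b" | d where "y = z d"
    unfolding arcs_eq by blast
  then show ?case
  proof cases
    case 1
    then show ?thesis using IH y(2) by (simp add: tail_ed head_ed ed_neq_z)
  next
    case 2
    then show ?thesis using IH y(2) Br01 by (cases d) (auto simp: tail_z head_z admissible_def)
  qed
qed

subsection \<open>The weight homomorphism\<close>

definition entry_coeff :: "'v \<Rightarrow> 'v \<Rightarrow> ('v, 'e) path \<Rightarrow> 'a::comm_ring_1 \<Rightarrow> 'a poly" where
  "entry_coeff u v p c = (if fst p = u \<and> snd (snd p) = v then monom c (weight (fst (snd p))) else 0)"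

lemma entry_coeff_simp [simp]:
  "entry_coeff u v (x, p, y) c = (if x = u \<and> y = v then monom c (weight p) else 0)"
  by (simp add: entry_coeff_def)

sublocale entry: additive_coefficients "entry_coeff u v" for u v
  by unfold_locales (auto simp: entry_coeff_def add_monom)

abbreviation "entry u v \<equiv> linear_extension (entry_coeff u v)"

text \<open>Weights add under concatenation, and two paths compose only at a common middle vertex;
  hence the entries multiply like matrices indexed by the vertices.\<close>

lemma entry_mult:
  assumes "Poly_Mapping.keys f \<subseteq> paths G" "Poly_Mapping.keys g \<subseteq> paths G"
  shows "entry u v (bilinear_extension path_mult f g) = (\<Sum>x\<in>verts G. entry u x f * entry x v g)"
  using assms(1)
proof (induction f rule: keys_subset_induct)
  case (single p c)
  obtain a p' b where p: "p = (a, p', b)" by (cases p)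
  have b: "b \<in> verts G" using single p by auto
  from assms(2) show ?case
  proof (induction g rule: keys_subset_induct)
    case (single q d)
    obtain a' q' b' where q: "q = (a', q', b')" by (cases q)
    have "(\<Sum>x\<in>verts G. entry u x (Poly_Mapping.single p c) * entry x v (Poly_Mapping.single q d)) =
        (\<Sum>x\<in>verts G. if x = b then (if a = u \<and> a' = b \<and> b' = v then monom (c * d) (weight p' + weight q') else 0) else 0)"
      by (intro sum.cong) (auto simp: p q mult_monom)
    also have "\<dots> = entry u v (bilinear_extension path_mult (Poly_Mapping.single p c) (Poly_Mapping.single q d))"
      using b by (auto simp: p q sum.delta[OF finite_verts])
    finally show ?case by simp
  next
    case (add g g')
    then show ?case by (simp add: bilinear_extension_add_right entry.extension_add distrib_left sum.distrib)
  qed simp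
next
  case (add f f')
  then show ?case by (simp add: bilinear_extension_add_left entry.extension_add distrib_right sum.distrib)
qed simp

lemma entry_one:
  assumes "u \<in> verts G"
  shows "entry u v (\<Sum>s\<in>verts G. Poly_Mapping.single (s, [], s) 1) = (if u = v then 1 else 0)"
proof -
  have "entry u v (\<Sum>s\<in>verts G. Poly_Mapping.single (s, [], s) (1::'a::comm_ring_1)) =
      (\<Sum>s\<in>verts G. if s = u then (if u = v then 1 else 0) else 0)"
    unfolding entry.extension_sum by (intro sum.cong) (auto simp: monom_0 one_pCons)
  then show ?thesis using assms by (simp add: sum.delta[OF finite_verts])
qed

text \<open>In particular, entries from branch 1 to branch 0 are divisible by t, which makes the
  matrices block triangular at t = 0.\<close>

lemma coeff_entry_admissible:
  assumes "Poly_Mapping.keys f \<subseteq> paths G" "coeff (entry u v f) k \<noteq> 0"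
  shows "admissible (br u) (br v) k"
  using assms
proof (induction f rule: keys_subset_induct)
  case (single p c)
  obtain a p' b where p: "p = (a, p', b)" by (cases p)
  with single have "a = u" "b = v" "k = weight p'" by (auto split: if_splits)
  then show ?case using admissible_weight[of u p' v] single p by simp
next
  case (add f g)
  then show ?case
    by (cases "coeff (entry u v f) k = 0") (auto simp: entry.extension_add)
qed simp

text \<open>The offset \<open>s\<close> covers relators that start with \<open>z False\<close>.
  Weights are demanded only where \<open>f\<close> has a coefficient, because normal forms are
  genuine walks only for admissible weights.\<close>

lemma entry_walk_sum:
  assumes "\<And>k. coeff f k \<noteq> 0 \<Longrightarrow> weight (w k) = k + s"
  shows "entry u v (walk_sum x w y f) = (if u = x \<and> v = y then monom 1 s * f else 0)"
proof -
  have "entry u v (walk_sum x w y f) = (\<Sum>k\<le>degree f. if u = x \<and> v = y then monom 1 s * monom (coeff f k) k else 0)"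
    unfolding walk_sum_def entry.extension_sum
  proof (intro sum.cong refl)
    fix k show "entry u v (Poly_Mapping.single (x, w k, y) (coeff f k)) = (if u = x \<and> v = y then monom 1 s * monom (coeff f k) k else 0)"
      using assms[of k] by (cases "coeff f k = 0") (auto simp: mult_monom add.commute)
  qed
  then show ?thesis
    by (cases "u = x \<and> v = y") (auto simp: sum_distrib_left[symmetric] poly_as_sum_of_monoms)
qed

abbreviation nf_sum :: "'v \<Rightarrow> 'v \<Rightarrow> 'a::comm_ring_1 poly \<Rightarrow> (('v, 'e) path \<Rightarrow>\<^sub>0 'a)" where
  "nf_sum u v \<equiv> walk_sum u (nf u v) v"

text \<open>Admissibility is the only constraint on the matrix: each monomial is realised by the
  normal form walk of the corresponding weight.\<close>

lemma entry_surj: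
  assumes "\<And>u v k. u \<in> verts G \<Longrightarrow> v \<in> verts G \<Longrightarrow> coeff (D u v) k \<noteq> 0 \<Longrightarrow> admissible (br u) (br v) k"
  shows "\<exists>f. Poly_Mapping.keys f \<subseteq> paths G \<and> (\<forall>u\<in>verts G. \<forall>v\<in>verts G. entry u v f = D u v)"
proof (intro exI conjI ballI)
  let ?f = "\<Sum>uv\<in>verts G \<times> verts G. nf_sum (fst uv) (snd uv) (D (fst uv) (snd uv))"
  show "Poly_Mapping.keys ?f \<subseteq> paths G"
    by (intro keys_sum_subset keys_walk_sum) (use assms awalk_nf(1) in auto)
  fix u v assume uv: "u \<in> verts G" "v \<in> verts G"
  have "entry u v ?f = (\<Sum>xy\<in>verts G \<times> verts G. if xy = (u, v) then D u v else 0)"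
    unfolding entry.extension_sum
  proof (intro sum.cong refl)
    fix xy assume "xy \<in> verts G \<times> verts G"
    then have "entry u v (nf_sum (fst xy) (snd xy) (D (fst xy) (snd xy))) =
        (if u = fst xy \<and> v = snd xy then monom 1 0 * D (fst xy) (snd xy) else 0)"
      by (intro entry_walk_sum) (use assms awalk_nf(2) in auto)
    also have "\<dots> = (if xy = (u, v) then D u v else 0)" by (cases xy) auto
    finally show "entry u v (nf_sum (fst xy) (snd xy) (D (fst xy) (snd xy))) = (if xy = (u, v) then D u v else 0)" .
  qed
  also have "\<dots> = D u v" using uv finite_verts by (simp add: sum.delta)
  finally show "entry u v ?f = D u v" .
qed

end

section \<open>Normal forms of walks modulo the relations\<close>

locale branched_quotient = branched_graph G Br len vx ed z +
  algebra_ideal "paths G" "path_mult :: ('v, 'e) path \<Rightarrow> ('v, 'e) path \<Rightarrow> (('v, 'e) path \<Rightarrow>\<^sub>0 'a)"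
    "\<Sum>s\<in>verts G. Poly_Mapping.single (s, [], s) 1" I
  for G :: "('v, 'e) pre_digraph" and Br len vx ed z
    and I :: "(('v, 'e) path \<Rightarrow>\<^sub>0 'a::comm_ring_1) set" +
  assumes branch_relation: "b \<in> Br \<Longrightarrow> i < len b \<Longrightarrow>
      Poly_Mapping.single (tail G (ed b i d), [ed b i d, ed b i (\<not> d)], tail G (ed b i d)) 1
      - Poly_Mapping.single (tail G (ed b i d), [], tail G (ed b i d)) 1 \<in> I"
begin

abbreviation equivalent :: "'v \<Rightarrow> 'v \<Rightarrow> 'e list \<Rightarrow> 'e list \<Rightarrow> bool" where
  "equivalent u v p q \<equiv> Poly_Mapping.single (u, p, v) 1 - Poly_Mapping.single (u, q, v) 1 \<in> I"

lemma equivalent_context: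
  assumes "equivalent u v p q" "awalk x r u" "awalk v s y"
  shows "equivalent x y (r @ p @ s) (r @ q @ s)"
proof -
  have "bilinear_extension path_mult (Poly_Mapping.single (x, r, u) 1)
      (bilinear_extension path_mult (Poly_Mapping.single (u, p, v) 1 - Poly_Mapping.single (u, q, v) 1)
        (Poly_Mapping.single (v, s, y) 1)) \<in> I"
    by (intro mult_mem_left mult_mem_right assms(1)) (use assms in auto)
  then show ?thesis
    by (simp add: bilinear_extension_diff_left bilinear_extension_diff_right)
qed

lemma equivalent_Cons:
  assumes "equivalent (head G y) v p q" "y \<in> arcs G" "v \<in> verts G"
  shows "equivalent (tail G y) v (y # p) (y # q)"
  using equivalent_context[OF assms(1) arc_implies_awalk[OF assms(2)], of "[]" v] assms(3)
  by (simp add: awalk_Nil_iff)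

lemma equivalent_cancel:
  assumes "b \<in> Br" "i < len b" "awalk (tail G (ed b i d)) p v"
  shows "equivalent (tail G (ed b i d)) v (ed b i d # ed b i (\<not> d) # p) p"
proof -
  have "awalk (tail G (ed b i d)) [] (tail G (ed b i d))"
    using assms by (auto simp: awalk_Nil_iff)
  from equivalent_context[OF branch_relation[OF assms(1,2)] this assms(3)] show ?thesis by simp
qed

text \<open>Cancellation works from the inside: the part beyond \<open>vx b (Suc i)\<close>
  collapses first, then the remaining pair of inverse edges.\<close>

lemma equivalent_up_down:
  assumes "i \<le> len b" "b \<in> Br"
  shows "equivalent (vx b i) (vx b i) (up b i @ down b i) []"
  using assms(1)
proof (induction i rule: inc_induct)
  case (step i)
  let ?u = "vx b i" and ?T = "ed b i True" and ?F = "ed b i False"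
  have e: "tail G ?T = ?u" "head G ?T = vx b (Suc i)" "tail G ?F = vx b (Suc i)" "head G ?F = ?u"
    using step assms(2) by (simp_all add: tail_ed head_ed)
  have u: "?u \<in> verts G" "vx b (Suc i) \<in> verts G" using step assms(2) by auto
  have "awalk ?u [?T] (vx b (Suc i))" "awalk (vx b (Suc i)) [?F] ?u"
    using step assms(2) u e by (auto simp: awalk_Cons_iff awalk_Nil_iff)
  from equivalent_context[OF step(3) this]
  have "equivalent ?u ?u (up b i @ down b i) [?T, ?F]"
    using step by (simp add: up_step down_step)
  moreover have "equivalent ?u ?u [?T, ?F] []"
    using branch_relation[OF assms(2) step(2), of True] by (simp add: e)
  ultimately show ?case by (rule cong_trans)
qed simp

text \<open>Prepend one edge at a time. An upward edge or a crossing of \<open>z\<close> turns a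
  normal form literally into a normal form, and a downward edge cancels against the start of one.
  The empty walk is the case of climbing a branch and descending again.\<close>

lemma equivalent_nf:
  assumes "awalk u p v"
  shows "equivalent u v p (nf u v (weight p))"
  using assms
proof (induction p arbitrary: u)
  case Nil
  then have uv: "u = v" "u \<in> verts G" by (auto simp: awalk_Nil_iff)
  have "core (br u) (br u) 0 = []" by (simp add: core_def)
  then have "nf u u 0 = up (br u) (ix u) @ down (br u) (ix u)" by (simp add: nf_def)
  then show ?case
    using cong_sym[OF equivalent_up_down[OF ix_len br_Br]] uv by simp
next
  case (Cons y p)
  then have y: "y \<in> arcs G" "u = tail G y" and p: "awalk (head G y) p v"
    by (auto simp: awalk_Cons_iff)
  have v: "v \<in> verts G" using p by auto
  let ?w = "weight p"
  have step: "equivalent u v (y # p) (y # nf (head G y) v ?w)"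
    unfolding y(2) by (rule equivalent_Cons[OF Cons.IH[OF p] y(1) v])
  have adm: "admissible (br (head G y)) (br v) ?w"
    by (rule admissible_weight[OF p])
  from y(1) consider b i where "y = ed b i True" "b \<in> Br" "i < len b"
    | b i where "y = ed b i False" "b \<in> Br" "i < len b" | "y = z True" | "y = z False"
    unfolding arcs_eq by (auto) (metis (full_types))
  then show ?case
  proof cases
    case 1
    then have "y # nf (head G y) v ?w = nf u v (weight (y # p))"
      using y(2) by (simp add: nf_def tail_ed head_ed ed_neq_z up_step)
    then show ?thesis using step by simp
  next
    case 2
    have w: "awalk (tail G y) (nf u v ?w) v"
      using awalk_nf(1)[of u v ?w] adm 2 y(2) v by (simp add: tail_ed head_ed)
    \<comment> \<open>After the downward edge from u, the normal form begins by climbing straight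
      back to u.\<close>
    have "nf (head G y) v ?w = ed b i True # nf u v ?w"
      using 2 y(2) by (simp add: nf_def tail_ed head_ed up_step)
    then have "equivalent u v (y # nf (head G y) v ?w) (nf u v ?w)"
      using equivalent_cancel[of b i False, OF 2(2,3)] w 2(1) y(2) by simp
    then show ?thesis using cong_trans[OF step] 2 by (simp add: ed_neq_z)
  next
    case 3
    then have "y # nf (head G y) v ?w = nf u v (weight (y # p))"
      using y(2) adm Br01 core_z_True[of "br v" ?w] by (simp add: nf_def tail_z head_z flip: append_Cons)
    then show ?thesis using step by simp
  next
    case 4
    then have "y # nf (head G y) v ?w = nf u v (weight (y # p))"
      using y(2) Br01 core_z_False[of "br v" ?w] by (simp add: nf_def tail_z head_z flip: append_Cons)
    then show ?thesis using step by simp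
  qed
qed

text \<open>This makes membership in \<open>I\<close> a question about the entries alone, one pair
  of vertices at a time.\<close>

lemma nf_sum_decomposition:
  assumes "Poly_Mapping.keys f \<subseteq> paths G"
  shows "f - (\<Sum>uv\<in>verts G \<times> verts G. nf_sum (fst uv) (snd uv) (entry (fst uv) (snd uv) f)) \<in> I"
  using assms
proof (induction f rule: keys_subset_induct)
  case (single p c)
  obtain a w b where p: "p = (a, w, b)" by (cases p)
  with single have w: "awalk a w b" by simp
  then have ab: "(a, b) \<in> verts G \<times> verts G" by auto
  have "(\<Sum>uv\<in>verts G \<times> verts G. nf_sum (fst uv) (snd uv) (entry (fst uv) (snd uv) (Poly_Mapping.single p c))) =
      (\<Sum>uv\<in>verts G \<times> verts G. if uv = (a, b) then Poly_Mapping.single (a, nf a b (weight w), b) c else 0)"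
    by (intro sum.cong) (auto simp: p)
  also have "\<dots> = Poly_Mapping.single (a, nf a b (weight w), b) c"
    using ab finite_verts by (simp add: sum.delta)
  finally show ?case using scale_mem[OF equivalent_nf[OF w], of c] by (simp add: p scale_diff_right)
next
  case (add f g)
  show ?case using add_mem[OF add(3,4)]
    by (simp add: entry.extension_add walk_sum_add sum.distrib algebra_simps)
qed simp

text \<open>Multiplying a relator by normal forms of weights \<open>k1\<close> and \<open>k2\<close>
  on its two sides moves it to any position; normalising the resulting walks adds up the
  weights.\<close>

lemma shifted_relator_mem:
  assumes r: "walk_sum x w y c \<in> I"
    and w: "\<And>k. awalk x (w k) y" "\<And>k. weight (w k) = k + s"
    and uv: "u \<in> verts G" "v \<in> verts G"
    and adm: "admissible (br u) (br x) k1" "admissible (br y) (br v) k2"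
  shows "nf_sum u v (Polynomial.monom 1 (k1 + s + k2) * c) \<in> I"
proof -
  have xy: "x \<in> verts G" "y \<in> verts G" using w(1)[of 0] by auto
  note u1 = awalk_nf[OF uv(1) xy(1) adm(1)] and v1 = awalk_nf[OF xy(2) uv(2) adm(2)]
  have "bilinear_extension path_mult (Poly_Mapping.single (u, nf u x k1, x) 1)
      (bilinear_extension path_mult (walk_sum x w y c) (Poly_Mapping.single (y, nf y v k2, v) 1)) \<in> I"
    by (intro mult_mem_left mult_mem_right r) (use u1 v1 in auto)
  then have 1: "walk_sum u (\<lambda>k. nf u x k1 @ w k @ nf y v k2) v c \<in> I"
    by (simp add: path_mult_walk_sum walk_sum_path_mult)
  have "walk_sum u (\<lambda>k. nf u x k1 @ w k @ nf y v k2) v c - walk_sum u (\<lambda>k. nf u v (k + (k1 + s + k2))) v c \<in> I"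
  proof (rule walk_sum_diff_mem)
    show "algebra_ideal (paths G) path_mult (\<Sum>s\<in>verts G. Poly_Mapping.single (s, [], s) 1) I"
      by unfold_locales
    fix k
    have walk: "awalk u (nf u x k1 @ w k @ nf y v k2) v"
      using u1(1) v1(1) w(1) by (meson awalk_appendI)
    have "weight (nf u x k1 @ w k @ nf y v k2) = k + (k1 + s + k2)"
      using u1(2) v1(2) w(2) by simp
    with equivalent_nf[OF walk]
    show "equivalent u v (nf u x k1 @ w k @ nf y v k2) (nf u v (k + (k1 + s + k2)))" by simp
  qed
  then have "walk_sum u (\<lambda>k. nf u v (k + (k1 + s + k2))) v c \<in> I"
    using 1 cong_mem by blast
  then show ?thesis by (simp add: walk_sum_shift)
qed

text \<open>Here \<kappa> is the least power of t with which the relator reaches the position of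
  \<open>u\<close> and \<open>v\<close>; linear combinations of the higher powers fill up all
  multiples.\<close>

lemma relator_multiple_mem:
  assumes "\<And>t. t \<ge> \<kappa> \<Longrightarrow> nf_sum u v (Polynomial.monom 1 t * c) \<in> I"
  shows "nf_sum u v (Polynomial.monom 1 \<kappa> * c * g) \<in> I"
proof (induction g rule: poly_monom_induct)
  case (monom a k)
  have "Polynomial.monom 1 \<kappa> * c * Polynomial.monom a k = Polynomial.smult a (Polynomial.monom 1 (\<kappa> + k) * c)"
    by (metis (no_types, lifting) mult.assoc mult.commute mult_1 mult_monom mult_smult_right smult_monom mult.right_neutral)
  then show ?case using scale_mem[OF assms[of "\<kappa> + k"], of a] by (simp add: walk_sum_smult)
next
  case (add p q)
  then show ?case by (simp add: distrib_left walk_sum_add add_mem)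
qed

end

section \<open>Homomorphisms to matrix rings\<close>

lemma matrix_ring_simps [simp]:
  "carrier (matrix_ring k R) = {A \<in> carrier_mat k k. \<forall>i<k. \<forall>j<k. A $$ (i, j) \<in> carrier R}"
  "A \<otimes>\<^bsub>matrix_ring k R\<^esub> B = mat k k (\<lambda>(i, j). \<Oplus>\<^bsub>R\<^esub>l\<in>{..<k}. A $$ (i, l) \<otimes>\<^bsub>R\<^esub> B $$ (l, j))"
  "\<one>\<^bsub>matrix_ring k R\<^esub> = mat k k (\<lambda>(i, j). if i = j then \<one>\<^bsub>R\<^esub> else \<zero>\<^bsub>R\<^esub>)"
  "\<zero>\<^bsub>matrix_ring k R\<^esub> = mat k k (\<lambda>_. \<zero>\<^bsub>R\<^esub>)"
  "A \<oplus>\<^bsub>matrix_ring k R\<^esub> B = mat k k (\<lambda>(i, j). A $$ (i, j) \<oplus>\<^bsub>R\<^esub> B $$ (i, j))"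
  by (simp_all add: matrix_ring_def)

lemma finsum_ring_hom:
  assumes "ring R" "\<mu> \<in> Ring.ring_hom (ring_of_type_algebra :: 'a::comm_ring_1 ring) R" "finite A"
  shows "(\<Oplus>\<^bsub>R\<^esub>l\<in>A. \<mu> (g l)) = \<mu> (sum g A)"
proof -
  interpret R: ring R by fact
  interpret h: ring_hom_ring "ring_of_type_algebra :: 'a ring" R \<mu>
    by (intro ring_hom_ringI2 assms ring_from_type_algebra)
  have c: "\<mu> a \<in> carrier R" for a using h.hom_closed[of a] by simp
  from assms(3) show ?thesis
  proof (induction A rule: finite_induct)
    case empty
    show ?case using h.hom_zero by simp
  next
    case (insert x A)
    then show ?case using h.hom_add[of "g x" "sum g A"] c by (simp add: Pi_def)
  qed
qed

context finite_vertex_digraph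
begin

abbreviation path_ring :: "(('v, 'e) path \<Rightarrow>\<^sub>0 'c::comm_ring_1) ring" where
  "path_ring \<equiv> free_algebra (paths G) path_mult (\<Sum>s\<in>verts G. Poly_Mapping.single (s, [], s) 1)"

end

context branched_graph
begin

definition block :: "nat \<Rightarrow> (nat \<Rightarrow> 'v) \<Rightarrow> ('c::comm_ring_1 poly \<Rightarrow> 'r) \<Rightarrow> (('v, 'e) path \<Rightarrow>\<^sub>0 'c) \<Rightarrow> 'r mat" where
  "block k \<alpha> \<mu> f = mat k k (\<lambda>(i, j). \<mu> (entry (\<alpha> i) (\<alpha> j) f))"

text \<open>A block of a matrix product differs from the product of the blocks by the summands whose
  middle vertex lies outside; \<open>vanish\<close> says that \<mu> kills these.\<close>

lemma block_hom:
  assumes R: "ring R" and \<mu>: "\<mu> \<in> Ring.ring_hom (ring_of_type_algebra :: 'c::comm_ring_1 poly ring) R"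
    and \<alpha>: "inj_on \<alpha> {..<k}" "\<alpha> ` {..<k} \<subseteq> verts G"
    and vanish: "\<And>f g i j x. Poly_Mapping.keys f \<subseteq> paths G \<Longrightarrow> Poly_Mapping.keys g \<subseteq> paths G \<Longrightarrow>
      i < k \<Longrightarrow> j < k \<Longrightarrow> x \<in> verts G - \<alpha> ` {..<k} \<Longrightarrow> \<mu> (entry (\<alpha> i) x f * entry x (\<alpha> j) g) = \<zero>\<^bsub>R\<^esub>"
  shows "block k \<alpha> \<mu> \<in> Ring.ring_hom path_ring (matrix_ring k R)"
proof (rule ring_hom_memI)
  interpret R: ring R by fact
  interpret h: ring_hom_ring "ring_of_type_algebra :: 'c poly ring" R \<mu>
    by (intro ring_hom_ringI2 assms ring_from_type_algebra)
  have c: "\<mu> a \<in> carrier R" for a using h.hom_closed[of a] by simp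
  have zero: "\<mu> 0 = \<zero>\<^bsub>R\<^esub>" using h.hom_zero by simp
  have add: "\<mu> (a + b) = \<mu> a \<oplus>\<^bsub>R\<^esub> \<mu> b" for a b using h.hom_add[of a b] by simp
  have mult: "\<mu> (a * b) = \<mu> a \<otimes>\<^bsub>R\<^esub> \<mu> b" for a b using h.hom_mult[of a b] by simp
  have one: "\<mu> 1 = \<one>\<^bsub>R\<^esub>" using h.hom_one by simp
  fix f :: "('v, 'e) path \<Rightarrow>\<^sub>0 'c" assume f: "f \<in> carrier path_ring"
  show "block k \<alpha> \<mu> f \<in> carrier (matrix_ring k R)" by (simp add: block_def c)
  fix g :: "('v, 'e) path \<Rightarrow>\<^sub>0 'c" assume g: "g \<in> carrier path_ring"
  show "block k \<alpha> \<mu> (f \<oplus>\<^bsub>path_ring\<^esub> g) = block k \<alpha> \<mu> f \<oplus>\<^bsub>matrix_ring k R\<^esub> block k \<alpha> \<mu> g"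
    by (rule eq_matI) (simp_all add: block_def entry.extension_add add)
  show "block k \<alpha> \<mu> (f \<otimes>\<^bsub>path_ring\<^esub> g) = block k \<alpha> \<mu> f \<otimes>\<^bsub>matrix_ring k R\<^esub> block k \<alpha> \<mu> g"
  proof (rule eq_matI)
    fix i j assume "i < dim_row (block k \<alpha> \<mu> f \<otimes>\<^bsub>matrix_ring k R\<^esub> block k \<alpha> \<mu> g)"
      "j < dim_col (block k \<alpha> \<mu> f \<otimes>\<^bsub>matrix_ring k R\<^esub> block k \<alpha> \<mu> g)"
    then have ij: "i < k" "j < k" by simp_all
    let ?e = "\<lambda>x. entry (\<alpha> i) x f * entry x (\<alpha> j) g"
    have sum_zero: "\<mu> (sum ?e A) = \<zero>\<^bsub>R\<^esub>" if "finite A" "\<And>x. x \<in> A \<Longrightarrow> \<mu> (?e x) = \<zero>\<^bsub>R\<^esub>" for A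
      using that by (induction A rule: finite_induct) (simp_all add: zero add)
    have rest: "\<mu> (sum ?e (verts G - \<alpha> ` {..<k})) = \<zero>\<^bsub>R\<^esub>"
      by (rule sum_zero) (use f g ij finite_verts in \<open>auto intro!: vanish\<close>)
    have "(\<Oplus>\<^bsub>R\<^esub>l\<in>{..<k}. \<mu> (entry (\<alpha> i) (\<alpha> l) f) \<otimes>\<^bsub>R\<^esub> \<mu> (entry (\<alpha> l) (\<alpha> j) g)) =
        \<mu> (\<Sum>l<k. ?e (\<alpha> l))"
      using finsum_ring_hom[OF R \<mu>, of "{..<k}" "\<lambda>l. ?e (\<alpha> l)"] by (simp add: mult)
    also have "(\<Sum>l<k. ?e (\<alpha> l)) = sum ?e (\<alpha> ` {..<k})"
      by (simp add: sum.reindex[OF \<alpha>(1)])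
    also have "\<mu> \<dots> = \<mu> (sum ?e (verts G))"
      using sum.subset_diff[OF \<alpha>(2) finite_verts, of ?e] rest c by (simp add: add)
    also have "sum ?e (verts G) = entry (\<alpha> i) (\<alpha> j) (bilinear_extension path_mult f g)"
      by (rule entry_mult[symmetric]) (use f g in simp_all)
    also have "(\<Oplus>\<^bsub>R\<^esub>l\<in>{..<k}. \<mu> (entry (\<alpha> i) (\<alpha> l) f) \<otimes>\<^bsub>R\<^esub> \<mu> (entry (\<alpha> l) (\<alpha> j) g)) =
        (\<Oplus>\<^bsub>R\<^esub>l\<in>{..<k}. block k \<alpha> \<mu> f $$ (i, l) \<otimes>\<^bsub>R\<^esub> block k \<alpha> \<mu> g $$ (l, j))"
      by (rule R.finsum_cong') (use ij c in \<open>auto simp: block_def\<close>)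
    finally show "block k \<alpha> \<mu> (f \<otimes>\<^bsub>path_ring\<^esub> g) $$ (i, j) =
        (block k \<alpha> \<mu> f \<otimes>\<^bsub>matrix_ring k R\<^esub> block k \<alpha> \<mu> g) $$ (i, j)"
      using ij by (simp add: block_def[of k \<alpha> \<mu> "bilinear_extension path_mult f g"])
  qed (simp_all add: block_def)
next
  interpret h: ring_hom_ring "ring_of_type_algebra :: 'c poly ring" R \<mu>
    by (intro ring_hom_ringI2 assms ring_from_type_algebra)
  show "block k \<alpha> \<mu> \<one>\<^bsub>path_ring\<^esub> = \<one>\<^bsub>matrix_ring k R\<^esub>"
  proof (rule eq_matI)
    fix i j assume "i < dim_row \<one>\<^bsub>matrix_ring k R\<^esub>" "j < dim_col \<one>\<^bsub>matrix_ring k R\<^esub>"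
    then have ij: "i < k" "j < k" by simp_all
    then have "\<alpha> i \<in> verts G" "\<alpha> i = \<alpha> j \<longleftrightarrow> i = j" using \<alpha> by (auto dest: inj_onD)
    then show "block k \<alpha> \<mu> \<one>\<^bsub>path_ring\<^esub> $$ (i, j) = \<one>\<^bsub>matrix_ring k R\<^esub> $$ (i, j)"
      using ij h.hom_zero h.hom_one by (simp add: block_def entry_one)
  qed (simp_all add: block_def)
qed

end

section \<open>Residue rings of rational polynomials, products and surjective images of
  rings\<close>

lemma rat_poly_quotient:
  fixes c :: "rat poly"
  defines "\<pi> \<equiv> \<lambda>p. Idl\<^bsub>rat_poly_ring\<^esub> {c} +>\<^bsub>rat_poly_ring\<^esub> p"
  shows "ring (rat_poly_ring Quot Idl\<^bsub>rat_poly_ring\<^esub> {c})"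
    and "\<pi> \<in> Ring.ring_hom rat_poly_ring (rat_poly_ring Quot Idl\<^bsub>rat_poly_ring\<^esub> {c})"
    and "carrier (rat_poly_ring Quot Idl\<^bsub>rat_poly_ring\<^esub> {c}) = range \<pi>"
    and "\<pi> p = \<pi> q \<longleftrightarrow> c dvd p - q"
    and "\<zero>\<^bsub>rat_poly_ring Quot Idl\<^bsub>rat_poly_ring\<^esub> {c}\<^esub> = \<pi> 0"
proof -
  interpret P: cring rat_poly_ring by (rule cring_from_type_algebra)
  interpret ideal "Idl\<^bsub>rat_poly_ring\<^esub> {c}" rat_poly_ring
    by (rule P.genideal_ideal) simp
  have Idl: "Idl\<^bsub>rat_poly_ring\<^esub> {c} = {p. c dvd p}"
    using P.cgenideal_eq_genideal[of c] by (auto simp: cgenideal_def dvd_def mult.commute)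
  have \<pi>: "\<pi> p = {q. c dvd q - p}" for p
  proof -
    have "q \<in> \<pi> p \<longleftrightarrow> c dvd q - p" for q
      unfolding \<pi>_def a_r_coset_def' Idl by (auto intro!: exI[of _ "q - p"])
    then show ?thesis by blast
  qed
  show "ring (rat_poly_ring Quot Idl\<^bsub>rat_poly_ring\<^esub> {c})" by (rule quotient_is_ring)
  show hom: "\<pi> \<in> Ring.ring_hom rat_poly_ring (rat_poly_ring Quot Idl\<^bsub>rat_poly_ring\<^esub> {c})"
    unfolding \<pi>_def by (rule rcos_ring_hom)
  show "carrier (rat_poly_ring Quot Idl\<^bsub>rat_poly_ring\<^esub> {c}) = range \<pi>"
    by (auto simp: FactRing_def A_RCOSETS_def' \<pi>_def)
  show "\<pi> p = \<pi> q \<longleftrightarrow> c dvd p - q"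
  proof
    assume "\<pi> p = \<pi> q"
    moreover have "p \<in> \<pi> p" by (simp add: \<pi>)
    ultimately show "c dvd p - q" by (simp add: \<pi>)
  next
    assume pq: "c dvd p - q"
    have "c dvd r - p \<longleftrightarrow> c dvd r - q" for r
      using dvd_add_left_iff[OF pq, of "r - p"] by simp
    then show "\<pi> p = \<pi> q" by (simp add: \<pi>)
  qed
  show "\<zero>\<^bsub>rat_poly_ring Quot Idl\<^bsub>rat_poly_ring\<^esub> {c}\<^esub> = \<pi> 0"
    by (simp add: \<pi> FactRing_def Idl)
qed

lemma eval_0_ring_hom: "(\<lambda>p. poly p 0) \<in> Ring.ring_hom rat_poly_ring rat_ring"
  by (rule ring_hom_memI) simp_all

lemma RDirProd_hom:
  assumes "f \<in> Ring.ring_hom R A" "g \<in> Ring.ring_hom R B"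
  shows "(\<lambda>x. (f x, g x)) \<in> Ring.ring_hom R (RDirProd A B)"
  using assms unfolding Ring.ring_hom_def
  by (auto simp: RDirProd_def DirProd_def monoid.defs)

lemma RDirProd_zero: "\<zero>\<^bsub>RDirProd A B\<^esub> = (\<zero>\<^bsub>A\<^esub>, \<zero>\<^bsub>B\<^esub>)"
  by (simp add: RDirProd_def DirProd_def monoid.defs)

text \<open>The ring axioms pass to homomorphic images. This is how the product of matrix rings in
  the conclusion is seen to be a ring.\<close>

lemma ring_surjective_image:
  assumes "ring R" "h \<in> Ring.ring_hom R (S :: 's ring)" "h ` carrier R = carrier S" "h \<zero>\<^bsub>R\<^esub> = \<zero>\<^bsub>S\<^esub>"
  shows "ring S"
proof -
  have "ring (S \<lparr>carrier := h ` carrier R, zero := h \<zero>\<^bsub>R\<^esub>\<rparr>)"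
    by (rule ring.ring_hom_imp_img_ring[OF assms(1,2)])
  then show ?thesis unfolding assms by simp
qed

text \<open>The constant terms in the branches \<beta> and \<gamma> feed the two rational blocks:
  branches 0 and 1 for the Coxeter graph, branches 2 and 3 for the doubled graph.
  \<open>nf_sum_mem\<close> shows that the kernel lies in the ideal, \<open>J_dvd\<close> and
  \<open>J_const\<close> show that the relations lie in the kernel. The exponent is 1 from branch 1
  to branch 0, and on the diagonal in the Coxeter case.\<close>

locale two_block_presentation = branched_quotient G Br len vx ed z "Idl\<^bsub>free_algebra (paths G) path_mult
      (\<Sum>s\<in>verts G. Poly_Mapping.single (s, [], s) 1)\<^esub> J"
  for G :: "('v, 'e) pre_digraph" and Br len vx ed z
    and J :: "(('v, 'e) path \<Rightarrow>\<^sub>0 rat) set" +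
  fixes c :: "rat poly" and \<beta> \<gamma> n m :: nat
  assumes lens: "len 0 = n" "len 1 = m" "len \<beta> = n" "len \<gamma> = m"
    and Br_eq: "Br = {0, 1, \<beta>, \<gamma>}"
    and blocks: "\<beta> = 0 \<and> \<gamma> = 1 \<or> \<beta> = 2 \<and> \<gamma> = 3"
    and c_0: "poly c 0 \<noteq> 0"
    and keys_J: "x \<in> J \<Longrightarrow> Poly_Mapping.keys x \<subseteq> paths G"
    and nf_sum_mem: "u \<in> verts G \<Longrightarrow> v \<in> verts G \<Longrightarrow> br u < 2 \<Longrightarrow> br v < 2 \<Longrightarrow>
      nf_sum u v (Polynomial.monom 1 (if br u = 1 \<and> br v = 0 \<or> \<beta> = 0 \<and> br u = br v then 1 else 0) * c * g)
        \<in> Idl\<^bsub>free_algebra (paths G) path_mult (\<Sum>s\<in>verts G. Poly_Mapping.single (s, [], s) 1)\<^esub> J"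
    and J_dvd: "x \<in> J \<Longrightarrow> u \<in> verts G \<Longrightarrow> v \<in> verts G \<Longrightarrow> br u < 2 \<Longrightarrow> br v < 2 \<Longrightarrow> c dvd entry u v x"
    and J_const: "x \<in> J \<Longrightarrow> u \<in> verts G \<Longrightarrow> v \<in> verts G \<Longrightarrow> br u = br v \<Longrightarrow> br u \<in> {\<beta>, \<gamma>} \<Longrightarrow>
      poly (entry u v x) 0 = 0"
begin

abbreviation "I \<equiv> Idl\<^bsub>free_algebra (paths G) path_mult
      (\<Sum>s\<in>verts G. Poly_Mapping.single (s, [], s) 1)\<^esub> J"

abbreviation "L \<equiv> rat_poly_ring Quot Idl\<^bsub>rat_poly_ring\<^esub> {c}"

abbreviation \<pi> :: "rat poly \<Rightarrow> rat poly set" where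
  "\<pi> p \<equiv> Idl\<^bsub>rat_poly_ring\<^esub> {c} +>\<^bsub>rat_poly_ring\<^esub> p"

abbreviation "K \<equiv> RDirProd (matrix_ring (m + n + 2) L)
  (RDirProd (matrix_ring (n + 1) rat_ring) (matrix_ring (m + 1) rat_ring))"

definition \<alpha> :: "nat \<Rightarrow> 'v" where
  "\<alpha> i = (if i < Suc n then vx 0 i else vx 1 (i - Suc n))"

definition \<alpha>_inv :: "'v \<Rightarrow> nat" where
  "\<alpha>_inv u = (if br u = 0 then ix u else Suc n + ix u)"

lemma \<alpha>_verts: "i < m + n + 2 \<Longrightarrow> \<alpha> i \<in> verts G" and br_\<alpha>: "i < m + n + 2 \<Longrightarrow> br (\<alpha> i) < 2"
  using Br01 lens by (auto simp: \<alpha>_def)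

lemma \<alpha>_inv_\<alpha>: "i < m + n + 2 \<Longrightarrow> \<alpha>_inv (\<alpha> i) = i"
  using Br01 lens by (auto simp: \<alpha>_def \<alpha>_inv_def)

lemma \<alpha>_\<alpha>_inv:
  assumes "u \<in> verts G" "br u < 2"
  shows "\<alpha> (\<alpha>_inv u) = u" "\<alpha>_inv u < m + n + 2"
proof -
  have "ix u \<le> len (br u)" "vx (br u) (ix u) = u" using assms ix_len by auto
  moreover have "br u = 0 \<or> br u = 1" using assms(2) by linarith
  ultimately show "\<alpha> (\<alpha>_inv u) = u" "\<alpha>_inv u < m + n + 2"
    using lens by (auto simp: \<alpha>_def \<alpha>_inv_def)
qed

definition h :: "(('v, 'e) path \<Rightarrow>\<^sub>0 rat) \<Rightarrow> rat poly set mat \<times> rat mat \<times> rat mat" where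
  "h f = (block (m + n + 2) \<alpha> \<pi> f, block (n + 1) (vx \<beta>) (\<lambda>p. poly p 0) f,
     block (m + 1) (vx \<gamma>) (\<lambda>p. poly p 0) f)"

lemma eval_entry_eq_0:
  assumes "Poly_Mapping.keys f \<subseteq> paths G" "\<not> admissible (br u) (br v) 0"
  shows "poly (entry u v f) 0 = 0"
  using coeff_entry_admissible[OF assms(1), of u v 0] assms(2) by (auto simp: poly_0_coeff_0)

lemma entry_eq_0:
  assumes "Poly_Mapping.keys f \<subseteq> paths G" "\<And>k. \<not> admissible (br u) (br v) k"
  shows "entry u v f = 0"
  by (rule poly_eqI) (use coeff_entry_admissible[OF assms(1)] assms(2) in auto)

text \<open>Leaving a branch and coming back either is impossible or uses \<open>z False\<close>, so
  detours contribute nothing to constant terms.\<close>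

lemma constant_block_hom:
  assumes "b \<in> {\<beta>, \<gamma>}"
  shows "block (len b + 1) (vx b) (\<lambda>p. poly p 0) \<in> Ring.ring_hom path_ring (matrix_ring (len b + 1) rat_ring)"
proof (rule block_hom)
  have b: "b \<in> Br" using assms Br_eq by auto
  show "ring rat_ring" by (rule ring_from_type_algebra)
  show "(\<lambda>p. poly p 0) \<in> Ring.ring_hom rat_poly_ring rat_ring" by (rule eval_0_ring_hom)
  show "inj_on (vx b) {..<len b + 1}" by (rule inj_onI) (use vx_inj b in auto)
  show "vx b ` {..<len b + 1} \<subseteq> verts G" using b by auto
  fix f g :: "('v, 'e) path \<Rightarrow>\<^sub>0 rat" and i j x
  assume *: "Poly_Mapping.keys f \<subseteq> paths G" "Poly_Mapping.keys g \<subseteq> paths G" "i < len b + 1" "j < len b + 1"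
    "x \<in> verts G - vx b ` {..<len b + 1}"
  have "br x \<noteq> b"
  proof
    assume "br x = b"
    then have "x = vx b (ix x)" "ix x < len b + 1" using * vx_pos[of x] ix_len[of x] by auto
    then show False using * by auto
  qed
  then have "\<not> admissible b (br x) 0 \<or> \<not> admissible (br x) b 0"
    by (auto simp: admissible_def split: if_splits)
  then show "poly (entry (vx b i) x f * entry x (vx b j) g) 0 = \<zero>\<^bsub>rat_ring\<^esub>"
    using eval_entry_eq_0[OF *(1), of "vx b i" x] eval_entry_eq_0[OF *(2), of x "vx b j"] * b by auto
qed

text \<open>No walk leaves the branches 0 and 1, so the entries leading out of this block are
  zero.\<close>

lemma main_block_hom:
  "block (m + n + 2) \<alpha> \<pi> \<in> Ring.ring_hom path_ring (matrix_ring (m + n + 2) L)"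
proof (rule block_hom)
  show "ring L" "\<pi> \<in> Ring.ring_hom rat_poly_ring L" by (rule rat_poly_quotient)+
  show "inj_on \<alpha> {..<m + n + 2}" by (rule inj_on_inverseI[of _ \<alpha>_inv]) (use \<alpha>_inv_\<alpha> in auto)
  show "\<alpha> ` {..<m + n + 2} \<subseteq> verts G" using \<alpha>_verts by auto
  fix f g :: "('v, 'e) path \<Rightarrow>\<^sub>0 rat" and i j x
  assume *: "Poly_Mapping.keys f \<subseteq> paths G" "Poly_Mapping.keys g \<subseteq> paths G" "i < m + n + 2" "j < m + n + 2"
    "x \<in> verts G - \<alpha> ` {..<m + n + 2}"
  have "\<not> br x < 2" using \<alpha>_\<alpha>_inv[of x] * by (metis DiffD1 DiffD2 imageI lessThan_iff)
  then have "entry (\<alpha> i) x f = 0"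
    by (intro entry_eq_0[OF *(1)]) (use br_\<alpha>[OF *(3)] in \<open>auto simp: admissible_def\<close>)
  then show "\<pi> (entry (\<alpha> i) x f * entry x (\<alpha> j) g) = \<zero>\<^bsub>L\<^esub>"
    by (simp add: rat_poly_quotient(5))
qed

lemma h_hom: "h \<in> Ring.ring_hom path_ring K"
  using RDirProd_hom[OF main_block_hom RDirProd_hom[OF constant_block_hom[of \<beta>] constant_block_hom[of \<gamma>]]]
  unfolding h_def[abs_def] lens by simp

lemma carrier_L: "carrier L = range \<pi>"
  by (rule rat_poly_quotient(3))

lemma carrier_K: "carrier K = carrier (matrix_ring (m + n + 2) L) \<times>
    carrier (matrix_ring (n + 1) rat_ring) \<times> carrier (matrix_ring (m + 1) rat_ring)"
  by (simp only: RDirProd_carrier)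

lemma block_eq_zero_iff:
  "block k a \<mu> f = \<zero>\<^bsub>matrix_ring k R\<^esub> \<longleftrightarrow> (\<forall>i<k. \<forall>j<k. \<mu> (entry (a i) (a j) f) = \<zero>\<^bsub>R\<^esub>)"
  by (auto simp: block_def mat_eq_iff)

lemma h_eq_zero_iff:
  "h f = \<zero>\<^bsub>K\<^esub> \<longleftrightarrow>
    (\<forall>u\<in>verts G. \<forall>v\<in>verts G. br u < 2 \<and> br v < 2 \<longrightarrow> c dvd entry u v f) \<and>
    (\<forall>u\<in>verts G. \<forall>v\<in>verts G. br u = br v \<and> br u \<in> {\<beta>, \<gamma>} \<longrightarrow> poly (entry u v f) 0 = 0)"
proof -
  have 1: "block (m + n + 2) \<alpha> \<pi> f = \<zero>\<^bsub>matrix_ring (m + n + 2) L\<^esub> \<longleftrightarrow>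
      (\<forall>u\<in>verts G. \<forall>v\<in>verts G. br u < 2 \<and> br v < 2 \<longrightarrow> c dvd entry u v f)"
    unfolding block_eq_zero_iff rat_poly_quotient(4,5) diff_zero
    using \<alpha>_verts br_\<alpha> \<alpha>_\<alpha>_inv by metis
  have 2: "block (len b + 1) (vx b) (\<lambda>p. poly p 0) f = \<zero>\<^bsub>matrix_ring (len b + 1) rat_ring\<^esub> \<longleftrightarrow>
      (\<forall>u\<in>verts G. \<forall>v\<in>verts G. br u = b \<and> br v = b \<longrightarrow> poly (entry u v f) 0 = 0)" if "b \<in> Br" for b
  proof
    assume *: "block (len b + 1) (vx b) (\<lambda>p. poly p 0) f = \<zero>\<^bsub>matrix_ring (len b + 1) rat_ring\<^esub>"
    show "\<forall>u\<in>verts G. \<forall>v\<in>verts G. br u = b \<and> br v = b \<longrightarrow> poly (entry u v f) 0 = 0"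
    proof (intro ballI impI)
      fix u v assume uv: "u \<in> verts G" "v \<in> verts G" "br u = b \<and> br v = b"
      then have "ix u < len b + 1" "ix v < len b + 1" "vx b (ix u) = u" "vx b (ix v) = v"
        using ix_len[of u] ix_len[of v] vx_pos[of u] vx_pos[of v] by auto
      then show "poly (entry u v f) 0 = 0"
        using *[unfolded block_eq_zero_iff] by fastforce
    qed
  next
    assume "\<forall>u\<in>verts G. \<forall>v\<in>verts G. br u = b \<and> br v = b \<longrightarrow> poly (entry u v f) 0 = 0"
    then show "block (len b + 1) (vx b) (\<lambda>p. poly p 0) f = \<zero>\<^bsub>matrix_ring (len b + 1) rat_ring\<^esub>"
      unfolding block_eq_zero_iff using that by simp
  qed
  show ?thesis
    unfolding h_def RDirProd_zero prod.inject 1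
    using 2[of \<beta>, unfolded lens] 2[of \<gamma>, unfolded lens] Br_eq by auto
qed

text \<open>Entry by entry: in the branches 0 and 1 the entry is a multiple of \<open>c\<close>,
  with an extra factor t wherever \<open>nf_sum_mem\<close> asks for it; all remaining entries
  vanish.\<close>

lemma kernel_subset:
  assumes f: "Poly_Mapping.keys f \<subseteq> paths G" and h: "h f = \<zero>\<^bsub>K\<^esub>"
  shows "f \<in> I"
proof -
  have "nf_sum u v (entry u v f) \<in> I" if uv: "u \<in> verts G" "v \<in> verts G" for u v
  proof (cases "br u < 2 \<and> br v < 2")
    case True
    then obtain g where g: "entry u v f = c * g"
      using h uv unfolding h_eq_zero_iff by (meson dvdE)
    show ?thesis
    proof (cases "br u = 1 \<and> br v = 0 \<or> \<beta> = 0 \<and> br u = br v")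
      case shifted: True
      \<comment> \<open>From branch 1 to branch 0 no walk has weight 0. On the diagonal, which is
        shifted only if \<open>\<beta> = 0\<close>, the rational blocks supply the
        vanishing.\<close>
      have "poly (entry u v f) 0 = 0"
      proof (cases "br u = 1 \<and> br v = 0")
        case True
        then show ?thesis by (intro eval_entry_eq_0[OF f]) (simp add: admissible_def)
      next
        case False
        then show ?thesis using h uv shifted True blocks unfolding h_eq_zero_iff by fastforce
      qed
      \<comment> \<open>As \<open>c\<close> has a nonzero constant term, the zero at 0 passes to the
        cofactor, which yields the factor t.\<close>
      then have "poly g 0 = 0" using g c_0 by simp
      then obtain g' where "g = pCons 0 g'" by (cases g) auto
      then have "entry u v f = Polynomial.monom 1 1 * c * g'"
        using g by (simp add: monom_Suc One_nat_def monom_0)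
      then show ?thesis using nf_sum_mem[OF uv, of g'] True shifted by simp
    next
      case False
      have "entry u v f = Polynomial.monom 1 0 * c * g" using g by simp
      moreover have "(if br u = 1 \<and> br v = 0 \<or> \<beta> = 0 \<and> br u = br v then 1 else 0) = (0::nat)"
        using False by (rule if_not_P)
      ultimately show ?thesis
        using nf_sum_mem[OF uv conjunct1[OF True] conjunct2[OF True], of g] by (simp only:)
    qed
  next
    case False
    have "entry u v f = 0"
    proof (rule poly_eqI)
      fix k
      show "Polynomial.coeff (entry u v f) k = Polynomial.coeff 0 k"
      proof (cases "admissible (br u) (br v) k")
        case True
        \<comment> \<open>Outside the branches 0 and 1 only weight 0 within one branch is possible,
          so the entry equals its constant term, which vanishes by hypothesis.\<close>
        then have "br u = br v" "k = 0" "br u \<ge> 2"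
          using False by (auto simp: admissible_def split: if_splits)
        moreover have "br u \<in> {\<beta>, \<gamma>}" using br_Br[OF uv(1)] \<open>br u \<ge> 2\<close> Br_eq by auto
        ultimately show ?thesis using h uv unfolding h_eq_zero_iff by (simp add: poly_0_coeff_0)
      next
        case False
        then show ?thesis using coeff_entry_admissible[OF f] by auto
      qed
    qed
    then show ?thesis by simp
  qed
  then have "(\<Sum>uv\<in>verts G \<times> verts G. nf_sum (fst uv) (snd uv) (entry (fst uv) (snd uv) f)) \<in> I"
    by (intro sum_mem) auto
  then show ?thesis using cong_mem[OF nf_sum_decomposition[OF f]] by blast
qed

lemma h_surj: "h ` carrier path_ring = carrier K"
proof
  show "h ` carrier path_ring \<subseteq> carrier K"
    by (rule image_subsetI) (rule ring_hom_closed[OF h_hom])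
  show "carrier K \<subseteq> h ` carrier path_ring"
  proof
    fix y assume y: "y \<in> carrier K"
    obtain A M N where AMN: "y = (A, M, N)" by (cases y)
    have A: "A \<in> carrier_mat (m + n + 2) (m + n + 2)"
      "\<And>i j. i < m + n + 2 \<Longrightarrow> j < m + n + 2 \<Longrightarrow> A $$ (i, j) \<in> range \<pi>"
      and MN: "M \<in> carrier_mat (n + 1) (n + 1)" "N \<in> carrier_mat (m + 1) (m + 1)"
      using y unfolding carrier_K AMN by (simp_all add: carrier_L)
    \<comment> \<open>A polynomial representing the prescribed residue class at the position of u
      and v.\<close>
    define g where "g u v = (SOME p. A $$ (\<alpha>_inv u, \<alpha>_inv v) = \<pi> p)" for u v
    have g: "A $$ (i, j) = \<pi> (g (\<alpha> i) (\<alpha> j))" if "i < m + n + 2" "j < m + n + 2" for i j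
      using someI_ex[of "\<lambda>p. A $$ (i, j) = \<pi> p"] A(2)[OF that] unfolding g_def \<alpha>_inv_\<alpha>[OF that(1)] \<alpha>_inv_\<alpha>[OF that(2)]
      by blast
    \<comment> \<open>The prescribed constant term. It is 0 off the rational blocks; from branch 1
      to branch 0 this value is forced, since no walk there has weight 0.\<close>
    define q where "q u v = (if br u = \<beta> \<and> br v = \<beta> then M $$ (ix u, ix v)
      else if br u = \<gamma> \<and> br v = \<gamma> then N $$ (ix u, ix v) else 0)" for u v
    \<comment> \<open>Chinese remainders for \<open>c\<close> and t: adding a multiple of
      \<open>c\<close> preserves the class of g and, as \<open>poly c 0\<close> is nonzero, adjusts
      the constant term to q.\<close>
    define D where "D u v = (if br u < 2 \<and> br v < 2
      then g u v + c * [:(q u v - poly (g u v) 0) / poly c 0:] else [:q u v:])" for u v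
    have D_0: "poly (D u v) 0 = q u v" for u v
      using c_0 by (simp add: D_def)
    have "\<exists>f. Poly_Mapping.keys f \<subseteq> paths G \<and> (\<forall>u\<in>verts G. \<forall>v\<in>verts G. entry u v f = D u v)"
    proof (rule entry_surj)
      fix u v k assume uv: "u \<in> verts G" "v \<in> verts G" and k: "Polynomial.coeff (D u v) k \<noteq> 0"
      show "admissible (br u) (br v) k"
      proof (cases "br u < 2 \<and> br v < 2")
        case True
        have "q u v = 0" if "br u = 1" "br v = 0" using blocks that by (auto simp: q_def)
        then have "k \<noteq> 0" if "br u = 1" "br v = 0"
          using k D_0[of u v] that by (metis poly_0_coeff_0)
        then show ?thesis using True by (auto simp: admissible_def)
      next
        case False
        then have D: "D u v = [:q u v:]" unfolding D_def by (simp only: if_False)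
        then have "k = 0" using k by (cases k) auto
        moreover have "q u v \<noteq> 0" using k D \<open>k = 0\<close> by simp
        then have "br u = br v" by (auto simp: q_def split: if_splits)
        ultimately show ?thesis using False by (auto simp: admissible_def)
      qed
    qed
    then obtain f where f: "Poly_Mapping.keys f \<subseteq> paths G"
      "\<And>u v. u \<in> verts G \<Longrightarrow> v \<in> verts G \<Longrightarrow> entry u v f = D u v" by blast
    have in_Br: "\<beta> \<in> Br" "\<gamma> \<in> Br" by (simp_all add: Br_eq)
    have distinct: "\<gamma> \<noteq> \<beta>" using blocks by auto
    have "block (m + n + 2) \<alpha> \<pi> f = A"
    proof (rule eq_matI)
      fix i j assume "i < dim_row A" "j < dim_col A"
      then have ij: "i < m + n + 2" "j < m + n + 2" using A(1) by auto
      have "c dvd D (\<alpha> i) (\<alpha> j) - g (\<alpha> i) (\<alpha> j)"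
        using br_\<alpha>[OF ij(1)] br_\<alpha>[OF ij(2)] by (simp add: D_def del: mult_pCons_right)
      then have "\<pi> (D (\<alpha> i) (\<alpha> j)) = \<pi> (g (\<alpha> i) (\<alpha> j))"
        unfolding rat_poly_quotient(4) .
      then show "block (m + n + 2) \<alpha> \<pi> f $$ (i, j) = A $$ (i, j)"
        using ij f(2)[OF \<alpha>_verts[OF ij(1)] \<alpha>_verts[OF ij(2)]] g[OF ij] by (simp add: block_def)
    qed (use A(1) in \<open>auto simp: block_def\<close>)
    moreover have "block (n + 1) (vx \<beta>) (\<lambda>p. poly p 0) f = M"
    proof (rule eq_matI)
      fix i j assume "i < dim_row M" "j < dim_col M"
      then have ij: "i < n + 1" "j < n + 1" using MN by auto
      then have "i \<le> len \<beta>" "j \<le> len \<beta>" by (simp_all add: lens)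
      with in_Br have "pos (vx \<beta> i) = (\<beta>, i)" "pos (vx \<beta> j) = (\<beta>, j)"
        "vx \<beta> i \<in> verts G" "vx \<beta> j \<in> verts G" by simp_all
      then show "block (n + 1) (vx \<beta>) (\<lambda>p. poly p 0) f $$ (i, j) = M $$ (i, j)"
        using ij by (simp add: block_def f(2) D_0 q_def)
    qed (use MN in \<open>auto simp: block_def\<close>)
    moreover have "block (m + 1) (vx \<gamma>) (\<lambda>p. poly p 0) f = N"
    proof (rule eq_matI)
      fix i j assume "i < dim_row N" "j < dim_col N"
      then have ij: "i < m + 1" "j < m + 1" using MN by auto
      then have "i \<le> len \<gamma>" "j \<le> len \<gamma>" by (simp_all add: lens)
      with in_Br have "pos (vx \<gamma> i) = (\<gamma>, i)" "pos (vx \<gamma> j) = (\<gamma>, j)"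
        "vx \<gamma> i \<in> verts G" "vx \<gamma> j \<in> verts G" by simp_all
      then show "block (m + 1) (vx \<gamma>) (\<lambda>p. poly p 0) f $$ (i, j) = N $$ (i, j)"
        using ij distinct by (simp add: block_def f(2) D_0 q_def)
    qed (use MN in \<open>auto simp: block_def\<close>)
    ultimately have "y = h f" by (simp add: AMN h_def)
    then show "y \<in> h ` carrier path_ring" using f(1) by simp
  qed
qed

theorem quotient_iso: "path_ring Quot I \<simeq> K"
proof -
  have R: "ring path_ring" by (rule path.ring_free_algebra)
  have h0: "h \<zero>\<^bsub>path_ring\<^esub> = \<zero>\<^bsub>K\<^esub>"
    unfolding h_eq_zero_iff by simp
  have K: "ring K" by (rule ring_surjective_image[OF R h_hom h_surj h0])
  interpret h: ring_hom_ring path_ring K h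
    using R K h_hom by (intro ring_hom_ringI2)
  have ker: "a_kernel path_ring K h = {f. Poly_Mapping.keys f \<subseteq> paths G \<and> h f = \<zero>\<^bsub>K\<^esub>}"
    unfolding a_kernel_def' by simp
  have "I \<subseteq> a_kernel path_ring K h"
  proof (rule ring.genideal_minimal[OF R h.kernel_is_ideal])
    show "J \<subseteq> a_kernel path_ring K h"
      unfolding ker h_eq_zero_iff using keys_J J_dvd J_const by auto
  qed
  moreover have "a_kernel path_ring K h \<subseteq> I"
    unfolding ker using kernel_subset by blast
  ultimately have "a_kernel path_ring K h = I" by blast
  then show ?thesis using h.FactRing_iso[OF h_surj] by simp
qed

end

section \<open>The two presentations by edge relators\<close>

context branched_graph
begin

lemma entry_diff: "entry u v (f - g) = entry u v f - (entry u v g :: 'c::comm_ring_1 poly)"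
  using entry.extension_add[of u v "f - g" g] by (simp add: algebra_simps)

text \<open>The polynomial t - 1 evaluated at a branch edge, written out as a difference of two
  paths so that both graphs can share it.\<close>

definition branch_relator :: "nat \<Rightarrow> nat \<Rightarrow> bool \<Rightarrow> (('v, 'e) path \<Rightarrow>\<^sub>0 rat)" where
  "branch_relator b i d =
     Poly_Mapping.single (tail G (ed b i d), [ed b i d, ed b i (\<not> d)], tail G (ed b i d)) 1
     - Poly_Mapping.single (tail G (ed b i d), [], tail G (ed b i d)) 1"

abbreviation z_loop :: "bool \<Rightarrow> nat \<Rightarrow> 'e list" where
  "z_loop d k \<equiv> concat (replicate k [z d, z (\<not> d)])"

lemma tail_z_verts [simp]: "tail G (z d) \<in> verts G" "head G (z d) \<in> verts G"
  using z_arcs tail_in_verts head_in_verts by auto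

lemma tail_z_not: "tail G (z (\<not> d)) = head G (z d)" "head G (z (\<not> d)) = tail G (z d)"
  by (simp_all add: tail_z head_z)

lemma weight_z_loop: "weight (z_loop d k) = k"
proof (induction k)
  case (Suc k)
  then show ?case by (cases d) simp_all
qed simp

lemma awalk_z_loop: "awalk (tail G (z d)) (z_loop d k) (tail G (z d))"
proof (induction k)
  case 0
  show ?case by (simp add: awalk_Nil_iff)
next
  case (Suc k)
  then show ?case by (simp add: awalk_Cons_iff tail_z_not)
qed

lemma keys_branch_relator:
  assumes "b \<in> Br" "i < len b"
  shows "Poly_Mapping.keys (branch_relator b i d) \<subseteq> paths G"
proof -
  have e: "tail G (ed b i d) \<in> verts G" "tail G (ed b i (\<not> d)) = head G (ed b i d)"
    "head G (ed b i (\<not> d)) = tail G (ed b i d)"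
    using assms by (auto simp: tail_ed head_ed)
  then have "awalk (tail G (ed b i d)) [ed b i d, ed b i (\<not> d)] (tail G (ed b i d))"
    "awalk (tail G (ed b i d)) [] (tail G (ed b i d))"
    using assms by (simp_all add: awalk_Cons_iff awalk_Nil_iff)
  then show ?thesis
    unfolding branch_relator_def
    by (intro subsetI) (auto simp: in_keys_iff lookup_minus lookup_single when_def split: if_splits)
qed

lemma entry_branch_relator:
  assumes "b \<in> Br" "i < len b"
  shows "entry u v (branch_relator b i d) = 0"
  using assms by (auto simp: branch_relator_def entry_diff ed_neq_z)

lemma keys_presentation:
  assumes "r \<in> {branch_relator b i d | b i d. b \<in> Br \<and> i < len b} \<union> range (\<lambda>d. walk_sum (x d) (w d) (y d) c)"
    and "\<And>d k. awalk (x d) (w d k) (y d)"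
  shows "Poly_Mapping.keys r \<subseteq> paths G"
proof -
  from assms(1) consider b i d where "b \<in> Br" "i < len b" "r = branch_relator b i d"
    | d where "r = walk_sum (x d) (w d) (y d) c" by blast
  then show ?thesis
  proof cases
    case 1
    then show ?thesis by (simp only: keys_branch_relator)
  next
    case 2
    show ?thesis unfolding 2 by (rule keys_walk_sum) (simp only: mem_paths assms(2))
  qed
qed

lemma branched_quotientI:
  assumes "\<And>r. r \<in> J \<Longrightarrow> Poly_Mapping.keys r \<subseteq> paths G"
    and "\<And>b i d. b \<in> Br \<Longrightarrow> i < len b \<Longrightarrow> branch_relator b i d \<in> J"
  shows "branched_quotient G Br len vx ed z (Idl\<^bsub>path_ring\<^esub> J)"
proof -
  interpret I: algebra_ideal "paths G" path_mult "\<Sum>s\<in>verts G. Poly_Mapping.single (s, [], s) 1"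
    "Idl\<^bsub>path_ring\<^esub> J"
    by (rule path.algebra_ideal_genideal) (rule assms(1))
  show ?thesis
  proof unfold_locales
    fix b i d assume "b \<in> Br" "i < len b"
    from path.mem_genideal[OF assms(1) assms(2)[OF this]]
    show "Poly_Mapping.single (tail G (ed b i d), [ed b i d, ed b i (\<not> d)], tail G (ed b i d)) 1
      - Poly_Mapping.single (tail G (ed b i d), [], tail G (ed b i d)) 1 \<in> Idl\<^bsub>path_ring\<^esub> J"
      by (simp only: branch_relator_def)
  qed
qed

text \<open>The relator along \<open>z True\<close> has entry c from branch 0 to branch 1, the one
  along \<open>z False\<close> has entry t c in the opposite direction. Extending either to a
  diagonal position yields t c: the first still has to cross \<open>z False\<close>, the second
  already has.\<close>

lemma coxeter_presentation_iso:
  fixes c :: "rat poly"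
  assumes lens: "len 0 = n" "len 1 = m" and Br: "Br = {0, 1}" and c: "poly c 0 \<noteq> 0"
    and J: "J = {branch_relator b i d | b i d. b \<in> Br \<and> i < len b} \<union>
      range (\<lambda>d. walk_sum (tail G (z d)) (\<lambda>k. z d # z_loop (\<not> d) k) (head G (z d)) c)"
  shows "path_ring Quot Idl\<^bsub>path_ring\<^esub> J \<simeq>
    RDirProd (matrix_ring (m + n + 2) (rat_poly_ring Quot Idl\<^bsub>rat_poly_ring\<^esub> {c}))
      (RDirProd (matrix_ring (n + 1) rat_ring) (matrix_ring (m + 1) rat_ring))"
proof -
  let ?r = "\<lambda>d. walk_sum (tail G (z d)) (\<lambda>k. z d # z_loop (\<not> d) k) (head G (z d)) c"
  have walk: "awalk (tail G (z d)) (z d # z_loop (\<not> d) k) (head G (z d))" for d k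
    using awalk_z_loop[where d = "\<not> d" and k = k] by (simp add: awalk_Cons_iff tail_z_not del: awalk_append_iff)
  have weight: "weight (z d # z_loop (\<not> d) k) = k + (if d then 0 else 1)" for d k
    using weight_z_loop[where d = "\<not> d" and k = k] by (cases d) simp_all
  have keys_J: "Poly_Mapping.keys x \<subseteq> paths G" if "x \<in> J" for x
    using that unfolding J by (rule keys_presentation) (rule walk)
  have r: "?r d \<in> Idl\<^bsub>path_ring\<^esub> J" for d
    by (rule path.mem_genideal[OF keys_J]) (auto simp: J)
  interpret branched_quotient G Br len vx ed z "Idl\<^bsub>path_ring\<^esub> J"
    by (rule branched_quotientI[OF keys_J]) (auto simp: J)
  have pos_z: "pos (tail G (z True)) = (0, n)" "pos (head G (z True)) = (1, m)"
    "pos (tail G (z False)) = (1, m)" "pos (head G (z False)) = (0, n)"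
    using Br01 lens by (simp_all add: tail_z head_z)
  have entry_r: "entry u v (?r d) =
      (if u = tail G (z d) \<and> v = head G (z d) then Polynomial.monom 1 (if d then 0 else 1) * c else 0)" for u v d
    by (rule entry_walk_sum) (simp only: weight)
  interpret two_block_presentation G Br len vx ed z J c 0 1 n m
  proof unfold_locales
    fix u v g
    assume uv: "u \<in> verts G" "v \<in> verts G" "br u < 2" "br v < 2"
    let ?\<kappa> = "if br u = 1 \<and> br v = 0 \<or> (0::nat) = 0 \<and> br u = br v then 1 else 0 :: nat"
    show "nf_sum u v (Polynomial.monom 1 ?\<kappa> * c * g) \<in> Idl\<^bsub>path_ring\<^esub> J"
    proof (rule relator_multiple_mem)
      fix t assume t: "?\<kappa> \<le> t"
      show "nf_sum u v (Polynomial.monom 1 t * c) \<in> Idl\<^bsub>path_ring\<^esub> J"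
      proof (cases "br u = 0")
        case True
        then have "admissible (br u) (br (tail G (z True))) 0" "admissible (br (head G (z True))) (br v) t"
          using t uv by (auto simp: pos_z admissible_def split: if_splits)
        from shifted_relator_mem[OF r walk weight uv(1,2) this] show ?thesis by simp
      next
        case False
        then have "br u = 1" using uv by linarith
        then have "1 \<le> t" using t uv(4) by (auto simp: less_2_cases_iff split: if_splits)
        \<comment> \<open>The relator along \<open>z False\<close> has weight offset 1 of its own,
          so the walk after it supplies t - 1.\<close>
        have "admissible (br u) (br (tail G (z False))) 0" "admissible (br (head G (z False))) (br v) (t - 1)"
          using uv \<open>br u = 1\<close> by (auto simp: pos_z admissible_def)
        from shifted_relator_mem[OF r walk weight uv(1,2) this] \<open>1 \<le> t\<close> show ?thesis by simp
      qed
    qed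
  next
    fix x u v assume "x \<in> J"
    then consider b i d where "b \<in> Br" "i < len b" "x = branch_relator b i d" | d where "x = ?r d"
      unfolding J by blast
    then have x: "entry u v x = 0 \<or>
        (\<exists>d. u = tail G (z d) \<and> v = head G (z d) \<and> entry u v x = Polynomial.monom 1 (if d then 0 else 1) * c)"
      by cases (use entry_branch_relator entry_r in metis)+
    then show "c dvd entry u v x" by auto
    assume "br u = br v"
    \<comment> \<open>The relators of \<open>z\<close> join different branches and have no entry
      inside a branch.\<close>
    then have "u \<noteq> tail G (z d) \<or> v \<noteq> head G (z d)" for d using pos_z by (cases d) auto
    then show "poly (entry u v x) 0 = 0" using x by auto
  qed (use lens Br c keys_J in auto)
  show ?thesis by (rule quotient_iso)
qed

text \<open>The relators of \<open>z\<close> are loops with entry c, so c itself occurs on the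
  diagonal and only positions from branch 1 to branch 0 get a factor t. The branches 2 and 3 see
  branch relators alone, and their entries are constants.\<close>

lemma doubled_presentation_iso:
  fixes c :: "rat poly"
  assumes lens: "len 0 = n" "len 1 = m" "len 2 = n" "len 3 = m" and Br: "Br = {0, 1, 2, 3}" and c: "poly c 0 \<noteq> 0"
    and J: "J = {branch_relator b i d | b i d. b \<in> Br \<and> i < len b} \<union>
      range (\<lambda>d. walk_sum (tail G (z d)) (z_loop d) (tail G (z d)) c)"
  shows "path_ring Quot Idl\<^bsub>path_ring\<^esub> J \<simeq>
    RDirProd (matrix_ring (m + n + 2) (rat_poly_ring Quot Idl\<^bsub>rat_poly_ring\<^esub> {c}))
      (RDirProd (matrix_ring (n + 1) rat_ring) (matrix_ring (m + 1) rat_ring))"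
proof -
  let ?r = "\<lambda>d. walk_sum (tail G (z d)) (z_loop d) (tail G (z d)) c"
  have keys_J: "Poly_Mapping.keys x \<subseteq> paths G" if "x \<in> J" for x
    using that unfolding J by (rule keys_presentation) (rule awalk_z_loop)
  have r: "?r d \<in> Idl\<^bsub>path_ring\<^esub> J" for d
    by (rule path.mem_genideal[OF keys_J]) (auto simp: J)
  interpret branched_quotient G Br len vx ed z "Idl\<^bsub>path_ring\<^esub> J"
    by (rule branched_quotientI[OF keys_J]) (auto simp: J)
  have pos_z: "pos (tail G (z True)) = (0, n)" "pos (tail G (z False)) = (1, m)"
    using Br01 lens by (simp_all add: tail_z)
  have entry_r: "entry u v (?r d) = (if u = tail G (z d) \<and> v = tail G (z d) then Polynomial.monom 1 0 * c else 0)" for u v d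
    by (rule entry_walk_sum) (simp add: weight_z_loop)
  have weight: "weight (z_loop d k) = k + 0" for d k by (simp add: weight_z_loop)
  interpret two_block_presentation G Br len vx ed z J c 2 3 n m
  proof unfold_locales
    fix u v g
    assume uv: "u \<in> verts G" "v \<in> verts G" "br u < 2" "br v < 2"
    let ?\<kappa> = "if br u = 1 \<and> br v = 0 \<or> (2::nat) = 0 \<and> br u = br v then 1 else 0 :: nat"
    show "nf_sum u v (Polynomial.monom 1 ?\<kappa> * c * g) \<in> Idl\<^bsub>path_ring\<^esub> J"
    proof (rule relator_multiple_mem)
      fix t assume t: "?\<kappa> \<le> t"
      show "nf_sum u v (Polynomial.monom 1 t * c) \<in> Idl\<^bsub>path_ring\<^esub> J"
      proof (cases "br u = 0")
        case True
        then have "admissible (br u) (br (tail G (z True))) 0" "admissible (br (tail G (z True))) (br v) t"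
          using uv by (auto simp: pos_z admissible_def)
        from shifted_relator_mem[OF r awalk_z_loop weight uv(1,2) this] show ?thesis by simp
      next
        case False
        then have "br u = 1" using uv by linarith
        then have "admissible (br u) (br (tail G (z False))) 0" "admissible (br (tail G (z False))) (br v) t"
          using uv t by (auto simp: pos_z admissible_def split: if_splits)
        from shifted_relator_mem[OF r awalk_z_loop weight uv(1,2) this] show ?thesis by simp
      qed
    qed
  next
    fix x u v assume "x \<in> J"
    then consider b i d where "b \<in> Br" "i < len b" "x = branch_relator b i d" | d where "x = ?r d"
      unfolding J by blast
    then have x: "entry u v x = 0 \<or> (\<exists>d. u = tail G (z d) \<and> entry u v x = Polynomial.monom 1 0 * c)"
      by cases (use entry_branch_relator entry_r in metis)+
    then show "c dvd entry u v x" by auto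
    assume "br u \<in> {2, 3}"
    then have "u \<noteq> tail G (z d)" for d using pos_z by (cases d) auto
    then show "poly (entry u v x) 0 = 0" using x by auto
  qed (use lens Br c keys_J in auto)
  show ?thesis by (rule quotient_iso)
qed

end

lemma eval_return_linear:
  assumes "tail G (arev y) = head G y" "head G (arev y) = tail G y"
  shows "eval_return G arev [:-1, 1:] y =
    Poly_Mapping.single (tail G y, [y, arev y], tail G y) 1 - Poly_Mapping.single (tail G y, [], tail G y) 1"
  unfolding eval_return_eq_walk_sum[of G arev y, OF assms]
  by (simp add: walk_sum_def single_uminus)

lemma (in branched_graph) image_arcs:
  "f ` arcs G = {f (ed b i d) | b i d. b \<in> Br \<and> i < len b} \<union> range (\<lambda>d. f (z d))"
proof -
  have "f ` {ed b i d | b i d. b \<in> Br \<and> i < len b} = {f (ed b i d) | b i d. b \<in> Br \<and> i < len b}"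
    by blast
  moreover have "f ` {z True, z False} = range (\<lambda>d. f (z d))" by (auto simp: UNIV_bool)
  ultimately show ?thesis unfolding arcs_eq image_Un by (simp only:)
qed

lemma image_interval_Suc: "f ` {1..k + 1} = {f (Suc i) | i. i \<le> k}"
proof -
  have "{1..k + 1} = Suc ` {..k}" by (simp add: image_Suc_atMost)
  then show ?thesis by (simp only: image_image) blast
qed

lemma image_interval: "f ` {1..k} = {f (Suc i) | i. i < k}"
proof -
  have "{1..k} = Suc ` {..<k}" by (simp add: image_Suc_lessThan)
  then show ?thesis by (simp only: image_image) blast
qed

section \<open>The doubled graph\<close>

text \<open>The ring property is recorded because reversing the isomorphism requires its source to
  be a ring.\<close>

lemma doubled_iso:
  fixes n m a :: nat
  defines "G \<equiv> doubled_graph n m"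
  shows "R_frak G (doubled_rev n m) (arcs G) (edge_poly a) \<simeq>
    RDirProd (matrix_ring (m + n + 2) (L_ring a))
      (RDirProd (matrix_ring (n + 1) rat_ring) (matrix_ring (m + 1) rat_ring))"
    and "ring (R_frak G (doubled_rev n m) (arcs G) (edge_poly a))"
proof -
  \<comment> \<open>Branches 0, 1, 2, 3 are the lines of s', t', s'', t'', with indices counted from
    0; \<open>Z1\<close> joins the last vertices of the first two.\<close>
  define len where "len b = (if b = 0 \<or> b = 2 then n else m)" for b :: nat
  define vx where "vx b i = (if b = 0 then S1 (Suc i) else if b = 1 then T1 (Suc i)
    else if b = 2 then S2 (Suc i) else T2 (Suc i))" for b i :: nat
  define ed where "ed b i d = (if b = 0 then Y1 (Suc i) else if b = 1 then X1 (Suc i)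
    else if b = 2 then Y2 (Suc i) else X2 (Suc i), d)" for b i :: nat and d :: bool
  define z where "z d = (Z1, d)" for d :: bool
  let ?Br = "{0, 1, 2, 3} :: nat set"
  let ?rev = "doubled_rev n m"
  interpret bidirected_digraph G ?rev
    unfolding G_def by (rule bidirected_digraph_doubled_graph)
  interpret branched_graph G ?Br len vx ed z
  proof unfold_locales
    show "finite (verts G)" by (simp add: G_def doubled_graph_def)
    have "{vx b i | b i. b \<in> ?Br \<and> i \<le> len b} = {vx 0 i | i. i \<le> len 0} \<union> {vx 1 i | i. i \<le> len 1}
        \<union> {vx 2 i | i. i \<le> len 2} \<union> {vx 3 i | i. i \<le> len 3}" by blast
    also have "\<dots> = verts G"
      unfolding G_def doubled_graph_def pre_digraph.select_convs image_interval_Suc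
      by (auto simp: vx_def len_def)
    finally show "verts G = {vx b i | b i. b \<in> ?Br \<and> i \<le> len b}" ..
    have "{ed b i d | b i d. b \<in> ?Br \<and> i < len b} = {ed 0 i d | i d. i < len 0} \<union> {ed 1 i d | i d. i < len 1}
        \<union> {ed 2 i d | i d. i < len 2} \<union> {ed 3 i d | i d. i < len 3}" by blast
    also have "\<dots> \<union> {z True, z False} = arcs G"
      unfolding G_def doubled_graph_def pre_digraph.select_convs pos_edges_def image_interval
      by (auto simp: ed_def len_def z_def)
    finally show "arcs G = {ed b i d | b i d. b \<in> ?Br \<and> i < len b} \<union> {z True, z False}" ..
  qed (auto simp: G_def doubled_graph_def vx_def len_def ed_def z_def split: if_splits)
  have rev_ed: "?rev (ed b i d) = ed b i (\<not> d)" if "b \<in> ?Br" "i < len b" for b i d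
    using that by (auto simp: doubled_rev_def pos_edges_def ed_def len_def)
  have rev_z: "?rev (z d) = z (\<not> d)" for d
    by (simp add: doubled_rev_def pos_edges_def z_def)
  have rel_ed: "eval_return G ?rev (edge_poly a (ed b i d)) (ed b i d) = branch_relator b i d"
    if "b \<in> ?Br" "i < len b" for b i d
  proof -
    have "edge_poly a (ed b i d) = [:-1, 1:]"
      by (simp add: ed_def C_poly_3 of_int_hom.map_poly_pCons_hom)
    then show ?thesis
      using that by (simp only:) (subst eval_return_linear,
        auto simp: rev_ed tail_ed head_ed branch_relator_def)
  qed
  let ?c = "map_poly rat_of_int (c_poly a)"
  have rel_z: "eval_return G ?rev (edge_poly a (z d)) (z d) = walk_sum (tail G (z d)) (z_loop d) (tail G (z d)) ?c" for d
  proof -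
    have "edge_poly a (z d) = ?c" by (simp add: z_def)
    then show ?thesis
      by (simp only:) (subst eval_return_eq_walk_sum, auto simp: rev_z tail_z_not)
  qed
  let ?J = "{eval_return G ?rev (edge_poly a y) y | y. y \<in> arcs G}"
  have J: "?J = {branch_relator b i d | b i d. b \<in> ?Br \<and> i < len b} \<union>
      range (\<lambda>d. walk_sum (tail G (z d)) (z_loop d) (tail G (z d)) ?c)"
  proof -
    have "?J = (\<lambda>y. eval_return G ?rev (edge_poly a y) y) ` arcs G" by blast
    also have "\<dots> = {eval_return G ?rev (edge_poly a (ed b i d)) (ed b i d) | b i d. b \<in> ?Br \<and> i < len b} \<union>
        range (\<lambda>d. eval_return G ?rev (edge_poly a (z d)) (z d))"
      by (rule image_arcs)
    also have "{eval_return G ?rev (edge_poly a (ed b i d)) (ed b i d) | b i d. b \<in> ?Br \<and> i < len b} =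
        {branch_relator b i d | b i d. b \<in> ?Br \<and> i < len b}"
      by (intro Collect_cong iff_exI) (metis rel_ed)
    finally show ?thesis unfolding rel_z .
  qed
  have eq: "R_frak G ?rev (arcs G) (edge_poly a) = path_ring Quot Idl\<^bsub>path_ring\<^esub> ?J"
    by (simp only: R_frak_def path_algebra_eq_free_algebra)
  have "path_ring Quot Idl\<^bsub>path_ring\<^esub> ?J \<simeq> RDirProd (matrix_ring (m + n + 2) (rat_poly_ring Quot Idl\<^bsub>rat_poly_ring\<^esub> {?c}))
      (RDirProd (matrix_ring (n + 1) rat_ring) (matrix_ring (m + 1) rat_ring))"
    by (rule doubled_presentation_iso[OF _ _ _ _ _ _ J])
      (use coeff_0_c_poly[of a] in \<open>auto simp: len_def poly_0_coeff_0\<close>)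
  then show "R_frak G ?rev (arcs G) (edge_poly a) \<simeq> RDirProd (matrix_ring (m + n + 2) (L_ring a))
      (RDirProd (matrix_ring (n + 1) rat_ring) (matrix_ring (m + 1) rat_ring))"
    unfolding eq L_ring_def .
  have keys: "Poly_Mapping.keys x \<subseteq> paths G" if "x \<in> ?J" for x
    using that unfolding J by (rule keys_presentation) (rule awalk_z_loop)
  interpret I: algebra_ideal "paths G" path_mult "\<Sum>s\<in>verts G. Poly_Mapping.single (s, [], s) 1"
    "Idl\<^bsub>path_ring\<^esub> ?J"
    by (rule path.algebra_ideal_genideal) (rule keys)
  show "ring (R_frak G ?rev (arcs G) (edge_poly a))"
    unfolding eq by (rule I.quotient_is_ring)
qed

section \<open>The Coxeter graph\<close>

lemma coxeter_iso:
  fixes W :: "('w, 'x) monoid_scheme" and S :: "'w set" and s t :: "nat \<Rightarrow> 'w" and n m a :: nat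
  assumes a: "a \<ge> 4" "even a"
    and cox: "coxeter_system W S"
    and S: "S = s ` {1..n+1} \<union> t ` {1..m+1}"
    and card_S: "card S = n + m + 2"
    and matrix: "\<forall>x\<in>S. \<forall>y\<in>S. coxeter_matrix W x y =
           (if x = y then 1
            else if {x, y} \<in> {{s i, s (i+1)} | i. 1 \<le> i \<and> i \<le> n} \<union> {{t j, t (j+1)} | j. 1 \<le> j \<and> j \<le> m} then 3
            else if {x, y} = {s (n+1), t (m+1)} then enat a
            else 2)"
  shows "R_tilde_hat W S \<simeq>
    RDirProd (matrix_ring (m + n + 2) (L_ring a))
      (RDirProd (matrix_ring (n + 1) rat_ring) (matrix_ring (m + 1) rat_ring))"
proof -
  define len where "len b = (if b = 0 then n else m)" for b :: nat
  define vx where "vx b i = (if b = 0 then s (Suc i) else t (Suc i))" for b i :: nat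
  define ed where "ed b i d = (if d then (vx b i, vx b (Suc i)) else (vx b (Suc i), vx b i))" for b i :: nat and d :: bool
  define z where "z d = (if d then (s (Suc n), t (Suc m)) else (t (Suc m), s (Suc n)))" for d :: bool
  let ?Br = "{0, 1} :: nat set"
  let ?rev = "coxeter_rev W S"
  let ?G = "coxeter_graph W S"
  interpret bidirected_digraph ?G ?rev by (rule bidirected_digraph_coxeter_graph[OF cox])
  have fin: "finite S" using cox by (simp add: coxeter_system_def)
  \<comment> \<open>\<open>S\<close> has the largest cardinality that n + 1 and m + 1 names allow,
    so both indexings are injective and their images are disjoint.\<close>
  have "card (s ` {1..n+1}) + card (t ` {1..m+1}) = n + m + 2 + card (s ` {1..n+1} \<inter> t ` {1..m+1})"
    using card_Un_Int[of "s ` {1..n+1}" "t ` {1..m+1}"] card_S S by simp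
  moreover have "card (s ` {1..n+1}) \<le> n + 1" "card (t ` {1..m+1}) \<le> m + 1"
    using card_image_le[of "{1..n+1}" s] card_image_le[of "{1..m+1}" t] by simp_all
  ultimately have "card (s ` {1..n+1}) = n + 1" "card (t ` {1..m+1}) = m + 1"
    "card (s ` {1..n+1} \<inter> t ` {1..m+1}) = 0" by linarith+
  then have inj_s: "inj_on s {1..n+1}" and inj_t: "inj_on t {1..m+1}" and disj: "s ` {1..n+1} \<inter> t ` {1..m+1} = {}"
    by (auto intro!: eq_card_imp_inj_on)
  have vx_inj: "b = b' \<and> i = j" if "b \<in> ?Br" "b' \<in> ?Br" "i \<le> len b" "j \<le> len b'" "vx b i = vx b' j" for b b' i j
  proof -
    have s_t: "s (Suc i) \<noteq> t (Suc j)" if "i \<le> n" "j \<le> m" for i j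
    proof -
      have "s (Suc i) \<in> s ` {1..n+1}" "t (Suc j) \<in> t ` {1..m+1}" using that by simp_all
      then show ?thesis using disj by (metis disjoint_iff)
    qed
    have "i = j" if "s (Suc i) = s (Suc j)" "i \<le> n" "j \<le> n"  for i j
      using inj_onD[OF inj_s that(1)] that by simp
    moreover have "i = j" if "t (Suc i) = t (Suc j)" "i \<le> m" "j \<le> m"  for i j
      using inj_onD[OF inj_t that(1)] that by simp
    ultimately show ?thesis using that s_t s_t[symmetric] by (auto simp: vx_def len_def split: if_splits)
  qed
  have S_eq: "S = {vx b i | b i. b \<in> ?Br \<and> i \<le> len b}"
  proof -
    have "{vx b i | b i. b \<in> ?Br \<and> i \<le> len b} = {vx 0 i | i. i \<le> len 0} \<union> {vx 1 i | i. i \<le> len 1}" by blast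
    then show ?thesis unfolding S image_interval_Suc by (simp add: vx_def len_def)
  qed
  have vx_S: "vx b i \<in> S" if "b \<in> ?Br" "i \<le> len b" for b i
    unfolding S_eq using that by blast
  \<comment> \<open>Adjacency with label 3 and with label \<open>a\<close> as unordered pairs;
    \<open>ed\<close> and \<open>z\<close> list their two orientations.\<close>
  define P where "P x y \<longleftrightarrow> (\<exists>b i. b \<in> ?Br \<and> i < len b \<and> {x, y} = {vx b i, vx b (Suc i)})" for x y
  define Q where "Q x y \<longleftrightarrow> {x, y} = {s (Suc n), t (Suc m)}" for x y
  have P_iff: "{x, y} \<in> {{s i, s (i+1)} | i. 1 \<le> i \<and> i \<le> n} \<union> {{t j, t (j+1)} | j. 1 \<le> j \<and> j \<le> m} \<longleftrightarrow> P x y" for x y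
  proof -
    have "(\<exists>i. A = {f i, f (i+1)} \<and> 1 \<le> i \<and> i \<le> k) \<longleftrightarrow> (\<exists>i<k. A = {f (Suc i), f (Suc (Suc i))})"
      for f :: "nat \<Rightarrow> 'w" and k A
      by (auto intro: exI[of _ "Suc _"]) (metis One_nat_def Suc_le_D Suc_le_lessD)
    then show ?thesis by (auto simp: P_def vx_def len_def)
  qed
  have M: "coxeter_matrix W x y = (if x = y then 1 else if P x y then 3 else if Q x y then enat a else 2)"
    if "x \<in> S" "y \<in> S" for x y
    using matrix that unfolding P_iff Q_def by simp
  have P_ed: "P x y \<longleftrightarrow> (\<exists>b i d. b \<in> ?Br \<and> i < len b \<and> (x, y) = ed b i d)" for x y
  proof -
    have "(\<exists>d. (x, y) = ed b i d) \<longleftrightarrow> {x, y} = {vx b i, vx b (Suc i)}" for b i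
      unfolding ed_def ex_bool_eq by (auto simp: doubleton_eq_iff)
    then show ?thesis unfolding P_def by blast
  qed
  have Q_z: "Q x y \<longleftrightarrow> (\<exists>d. (x, y) = z d)" for x y
    unfolding Q_def z_def ex_bool_eq by (auto simp: doubleton_eq_iff)
  have ed_S: "fst (ed b i d) \<in> S \<and> snd (ed b i d) \<in> S \<and> fst (ed b i d) \<noteq> snd (ed b i d)"
    if "b \<in> ?Br" "i < len b" for b i d
  proof -
    have "vx b i \<in> S" "vx b (Suc i) \<in> S" "vx b i \<noteq> vx b (Suc i)"
      using vx_S[OF that(1)] vx_inj[of b b i "Suc i"] that by auto
    then show ?thesis by (simp add: ed_def)
  qed
  have z_S: "fst (z d) \<in> S \<and> snd (z d) \<in> S \<and> fst (z d) \<noteq> snd (z d)" for d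
  proof -
    have "s (Suc n) = vx 0 n" "t (Suc m) = vx 1 m" by (simp_all add: vx_def)
    moreover have "vx 0 n \<in> S" "vx 1 m \<in> S" "vx 0 n \<noteq> vx 1 m"
      using vx_S[of 0 n] vx_S[of 1 m] vx_inj[of 0 1 n m] by (auto simp: len_def)
    ultimately show ?thesis by (simp add: z_def)
  qed
  \<comment> \<open>The ends of \<open>z\<close> lie in different branches, so the clause for label
    3 does not preempt the one for \<open>a\<close>.\<close>
  have z_not_P: "\<not> P (fst (z d)) (snd (z d))" for d
  proof
    assume "P (fst (z d)) (snd (z d))"
    then obtain b i where b: "b \<in> ?Br" "i < len b" "{fst (z d), snd (z d)} = {vx b i, vx b (Suc i)}"
      unfolding P_def by blast
    have "{fst (z d), snd (z d)} = {vx 0 n, vx 1 m}" by (auto simp: z_def vx_def)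
    with b(3) have mem: "vx 0 n \<in> {vx b i, vx b (Suc i)}" "vx 1 m \<in> {vx b i, vx b (Suc i)}"
      by (metis insertI1 insertI2 singletonI)+
    have range: "\<exists>j\<le>len b. y = vx b j" if "y \<in> {vx b i, vx b (Suc i)}" for y
      using that b(2) by (auto intro: exI[of _ i] exI[of _ "Suc i"])
    obtain j k where jk: "j \<le> len b" "vx 0 n = vx b j" "k \<le> len b" "vx 1 m = vx b k"
      using range[OF mem(1)] range[OF mem(2)] by blast
    have "0 = b \<and> n = j" by (rule vx_inj[OF _ b(1) _ jk(1,2)]) (simp_all add: len_def)
    moreover have "1 = b \<and> m = k" by (rule vx_inj[OF _ b(1) _ jk(3,4)]) (simp_all add: len_def)
    ultimately show False by simp
  qed
  have three: "\<not> (3 :: enat) \<le> 1" "\<not> (3 :: enat) \<le> 2" "(3 :: enat) \<le> enat a"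
    using a by (simp_all add: numeral_eq_enat one_enat_def)
  have arcs: "arcs ?G = {ed b i d | b i d. b \<in> ?Br \<and> i < len b} \<union> {z True, z False}"
  proof -
    have "(x, y) \<in> arcs ?G \<longleftrightarrow> x \<in> S \<and> y \<in> S \<and> x \<noteq> y \<and> (P x y \<or> Q x y)" for x y
      using M[of x y] three by (auto simp: coxeter_graph_def split: if_splits)
    moreover have "x \<in> S \<and> y \<in> S \<and> x \<noteq> y" if "P x y \<or> Q x y" for x y
      using that ed_S z_S unfolding P_ed Q_z by (metis fst_conv snd_conv)
    ultimately have "(x, y) \<in> arcs ?G \<longleftrightarrow> P x y \<or> Q x y" for x y by blast
    then have "arcs ?G = {(x, y). P x y \<or> Q x y}" by auto
    then show ?thesis unfolding P_ed Q_z ex_bool_eq by auto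
  qed
  interpret branched_graph ?G ?Br len vx ed z
  proof unfold_locales
    show "finite (verts ?G)" using fin by (simp add: coxeter_graph_def)
    show "verts ?G = {vx b i | b i. b \<in> ?Br \<and> i \<le> len b}"
      using S_eq by (simp add: coxeter_graph_def)
  next
    fix b b' i j assume "b \<in> ?Br" "b' \<in> ?Br" "i \<le> len b" "j \<le> len b'" "vx b i = vx b' j"
    then show "b = b' \<and> i = j" by (rule vx_inj)
  next
    show "arcs ?G = {ed b i d | b i d. b \<in> ?Br \<and> i < len b} \<union> {z True, z False}" by (rule arcs)
  next
    fix b i d
    show "tail ?G (ed b i d) = vx b (if d then i else Suc i)" "head ?G (ed b i d) = vx b (if d then Suc i else i)"
      by (simp_all add: coxeter_graph_def ed_def)
  next
    fix d
    show "tail ?G (z d) = (if d then vx 0 (len 0) else vx 1 (len 1))" "head ?G (z d) = (if d then vx 1 (len 1) else vx 0 (len 0))"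
      by (simp_all add: coxeter_graph_def z_def vx_def len_def)
  qed simp_all
  have rev_ed: "?rev (ed b i d) = ed b i (\<not> d)" if "b \<in> ?Br" "i < len b" for b i d
    using ed_arcs[OF that, of d] by (auto simp: coxeter_rev_def ed_def)
  have rev_z: "?rev (z d) = z (\<not> d)" for d
    using z_arcs[of d] by (auto simp: coxeter_rev_def z_def)
  have swap_ed: "(snd (ed b i d), fst (ed b i d)) = ed b i (\<not> d)" for b i d
    by (simp add: ed_def)
  have swap_z: "(snd (z d), fst (z d)) = z (\<not> d)" for d
    by (simp add: z_def)
  let ?e = "\<lambda>k x y. eval_return ?G ?rev (c_poly k) (y, x)"
  let ?c = "map_poly rat_of_int (c_poly a)"
  \<comment> \<open>Since \<open>a\<close> is even, the only odd label above 2 is 3. Evaluation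
    happens at the reversed edge, but reversal merely permutes the family.\<close>
  have odd_set: "{?e k x y | k x y. x \<in> S \<and> y \<in> S \<and> coxeter_matrix W x y = enat k \<and> 2 < k \<and> odd k} =
      {eval_return ?G ?rev (c_poly 3) (ed b i d) | b i d. b \<in> ?Br \<and> i < len b}" (is "?A = ?B")
  proof
    show "?A \<subseteq> ?B"
    proof
      fix r assume "r \<in> ?A"
      then obtain k x y where *: "r = ?e k x y" "x \<in> S" "y \<in> S" "coxeter_matrix W x y = enat k" "2 < k" "odd k"
        by blast
      then have k: "P x y" "k = 3"
        using M[of x y] a by (auto simp: numeral_eq_enat one_enat_def split: if_splits)
      then obtain b i d where b: "b \<in> ?Br" "i < len b" "(x, y) = ed b i d" unfolding P_ed by blast
      then have "(y, x) = ed b i (\<not> d)" using swap_ed[of b i d] by (metis fst_conv snd_conv)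
      then have "r = eval_return ?G ?rev (c_poly 3) (ed b i (\<not> d))" using *(1) k(2) by (simp only:)
      then show "r \<in> ?B" using b(1,2) by blast
    qed
    show "?B \<subseteq> ?A"
    proof
      fix r assume "r \<in> ?B"
      then obtain b i d where b: "b \<in> ?Br" "i < len b" "r = eval_return ?G ?rev (c_poly 3) (ed b i d)" by blast
      let ?x = "snd (ed b i d)" and ?y = "fst (ed b i d)"
      have "P ?x ?y" unfolding P_ed using b swap_ed by blast
      then have "coxeter_matrix W ?x ?y = enat 3" using M[of ?x ?y] ed_S[OF b(1,2), of d] by (auto simp: numeral_eq_enat)
      moreover have "r = ?e 3 ?x ?y" using b(3) by simp
      ultimately show "r \<in> ?A" using ed_S[OF b(1,2), of d] by fastforce
    qed
  qed
  \<comment> \<open>The only even label above 2 is \<open>a\<close>, so these relators come from the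
    two orientations of \<open>z\<close>, each followed by the evaluation at its reverse.\<close>
  have even_set: "{edge_elt ?G (x, y) \<otimes>\<^bsub>path_algebra ?G\<^esub> ?e k x y | k x y.
        x \<in> S \<and> y \<in> S \<and> coxeter_matrix W x y = enat k \<and> 2 < k \<and> even k} =
      range (\<lambda>d. edge_elt ?G (z d) \<otimes>\<^bsub>path_algebra ?G\<^esub> eval_return ?G ?rev (c_poly a) (z (\<not> d)))" (is "?A' = ?B'")
  proof
    show "?A' \<subseteq> ?B'"
    proof
      fix r assume "r \<in> ?A'"
      then obtain k x y where *: "r = edge_elt ?G (x, y) \<otimes>\<^bsub>path_algebra ?G\<^esub> ?e k x y" "x \<in> S" "y \<in> S"
        "coxeter_matrix W x y = enat k" "2 < k" "even k"
        by blast
      then have k: "Q x y" "k = a"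
        using M[of x y] a by (auto simp: numeral_eq_enat one_enat_def split: if_splits)
      then obtain d where d: "(x, y) = z d" unfolding Q_z by blast
      then have "(y, x) = z (\<not> d)" using swap_z[of d] by (metis fst_conv snd_conv)
      then have "r = edge_elt ?G (z d) \<otimes>\<^bsub>path_algebra ?G\<^esub> eval_return ?G ?rev (c_poly a) (z (\<not> d))"
        using *(1) k(2) d by (simp only:)
      then show "r \<in> ?B'" by (rule range_eqI)
    qed
    show "?B' \<subseteq> ?A'"
    proof
      fix r assume "r \<in> ?B'"
      then obtain d where d: "r = edge_elt ?G (z d) \<otimes>\<^bsub>path_algebra ?G\<^esub> eval_return ?G ?rev (c_poly a) (z (\<not> d))" by blast
      let ?x = "fst (z d)" and ?y = "snd (z d)"
      have "Q ?x ?y" unfolding Q_z by auto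
      then have "coxeter_matrix W ?x ?y = enat a" using M[of ?x ?y] z_S[of d] z_not_P[of d] by auto
      moreover have "r = edge_elt ?G (?x, ?y) \<otimes>\<^bsub>path_algebra ?G\<^esub> ?e a ?x ?y" using d swap_z[of d] by simp
      moreover have "2 < a" using a by simp
      ultimately show "r \<in> ?A'" using z_S[of d] a(2) by blast
    qed
  qed
  let ?J = "coxeter_relators W S"
  have J: "?J = {eval_return ?G ?rev (c_poly 3) (ed b i d) | b i d. b \<in> ?Br \<and> i < len b} \<union>
      range (\<lambda>d. edge_elt ?G (z d) \<otimes>\<^bsub>path_algebra ?G\<^esub> eval_return ?G ?rev (c_poly a) (z (\<not> d)))"
    unfolding coxeter_relators_def Let_def odd_set even_set ..
  have rel_ed: "of_int_coeffs (eval_return ?G ?rev (c_poly 3) (ed b i d)) = branch_relator b i d"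
    if "b \<in> ?Br" "i < len b" for b i d
    unfolding c_poly_3
    by (subst eval_return_linear) (use that in \<open>auto simp: rev_ed tail_ed head_ed branch_relator_def of_int_coeffs_diff\<close>)
  have rel_z: "edge_elt ?G (z d) \<otimes>\<^bsub>path_algebra ?G\<^esub> eval_return ?G ?rev (c_poly a) (z (\<not> d)) =
      walk_sum (tail ?G (z d)) (\<lambda>k. z d # z_loop (\<not> d) k) (head ?G (z d)) (c_poly a)" for d
  proof -
    have "eval_return ?G ?rev (c_poly a) (z (\<not> d)) = walk_sum (head ?G (z d)) (z_loop (\<not> d)) (head ?G (z d)) (c_poly a)"
      by (subst eval_return_eq_walk_sum) (auto simp: rev_z tail_z_not)
    then show ?thesis
      by (simp add: path_algebra_eq_free_algebra edge_elt_def path_mult_walk_sum)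
  qed
  \<comment> \<open>Over the rationals the relations take exactly the form treated in
    \<open>coxeter_presentation_iso\<close>.\<close>
  have J_rat: "of_int_coeffs ` ?J = {branch_relator b i d | b i d. b \<in> ?Br \<and> i < len b} \<union>
      range (\<lambda>d. walk_sum (tail ?G (z d)) (\<lambda>k. z d # z_loop (\<not> d) k) (head ?G (z d)) ?c)"
  proof -
    have "of_int_coeffs ` {eval_return ?G ?rev (c_poly 3) (ed b i d) | b i d. b \<in> ?Br \<and> i < len b} =
        {of_int_coeffs (eval_return ?G ?rev (c_poly 3) (ed b i d)) | b i d. b \<in> ?Br \<and> i < len b}" by blast
    also have "\<dots> = {branch_relator b i d | b i d. b \<in> ?Br \<and> i < len b}"
      by (intro Collect_cong iff_exI) (metis rel_ed)
    finally show ?thesis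
      unfolding J image_Un rel_z image_image of_int_coeffs_walk_sum by simp
  qed
  interpret integral_form "paths ?G" path_mult "\<Sum>s\<in>verts ?G. Poly_Mapping.single (s, [], s) 1"
    path_mult "\<Sum>s\<in>verts ?G. Poly_Mapping.single (s, [], s) 1" ?J
  proof unfold_locales
    fix p q :: "('w, 'w \<times> 'w) path"
    show "of_int_coeffs (path_mult p q) = path_mult p q" by (cases p; cases q) simp
  next
    show "of_int_coeffs (\<Sum>s\<in>verts ?G. Poly_Mapping.single (s, [], s) 1) =
        (\<Sum>s\<in>verts ?G. Poly_Mapping.single (s, [], s) 1)"
      by (simp add: of_int_coeffs_sum)
  next
    fix x assume "x \<in> ?J"
    \<comment> \<open>Supports do not change under extension of coefficients, so they are read off
      from the explicit form in \<open>J_rat\<close>.\<close>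
    then have "of_int_coeffs x \<in> of_int_coeffs ` ?J" by blast
    moreover have "Poly_Mapping.keys y \<subseteq> paths ?G" if "y \<in> of_int_coeffs ` ?J" for y
    proof -
      have walk: "awalk (tail ?G (z d)) (z d # z_loop (\<not> d) k) (head ?G (z d))" for d k
        using awalk_z_loop[where d = "\<not> d" and k = k] by (simp add: awalk_Cons_iff tail_z_not del: awalk_append_iff)
      show ?thesis
        using that unfolding J_rat by (rule keys_presentation) (rule walk)
    qed
    ultimately show "Poly_Mapping.keys x \<subseteq> paths ?G" by (metis keys_of_int_coeffs)
  qed
  have "R_tilde_hat W S \<simeq> path_ring Quot Idl\<^bsub>path_ring\<^esub> (of_int_coeffs ` ?J)"
    using tensor_rat_iso by (simp only: R_tilde_hat_def R_tilde_def path_algebra_eq_free_algebra)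
  moreover have "path_ring Quot Idl\<^bsub>path_ring\<^esub> (of_int_coeffs ` ?J) \<simeq>
      RDirProd (matrix_ring (m + n + 2) (rat_poly_ring Quot Idl\<^bsub>rat_poly_ring\<^esub> {?c}))
        (RDirProd (matrix_ring (n + 1) rat_ring) (matrix_ring (m + 1) rat_ring))"
    by (rule coxeter_presentation_iso[OF _ _ _ _ J_rat])
      (use coeff_0_c_poly[of a] in \<open>auto simp: len_def poly_0_coeff_0\<close>)
  ultimately show ?thesis
    unfolding L_ring_def by (rule ring_iso_trans)
qed

theorem theorem3p5:
  fixes W :: "('w, 'x) monoid_scheme" and S :: "'w set" and s t :: "nat \<Rightarrow> 'w" and n m a :: nat
  assumes "a \<ge> 4" and "even a"
    and "coxeter_system W S"
    and "S = s ` {1..n+1} \<union> t ` {1..m+1}"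
    and "card S = n + m + 2"
    and "\<forall>x\<in>S. \<forall>y\<in>S. coxeter_matrix W x y =
           (if x = y then 1
            else if {x, y} \<in> {{s i, s (i+1)} | i. 1 \<le> i \<and> i \<le> n} \<union> {{t j, t (j+1)} | j. 1 \<le> j \<and> j \<le> m} then 3
            else if {x, y} = {s (n+1), t (m+1)} then enat a
            else 2)"
  shows "R_tilde_hat W S \<simeq>
           R_frak (doubled_graph n m) (doubled_rev n m) (arcs (doubled_graph n m)) (edge_poly a)
       \<and> R_frak (doubled_graph n m) (doubled_rev n m) (arcs (doubled_graph n m)) (edge_poly a) \<simeq>
           RDirProd (matrix_ring (m + n + 2) (L_ring a))
             (RDirProd (matrix_ring (n + 1) rat_ring) (matrix_ring (m + 1) rat_ring))"
  \<comment> \<open>Both algebras are identified with the same product; the first isomorphism goes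
    to it and back along the second.\<close>
  using ring_iso_trans[OF coxeter_iso[OF assms] ring_iso_sym[OF doubled_iso(2,1)]] doubled_iso(1) by blast

end
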